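(* Let $N\ge3$ be odd, $K>0$, and let $z$ be in the interior of $\mathcal A_{\mathrm{regular}}$. For $0<\kappa\ll1$ let the fast vector fields on the coadjoint orbit $\mathcal O^*(z)$ be $X_j=X_j^0+\kappa\boldsymbol v_j$, $j=1,\dots,m$, where $X_j^0(\Omega)=[\Omega,\nabla h_j(\Omega)]$ are Hamiltonian and bracket-generating on $\mathcal O^*(z)$ and $\boldsymbol v_j$ are smooth non-Hamiltonian vector fields on $\mathcal O^*(z)$, satisfying the assumptions in the context, and let $\overline\Pi_{\mathcal E}(K;z),\overline\Pi_{\mathcal Z}(K;z)$ be the averages of the instantaneous nonlinear energy and enstrophy fluxes $\Pi_{\mathcal E}(K;\cdot),\Pi_{\mathcal Z}(K;\cdot)$ over $\mathcal O^*(z)$ with respect to the invariant measure $m_z^\kappa$ of the fast process driven by the $X_j$. Let $\phi_{\mathcal E,K,z},\phi_{\mathcal Z,K,z}$ be the unique $C^2$ solutions on $\mathcal O^*(z)$ of $$L^0_{\mathrm{fast}}\phi_{\mathcal E,K,z}=\Pi_{\mathcal E}(K;\cdot),\quad\int_{\mathcal O^*(z)}\phi_{\mathcal E,K,z}\,dm_{z,\mathrm{KKS}}=0,\qquad L^0_{\mathrm{fast}}\phi_{\mathcal Z,K,z}=\Pi_{\mathcal Z}(K;\cdot),\quad\int_{\mathcal O^*(z)}\phi_{\mathcal Z,K,z}\,dm_{z,\mathrm{KKS}}=0 .$$ If $$\int_{\mathcal O^*(z)}\mathcal R\phi_{\mathcal E,K,z}(\Omega)\,dm_{z,\mathrm{KKS}}(\Omega)\ne0,$$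 then $\overline\Pi_{\mathcal E}(K;z)$ is nonzero for all small enough $\kappa>0$. Similarly, if $$\int_{\mathcal O^*(z)}\mathcal R\phi_{\mathcal Z,K,z}(\Omega)\,dm_{z,\mathrm{KKS}}(\Omega)\ne0,$$ then $\overline\Pi_{\mathcal Z}(K;z)$ is nonzero for all small enough $\kappa>0$.
   Context: $\mathfrak{su}(N)$ is the real Lie algebra of trace-zero anti-Hermitian complex $N\times N$ matrices, $[A,B]=AB-BA$, with inner product $(A,B)=-\operatorname{tr}(AB)$; gradients are with respect to it. Put $\omega_N=e^{-4\pi i/N}$, $F=\mathrm{diag}(1,\omega_N,\dots,\omega_N^{N-1})$, and $H$ the matrix with $H_{j,j+1}=1$ ($1\le j\le N-1$), $H_{N,1}=1$, other entries $0$. $\mathcal K_N=(\mathbb Z/N\mathbb Z)^2\setminus\{(0,0)\}$; each $k\in\mathcal K_N$ is identified with its representative with $k_1,k_2\in\{-\frac{N-1}2,\dots,\frac{N-1}2\}$ and $|k|$ is its Euclidean norm. $J_k=\omega_N^{k_1k_2/2}F^{k_1}H^{k_2}$ (with $k_1k_2/2:=2^{-1}k_1k_2$ in $\mathbb Z/N\mathbb Z$), $L_{k,N}=\frac{N}{4\pi i}J_k$, a basis of the complexification of $\mathfrak{su}(N)$. Every $\Omega\in\mathfrak{su}(N)$ is $\Omega=\sum_{k\in\mathcal K_N}\Omega_kL_{k,N}$ with $\Omega_k\in\mathbb C$. The operator $A$, $AL_{k,N}=|k|^2L_{k,N}$, preserves $\mathfrak{su}(N)$; $\Psi=-A^{-1}\Omega$.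 $\pi(\Omega)=(\operatorname{tr}\Omega^2,\dots,\operatorname{tr}\Omega^N)$, $\mathcal A=\pi(\mathfrak{su}(N))$ (a subset of a real vector space of dimension $N-1$, since $\operatorname{tr}\Omega^k\in i^k\mathbb R$); for $z\in\mathcal A$, $\mathcal O^*(z)=\pi^{-1}(z)$ is a single coadjoint orbit $\{g\Lambda g^{-1}:g\in SU(N)\}$. $\mathcal A_{\mathrm{regular}}$ is the set of $z\in\mathcal A$ for which elements of $\mathcal O^*(z)$ have $N$ distinct eigenvalues. The KKS symplectic form on the orbit is $\omega_{\mathrm{KKS}}([X,\Omega],[Y,\Omega])=(\Omega,[X,Y])$; $m_{z,\mathrm{KKS}}$ is the associated Liouville volume normalized to a probability measure. Assumptions on the fast dynamics. $h_j$ are smooth functions on $\mathfrak{su}(N)$ and the Lie algebra generated by $X_1^0,\dots,X_m^0$ spans the tangent space of $\mathcal O^*(z)$ at each point; the same bracket-generating condition holds for $X_1,\dots,X_m$, so that the process $d\Omega_t=\sum_jX_j(\Omega_t)\circ dW^{(j)}_t$ (Stratonovich, independent 1-d Brownian motions) has a unique invariant probability measure $m_z^\kappa$ on $\mathcal O^*(z)$. It is assumed that $dm_z^\kappa=(1+\kappa q+O(\kappa^2))\,dm_{z,\mathrm{KKS}}$ with $q\in C^2(\mathcal O^*(z);\mathbb R)$ not identically $0$, $\int q\,dm_{z,\mathrm{KKS}}=0$, and remainder uniform on $\mathcal O^*(z)$. Operators (acting on functions on $\mathcal O^*(z)$; $D$ denotes Fréchet derivatives, computed with any smooth extension to a neighborhood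 in $\mathfrak{su}(N)$): $$L^0_{\mathrm{fast}}V=\tfrac12\sum_{j=1}^m\big[D^2V(X_j^0,X_j^0)+(\nabla V,[DX_j^0](X_j^0))\big],$$ $$\mathcal RV=\sum_{j=1}^mD^2V(X_j^0,\boldsymbol v_j)+\tfrac12\sum_{j=1}^m\big(\nabla V,[DX_j^0](\boldsymbol v_j)+[D\boldsymbol v_j](X_j^0)\big);$$ equivalently, viewing vector fields as derivations, $L^0_{\mathrm{fast}}=\frac12\sum_j(X_j^0)^2$ and $\mathcal R=\frac12\sum_j(X_j^0\boldsymbol v_j+\boldsymbol v_jX_j^0)$. Fluxes: $\mathcal E_{\le K}(\Omega)=\frac12\sum_{k\in\mathcal K_N,|k|\le K}\frac{|\Omega_k|^2}{|k|^2}$, $\mathcal Z_{\le K}(\Omega)=\frac12\sum_{k\in\mathcal K_N,|k|\le K}|\Omega_k|^2$; $\Pi_{\mathcal E}(K;\Omega)=-[D\mathcal E_{\le K}(\Omega)]([\Psi,\Omega])$, $\Pi_{\mathcal Z}(K;\Omega)=-[D\mathcal Z_{\le K}(\Omega)]([\Psi,\Omega])$; $\overline\Pi_{\mathcal E}(K;z)=\int_{\mathcal O^*(z)}\Pi_{\mathcal E}(K;\Omega)dm^\kappa_z(\Omega)$, $\overline\Pi_{\mathcal Z}(K;z)=\int_{\mathcal O^*(z)}\Pi_{\mathcal Z}(K;\Omega)dm^\kappa_z(\Omega)$. *)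

theory Defs
  imports "HOL-Probability.Probability" "HOL-Library.Numeral_Type"
begin

section \<open>The Euclidean space \<open>su(N)\<close>\<close>

text \<open>
  \<open>N\<close> is the cardinality of the index type \<open>'n\<close>; the sort \<open>card2\<close> says \<open>N \<ge> 2\<close>, which makes
  \<open>su(N)\<close> nontrivial and hence an instance of \<open>euclidean_space\<close>.  The class instance carries the
  inner product \<open>(A,B) = - tr (AB)\<close>, so that the library's derivatives and gradients on \<open>'n su\<close>
  are the intrinsic ones of \<open>su(N)\<close>.
\<close>

definition adjoint_mat :: "complex^'n^'n \<Rightarrow> complex^'n^'n" where
  "adjoint_mat A = (\<chi> i j. cnj (A $ j $ i))"

typedef (overloaded) ('n::finite) su = "{A :: complex^'n^'n. adjoint_mat A = - A \<and> trace A = 0}"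
  morphisms mat_of Abs_su
  by (rule exI[of _ 0]) (simp add: adjoint_mat_def trace_def vec_eq_iff)

setup_lifting type_definition_su

lemma mat_of_antiherm: "mat_of A $ j $ i = - cnj (mat_of A $ i $ j)"
proof -
  have "adjoint_mat (mat_of A) $ j $ i = - mat_of A $ j $ i"
    using mat_of[of A] by simp
  thus ?thesis by (simp add: adjoint_mat_def)
qed

lemma trace_mat_of: "trace (mat_of A) = 0"
  using mat_of[of A] by simp

lemma trace_scaleR: "trace (c *\<^sub>R A) = c *\<^sub>R trace (A :: complex^'n^'n)"
  by (simp add: trace_def scaleR_sum_right)

lemma trace_uminus: "trace (- A) = - trace (A :: complex^'n^'n)"
  by (simp add: trace_def sum_negf)

instantiation su :: (finite) real_vector
begin
lift_definition zero_su :: "'a su" is 0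
  by (simp add: adjoint_mat_def trace_def vec_eq_iff)
lift_definition plus_su :: "'a su \<Rightarrow> 'a su \<Rightarrow> 'a su" is "(+)"
  by (auto simp: adjoint_mat_def trace_add vec_eq_iff)
lift_definition minus_su :: "'a su \<Rightarrow> 'a su \<Rightarrow> 'a su" is "(-)"
  by (auto simp: adjoint_mat_def trace_sub vec_eq_iff)
lift_definition uminus_su :: "'a su \<Rightarrow> 'a su" is uminus
  by (auto simp: adjoint_mat_def trace_uminus vec_eq_iff)
lift_definition scaleR_su :: "real \<Rightarrow> 'a su \<Rightarrow> 'a su" is scaleR
  by (auto simp: adjoint_mat_def trace_scaleR vec_eq_iff)
instance
  by standard (transfer, simp add: algebra_simps)+
end

instantiation su :: (finite) real_inner
begin
definition inner_su :: "'a su \<Rightarrow> 'a su \<Rightarrow> real" where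
  "inner_su A B = Re (- trace (mat_of A ** mat_of B))"
definition norm_su :: "'a su \<Rightarrow> real" where "norm_su A = sqrt (inner A A)"
definition sgn_su :: "'a su \<Rightarrow> 'a su" where "sgn_su A = A /\<^sub>R norm A"
definition dist_su :: "'a su \<Rightarrow> 'a su \<Rightarrow> real" where "dist_su A B = norm (A - B)"
definition uniformity_su :: "('a su \<times> 'a su) filter" where
  "uniformity_su = (INF e\<in>{0 <..}. principal {(x, y). dist x y < e})"
definition open_su :: "'a su set \<Rightarrow> bool" where
  "open_su U = (\<forall>x\<in>U. eventually (\<lambda>(x', y). x' = x \<longrightarrow> y \<in> U) uniformity)"

lemma inner_su_ambient: "inner A B = inner (mat_of A) (mat_of B)" for A B :: "'a su"
proof -
  have "trace (mat_of A ** mat_of B)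
      = (\<Sum>i\<in>UNIV. \<Sum>k\<in>UNIV. - (mat_of A $ i $ k * cnj (mat_of B $ i $ k)))"
    unfolding trace_def matrix_matrix_mult_def
    by (simp, intro sum.cong refl) (metis mat_of_antiherm mult_minus_right)
  hence "- trace (mat_of A ** mat_of B)
      = (\<Sum>i\<in>UNIV. \<Sum>k\<in>UNIV. mat_of A $ i $ k * cnj (mat_of B $ i $ k))"
    by (simp add: sum_negf)
  thus ?thesis
    by (simp add: inner_su_def inner_vec_def inner_complex_def)
qed

instance
proof
  fix x y w :: "'a su" and r :: real
  show "inner x y = inner y x" by (simp add: inner_su_ambient inner_commute)
  show "inner (x + y) w = inner x w + inner y w"
    by (simp add: inner_su_ambient plus_su.rep_eq inner_add_left)
  show "inner (scaleR r x) y = r * inner x y"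
    by (simp add: inner_su_ambient scaleR_su.rep_eq)
  show "0 \<le> inner x x" by (simp add: inner_su_ambient)
  show "inner x x = 0 \<longleftrightarrow> x = 0"
    by (simp add: inner_su_ambient mat_of_inject[symmetric] zero_su.rep_eq)
qed (simp_all add: norm_su_def sgn_su_def dist_su_def uniformity_su_def open_su_def)
end

lemma subspace_su: "subspace {A :: complex^'n^'n. adjoint_mat A = - A \<and> trace A = 0}"
  by (auto simp: subspace_def adjoint_mat_def vec_eq_iff trace_add trace_scaleR)
    (simp add: trace_def)

lemma su_nontrivial: "\<exists>A :: ('n::card2) su. A \<noteq> 0"
proof -
  have "2 \<le> CARD('n)" by (rule two_le_card)
  then obtain i j :: 'n where ij: "i \<noteq> j"
    using card_le_Suc0_iff_eq[of "UNIV :: 'n set"] by fastforce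
  define M :: "((complex, 'n) vec, 'n) vec" where
    "M = (\<chi> a b. if a = i \<and> b = j then 1 else if a = j \<and> b = i then -1 else 0)"
  have M: "M \<in> {A. adjoint_mat A = - A \<and> trace A = 0}"
    using ij by (auto simp: M_def adjoint_mat_def vec_eq_iff trace_def intro!: sum.neutral)
  have "M $ i $ j = 1" by (simp add: M_def)
  hence "M \<noteq> 0" by auto
  moreover have "mat_of (Abs_su M) = M" using M by (rule Abs_su_inverse)
  ultimately have "Abs_su M \<noteq> 0"
    by (auto simp: zero_su.rep_eq)
  thus ?thesis by blast
qed

lemma su_orthonormal_basis: "\<exists>B :: ('a::card2) su set. B \<noteq> {} \<and> finite B \<and>
     (\<forall>u\<in>B. \<forall>v\<in>B. inner u v = (if u = v then 1 else 0)) \<and>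
     (\<forall>x. (\<forall>u\<in>B. inner x u = 0) \<longleftrightarrow> x = 0)"
proof -
  let ?S = "{A :: ((complex, 'a) vec, 'a) vec. adjoint_mat A = - A \<and> trace A = 0}"
  obtain B where B: "B \<subseteq> ?S" "pairwise orthogonal B" "\<And>x. x \<in> B \<Longrightarrow> norm x = 1"
    "independent B" "card B = dim ?S" "span B = ?S"
    by (rule orthonormal_basis_subspace[OF subspace_su], rule that) assumption+
  have finB: "finite B" using B(4) by (simp add: independent_imp_finite)
  let ?B = "Abs_su ` B"
  have rep: "mat_of (Abs_su b) = b" if "b \<in> B" for b
    using that B(1) by (auto simp: Abs_su_inverse)
  have on: "inner u v = (if u = v then 1 else 0)" if "u \<in> ?B" "v \<in> ?B" for u v
  proof -
    from that obtain a b where ab: "a \<in> B" "b \<in> B" "u = Abs_su a" "v = Abs_su b" by blast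
    have "inner u v = inner a b" using ab by (simp add: inner_su_ambient rep)
    moreover have "u = v \<longleftrightarrow> a = b" using ab by (metis rep)
    moreover have "inner a b = (if a = b then 1 else 0)"
      using B(2) B(3)[of a] ab
      by (auto simp: pairwise_def orthogonal_def norm_eq_1)
    ultimately show ?thesis by simp
  qed
  have zero: "x = 0" if "\<forall>u\<in>?B. inner x u = 0" for x :: "'a su"
  proof -
    have "orthogonal (mat_of x) b" if "b \<in> B" for b
      using that \<open>\<forall>u\<in>?B. inner x u = 0\<close> by (auto simp: inner_su_ambient rep orthogonal_def)
    moreover have "mat_of x \<in> span B" using mat_of[of x] B(6) by simp
    ultimately have "orthogonal (mat_of x) (mat_of x)"
      using orthogonal_to_span by blast
    thus ?thesis by (metis inner_eq_zero_iff inner_su_ambient orthogonal_def)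
  qed
  have ne: "?B \<noteq> {}"
    using su_nontrivial[where 'n='a] zero by blast
  show ?thesis
    by (rule exI[of _ ?B]) (use ne on zero finB in \<open>auto simp del: image_is_empty\<close>)
qed

instantiation su :: (card2) euclidean_space
begin
definition Basis_su :: "'a su set" where
  "Basis_su = (SOME B. B \<noteq> {} \<and> finite B \<and>
     (\<forall>u\<in>B. \<forall>v\<in>B. inner u v = (if u = v then 1 else 0)) \<and>
     (\<forall>x. (\<forall>u\<in>B. inner x u = 0) \<longleftrightarrow> x = 0))"
instance
  by standard (use someI_ex[OF su_orthonormal_basis[where 'a='a], folded Basis_su_def] in auto)
end

definition lie :: "'n::finite su \<Rightarrow> 'n su \<Rightarrow> 'n su" where
  "lie A B = Abs_su (mat_of A ** mat_of B - mat_of B ** mat_of A)"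

lemma adjoint_mat_mult: "adjoint_mat (A ** B) = adjoint_mat B ** adjoint_mat A"
  by (simp add: adjoint_mat_def matrix_matrix_mult_def vec_eq_iff mult.commute)

lemma mat_of_lie: "mat_of (lie A B) = mat_of A ** mat_of B - mat_of B ** mat_of A"
proof -
  have adj: "adjoint_mat (mat_of A) = - mat_of A" "adjoint_mat (mat_of B) = - mat_of B"
    using mat_of[of A] mat_of[of B] by simp_all
  have neg: "(- M) ** (- L) = M ** L" for M L :: "complex^'a^'a"
    by (simp add: matrix_matrix_mult_def vec_eq_iff)
  have "adjoint_mat (M - L) = adjoint_mat M - adjoint_mat L" for M L :: "complex^'a^'a"
    by (simp add: adjoint_mat_def vec_eq_iff)
  hence "adjoint_mat (mat_of A ** mat_of B - mat_of B ** mat_of A)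
      = - (mat_of A ** mat_of B - mat_of B ** mat_of A)"
    by (simp add: adjoint_mat_mult adj neg)
  moreover have "trace (mat_of A ** mat_of B - mat_of B ** mat_of A) = 0"
    using trace_mul_sym[of "mat_of A" "mat_of B"] by (simp only: trace_sub) simp
  ultimately show ?thesis unfolding lie_def by (simp add: Abs_su_inverse)
qed

section \<open>Derivatives, gradients, smoothness\<close>

abbreviation FD :: "('a::real_normed_vector \<Rightarrow> 'b::real_normed_vector) \<Rightarrow> 'a \<Rightarrow> 'a \<Rightarrow> 'b" where
  "FD f x u \<equiv> frechet_derivative f (at x) u"

definition FD2 :: "('a::real_normed_vector \<Rightarrow> 'b::real_normed_vector) \<Rightarrow> 'a \<Rightarrow> 'a \<Rightarrow> 'a \<Rightarrow> 'b" where
  "FD2 f x u w = FD (\<lambda>y. FD f y w) x u"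

definition grad :: "('a::real_inner \<Rightarrow> real) \<Rightarrow> 'a \<Rightarrow> 'a" where
  "grad f x = (THE g. GDERIV f x :> g)"

text \<open>\<open>C\<^sup>k\<close> on an open set of a finite-dimensional space: the derivative exists and all its
  directional components are \<open>C\<^bsup>k-1\<^esup>\<close>.\<close>

primrec Ck_on :: "nat \<Rightarrow> 'a::real_normed_vector set \<Rightarrow> ('a \<Rightarrow> 'b::real_normed_vector) \<Rightarrow> bool" where
  "Ck_on 0 U f \<longleftrightarrow> continuous_on U f"
| "Ck_on (Suc k) U f \<longleftrightarrow> (\<forall>x\<in>U. f differentiable (at x)) \<and> (\<forall>w. Ck_on k U (\<lambda>x. FD f x w))"

definition smooth_on :: "'a::real_normed_vector set \<Rightarrow> ('a \<Rightarrow> 'b::real_normed_vector) \<Rightarrow> bool" where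
  "smooth_on U f \<longleftrightarrow> (\<forall>k. Ck_on k U f)"

text \<open>
  A \<open>C\<^sup>k\<close> (smooth) function on an embedded submanifold \<open>M\<close> is represented by a function on the
  ambient space that is \<open>C\<^sup>k\<close> (smooth) on some open neighbourhood of \<open>M\<close>, i.e. by an arbitrary
  extension; its values far from \<open>M\<close> play no role.
\<close>

definition Ck_near :: "nat \<Rightarrow> 'a::real_normed_vector set \<Rightarrow> ('a \<Rightarrow> 'b::real_normed_vector) \<Rightarrow> bool" where
  "Ck_near k M f \<longleftrightarrow> (\<exists>U. open U \<and> M \<subseteq> U \<and> Ck_on k U f)"

definition smooth_near :: "'a::real_normed_vector set \<Rightarrow> ('a \<Rightarrow> 'b::real_normed_vector) \<Rightarrow> bool" where
  "smooth_near M f \<longleftrightarrow> (\<exists>U. open U \<and> M \<subseteq> U \<and> smooth_on U f)"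

section \<open>Coadjoint orbits\<close>

primrec mat_power :: "complex^'n^'n \<Rightarrow> nat \<Rightarrow> complex^'n^'n" where
  "mat_power A 0 = mat 1"
| "mat_power A (Suc k) = A ** mat_power A k"

text \<open>The tuple \<open>(tr \<Omega>\<^sup>2, \<dots>, tr \<Omega>\<^sup>N)\<close>, as a sequence vanishing off the indices \<open>2, \<dots>, N\<close>.\<close>

definition casimirs :: "'n::finite su \<Rightarrow> nat \<Rightarrow> complex" where
  "casimirs \<Omega> k = (if 2 \<le> k \<and> k \<le> CARD('n) then trace (mat_power (mat_of \<Omega>) k) else 0)"

definition orbit :: "(nat \<Rightarrow> complex) \<Rightarrow> 'n::finite su set" where
  "orbit z = {\<Omega>. casimirs \<Omega> = z}"

definition eigenvalues :: "complex^'n^'n \<Rightarrow> complex set" where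
  "eigenvalues M = {l. \<exists>x. x \<noteq> 0 \<and> M *v x = l *s x}"

definition A_regular :: "'n::finite itself \<Rightarrow> (nat \<Rightarrow> complex) set" where
  "A_regular _ = {z \<in> range (casimirs :: 'n su \<Rightarrow> _).
     \<forall>\<Omega> \<in> (orbit z :: 'n su set). card (eigenvalues (mat_of \<Omega>)) = CARD('n)}"

text \<open>The real vector space of dimension \<open>N - 1\<close> containing all values of \<^const>\<open>casimirs\<close>;
  the interior of the regular values is taken relative to it.\<close>

definition casimir_space :: "'n::finite itself \<Rightarrow> (nat \<Rightarrow> complex) set" where
  "casimir_space _ = {z. \<forall>k. if 2 \<le> k \<and> k \<le> CARD('n)
     then \<exists>r::real. z k = \<i> ^ k * complex_of_real r else z k = 0}"

definition interior_A_regular :: "'n::finite itself \<Rightarrow> (nat \<Rightarrow> complex) set" where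
  "interior_A_regular T = (top_of_set (casimir_space T)) interior_of (A_regular T)"

definition tangent_space :: "'n::finite su \<Rightarrow> 'n su set" where
  "tangent_space \<Omega> = range (\<lambda>Y. lie Y \<Omega>)"

subsection \<open>Liouville measure of the KKS form\<close>

definition kks_form :: "'n::finite su \<Rightarrow> 'n su \<Rightarrow> 'n su \<Rightarrow> real" where
  "kks_form \<Omega> \<xi> \<eta> = (THE r. \<exists>X Y. \<xi> = lie X \<Omega> \<and> \<eta> = lie Y \<Omega> \<and> r = inner \<Omega> (lie X Y))"

lemma matrix_diff_ldistrib: "A ** (B - C) = A ** B - A ** (C :: complex^'n^'n)"
  by (simp add: matrix_matrix_mult_def vec_eq_iff right_diff_distrib sum_subtractf)

lemma matrix_diff_rdistrib: "(A - B) ** C = A ** C - B ** (C :: complex^'n^'n)"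
  by (simp add: matrix_matrix_mult_def vec_eq_iff left_diff_distrib sum_subtractf)

lemma inner_lie_cyclic: "inner A (lie B C) = inner (lie A B) C"
proof -
  have "trace (mat_of A ** (mat_of C ** mat_of B)) = trace (mat_of B ** mat_of A ** mat_of C)"
    by (metis matrix_mul_assoc trace_mul_sym)
  thus ?thesis
    by (simp add: inner_su_def mat_of_lie trace_sub matrix_diff_ldistrib matrix_diff_rdistrib
        matrix_mul_assoc)
qed

lemma lie_skew: "lie A B = - lie B A"
  by (simp add: mat_of_inject[symmetric] mat_of_lie uminus_su.rep_eq)

lemma kks_form_lie: "kks_form \<Omega> (lie X \<Omega>) (lie Y \<Omega>) = inner \<Omega> (lie X Y)"
proof -
  have pull: "inner \<Omega> (lie U V) = - inner (lie U \<Omega>) V" for U V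
    using inner_lie_cyclic[of \<Omega> U V] by (metis lie_skew inner_minus_left)
  have push: "inner \<Omega> (lie U V) = inner (lie V \<Omega>) U" for U V
    using pull[of V U] by (metis lie_skew inner_minus_right minus_equation_iff)
  have "inner \<Omega> (lie X Y) = inner \<Omega> (lie X' Y')"
    if "lie X \<Omega> = lie X' \<Omega>" "lie Y \<Omega> = lie Y' \<Omega>" for X' Y'
    by (metis pull push that)
  thus ?thesis unfolding kks_form_def
    by (intro the_equality) (blast, metis)
qed

text \<open>Regular orbits have dimension \<open>2n = N (N - 1)\<close>.  A local parametrization has as its domain
  an open subset of \<open>\<real>\<^bsup>2n\<^esup>\<close>, with coordinates indexed by pairs of distinct indices.\<close>

typedef ('n::card2) offdiag = "{p :: 'n \<times> 'n. fst p \<noteq> snd p}"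
proof -
  have "2 \<le> CARD('n)" by (rule two_le_card)
  then obtain i j :: 'n where "i \<noteq> j"
    using card_le_Suc0_iff_eq[of "UNIV :: 'n set"] by fastforce
  thus ?thesis by (intro exI[of _ "(i, j)"]) simp
qed

instance offdiag :: (card2) finite
proof
  have "inj (Rep_offdiag :: 'a offdiag \<Rightarrow> _)" by (simp add: inj_def Rep_offdiag_inject)
  thus "finite (UNIV :: 'a offdiag set)" by (rule finite_imageD[rotated]) simp
qed

text \<open>The \<open>n\<close>-th exterior power \<open>\<omega>\<^sup>\<and>\<^sup>n\<close> evaluated on \<open>e\<^sub>0, \<dots>, e\<^sub>2\<^sub>n\<^sub>-\<^sub>1\<close>, with the convention
  \<open>(\<alpha> \<and> \<beta>)(u, w) = \<alpha>(u) \<beta>(w) - \<alpha>(w) \<beta>(u)\<close> for one-forms.\<close>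

definition wedge_power :: "nat \<Rightarrow> ('a \<Rightarrow> 'a \<Rightarrow> real) \<Rightarrow> (nat \<Rightarrow> 'a) \<Rightarrow> real" where
  "wedge_power n \<omega> e = (\<Sum>p | p permutes {..<2*n}.
      of_int (sign p) * (\<Prod>i<n. \<omega> (e (p (2*i))) (e (p (2*i+1))))) / 2 ^ n"

definition orbit_param :: "'n::card2 su set \<Rightarrow> (real^'n offdiag) set \<Rightarrow> (real^'n offdiag \<Rightarrow> 'n su) \<Rightarrow> bool" where
  "orbit_param M U \<psi> \<longleftrightarrow> open U \<and> smooth_on U \<psi> \<and> inj_on \<psi> U \<and> \<psi> ` U \<subseteq> M \<and>
     (\<forall>x\<in>U. inj (frechet_derivative \<psi> (at x)))"

definition coordinate_enum :: "nat \<Rightarrow> 'i::finite" where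
  "coordinate_enum = (SOME e. bij_betw e {..<CARD('i)} UNIV)"

text \<open>The density of \<open>|\<omega>\<^sup>n / n!|\<close> in a local parametrization (independent of the enumeration of
  the coordinates because of the absolute value).\<close>

definition liouville_density :: "(real^'n offdiag \<Rightarrow> 'n::card2 su) \<Rightarrow> real^'n offdiag \<Rightarrow> real" where
  "liouville_density \<psi> x = (let n = CARD('n offdiag) div 2 in
     \<bar>wedge_power n (kks_form (\<psi> x))
        (\<lambda>i. FD \<psi> x (axis (coordinate_enum i) 1))\<bar> / fact n)"

definition liouville_volume :: "'n::card2 su set \<Rightarrow> 'n su measure \<Rightarrow> bool" where
  "liouville_volume M \<mu> \<longleftrightarrow> sets \<mu> = sets (restrict_space borel M) \<and>
     (\<forall>U \<psi> A. orbit_param M U \<psi> \<longrightarrow> A \<in> sets \<mu> \<longrightarrow> A \<subseteq> \<psi> ` U \<longrightarrow>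
        emeasure \<mu> A = (\<integral>\<^sup>+ x \<in> {x \<in> U. \<psi> x \<in> A}. ennreal (liouville_density \<psi> x) \<partial>lborel))"

definition kks_probability :: "'n::card2 su set \<Rightarrow> 'n su measure \<Rightarrow> bool" where
  "kks_probability M m0 \<longleftrightarrow> prob_space m0 \<and>
     (\<exists>\<mu>. liouville_volume M \<mu> \<and> m0 = scale_measure (inverse (emeasure \<mu> M)) \<mu>)"

section \<open>The sine basis and the fluxes\<close>

text \<open>The position \<open>0, \<dots>, N - 1\<close> of a matrix index with respect to the order of \<open>'n\<close>.\<close>

definition idx :: "'n::{finite,linorder} \<Rightarrow> nat" where
  "idx i = card {j. j < i}"

definition omega_N :: "'n::finite itself \<Rightarrow> complex" where
  "omega_N _ = exp (- (4 * of_real pi * \<i>) / of_nat CARD('n))"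

definition F_mat :: "complex^'n::{finite,linorder}^'n::{finite,linorder}" where
  "F_mat = (\<chi> i j. if i = j then omega_N TYPE('n) ^ idx i else 0)"

definition H_mat :: "complex^'n::{finite,linorder}^'n::{finite,linorder}" where
  "H_mat = (\<chi> i j. if idx j = (idx i + 1) mod CARD('n) then 1 else 0)"

definition modes :: "'n::finite itself \<Rightarrow> (int \<times> int) set" where
  "modes _ = (let r = (int CARD('n) - 1) div 2 in ({-r..r} \<times> {-r..r}) - {(0, 0)})"

definition normsq :: "int \<times> int \<Rightarrow> real" where
  "normsq k = of_int (fst k)^2 + of_int (snd k)^2"

text \<open>\<open>\<omega>\<^sub>N\<close>, \<open>F\<close> and \<open>H\<close> all have order dividing \<open>N\<close>, so exponents are reduced modulo \<open>N\<close>;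
  \<open>(N + 1) div 2\<close> is the inverse of 2 modulo the odd number \<open>N\<close>.\<close>

definition c_scale :: "complex \<Rightarrow> complex^'n^'n \<Rightarrow> complex^'n^'n" where
  "c_scale c M = (\<chi> i j. c * M $ i $ j)"

definition J_mat :: "int \<times> int \<Rightarrow> complex^'n::{finite,linorder}^'n::{finite,linorder}" where
  "J_mat k = (let N = int CARD('n) in
     c_scale (omega_N TYPE('n) ^ nat ((((N + 1) div 2) * (fst k * snd k)) mod N))
       (mat_power F_mat (nat (fst k mod N)) ** mat_power H_mat (nat (snd k mod N))))"

definition L_mat :: "int \<times> int \<Rightarrow> complex^'n::{finite,linorder}^'n::{finite,linorder}" where
  "L_mat k = c_scale (of_nat CARD('n) / (4 * of_real pi * \<i>)) (J_mat k)"

definition coeff_fun :: "'n::{finite,linorder} su \<Rightarrow> int \<times> int \<Rightarrow> complex" where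
  "coeff_fun \<Omega> = (THE c. (\<forall>k. k \<notin> modes TYPE('n) \<longrightarrow> c k = 0) \<and>
     mat_of \<Omega> = (\<Sum>k\<in>modes TYPE('n). c_scale (c k) (L_mat k)))"

definition op_A :: "'n::{finite,linorder} su \<Rightarrow> 'n su" where
  "op_A \<Omega> = Abs_su (\<Sum>k\<in>modes TYPE('n). c_scale (of_real (normsq k) * coeff_fun \<Omega> k) (L_mat k))"

definition Psi :: "'n::{finite,linorder} su \<Rightarrow> 'n su" where
  "Psi \<Omega> = - inv op_A \<Omega>"

definition energy_upto :: "real \<Rightarrow> 'n::{finite,linorder} su \<Rightarrow> real" where
  "energy_upto K \<Omega> =
     (\<Sum>k | k \<in> modes TYPE('n) \<and> sqrt (normsq k) \<le> K. (cmod (coeff_fun \<Omega> k))^2 / normsq k) / 2"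

definition enstrophy_upto :: "real \<Rightarrow> 'n::{finite,linorder} su \<Rightarrow> real" where
  "enstrophy_upto K \<Omega> =
     (\<Sum>k | k \<in> modes TYPE('n) \<and> sqrt (normsq k) \<le> K. (cmod (coeff_fun \<Omega> k))^2) / 2"

definition energy_flux :: "real \<Rightarrow> 'n::{finite,linorder} su \<Rightarrow> real" where
  "energy_flux K \<Omega> = - FD (energy_upto K) \<Omega> (lie (Psi \<Omega>) \<Omega>)"

definition enstrophy_flux :: "real \<Rightarrow> 'n::{finite,linorder} su \<Rightarrow> real" where
  "enstrophy_flux K \<Omega> = - FD (enstrophy_upto K) \<Omega> (lie (Psi \<Omega>) \<Omega>)"

section \<open>Vector fields and operators\<close>

definition ham_field :: "('n::finite su \<Rightarrow> real) \<Rightarrow> 'n su \<Rightarrow> 'n su" where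
  "ham_field h \<Omega> = lie \<Omega> (grad h \<Omega>)"

definition perturbed_field ::
    "(nat \<Rightarrow> 'n::finite su \<Rightarrow> real) \<Rightarrow> (nat \<Rightarrow> 'n su \<Rightarrow> 'n su) \<Rightarrow> real \<Rightarrow> nat \<Rightarrow> 'n su \<Rightarrow> 'n su" where
  "perturbed_field h v \<kappa> j \<Omega> = ham_field (h j) \<Omega> + \<kappa> *\<^sub>R v j \<Omega>"

definition hamiltonian_on :: "'n::finite su set \<Rightarrow> ('n su \<Rightarrow> 'n su) \<Rightarrow> bool" where
  "hamiltonian_on M v \<longleftrightarrow> (\<exists>g. smooth_near M g \<and> (\<forall>\<Omega>\<in>M. v \<Omega> = ham_field g \<Omega>))"

inductive_set generated_lie_algebra :: "('a::real_normed_vector \<Rightarrow> 'a) set \<Rightarrow> ('a \<Rightarrow> 'a) set"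
  for S where
  gen: "X \<in> S \<Longrightarrow> X \<in> generated_lie_algebra S"
| add: "X \<in> generated_lie_algebra S \<Longrightarrow> Y \<in> generated_lie_algebra S \<Longrightarrow>
    (\<lambda>x. X x + Y x) \<in> generated_lie_algebra S"
| scale: "X \<in> generated_lie_algebra S \<Longrightarrow> (\<lambda>x. c *\<^sub>R X x) \<in> generated_lie_algebra S"
| bracket: "X \<in> generated_lie_algebra S \<Longrightarrow> Y \<in> generated_lie_algebra S \<Longrightarrow>
    (\<lambda>x. FD Y x (X x) - FD X x (Y x)) \<in> generated_lie_algebra S"

definition bracket_generating ::
    "'n::finite su set \<Rightarrow> nat \<Rightarrow> (nat \<Rightarrow> 'n su \<Rightarrow> 'n su) \<Rightarrow> bool" where
  "bracket_generating M m X \<longleftrightarrow>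
     (\<forall>\<Omega>\<in>M. span ((\<lambda>V. V \<Omega>) ` generated_lie_algebra (X ` {..<m})) = tangent_space \<Omega>)"

definition L_fast :: "nat \<Rightarrow> (nat \<Rightarrow> 'n::finite su \<Rightarrow> 'n su) \<Rightarrow> ('n su \<Rightarrow> real) \<Rightarrow> 'n su \<Rightarrow> real" where
  "L_fast m X V \<Omega> = (1/2) * (\<Sum>j<m. FD2 V \<Omega> (X j \<Omega>) (X j \<Omega>) +
      inner (grad V \<Omega>) (FD (X j) \<Omega> (X j \<Omega>)))"

definition R_op :: "nat \<Rightarrow> (nat \<Rightarrow> 'n::finite su \<Rightarrow> 'n su) \<Rightarrow> (nat \<Rightarrow> 'n su \<Rightarrow> 'n su)
    \<Rightarrow> ('n su \<Rightarrow> real) \<Rightarrow> 'n su \<Rightarrow> real" where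
  "R_op m X v V \<Omega> = (\<Sum>j<m. FD2 V \<Omega> (X j \<Omega>) (v j \<Omega>)) +
     (1/2) * (\<Sum>j<m. inner (grad V \<Omega>) (FD (X j) \<Omega> (v j \<Omega>) + FD (v j) \<Omega> (X j \<Omega>)))"

section \<open>Stratonovich equations and their invariant measures\<close>

definition brownian_motions ::
    "'w measure \<Rightarrow> (real \<Rightarrow> 'w measure) \<Rightarrow> nat \<Rightarrow> (nat \<Rightarrow> real \<Rightarrow> 'w \<Rightarrow> real) \<Rightarrow> bool" where
  "brownian_motions P F m W \<longleftrightarrow>
     prob_space P \<and> filtration (space P) F \<and> (\<forall>t. subalgebra P (F t)) \<and>
     (\<forall>j<m. \<forall>w\<in>space P. W j 0 w = 0 \<and> continuous_on {0..} (\<lambda>t. W j t w)) \<and>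
     (\<forall>j<m. \<forall>t\<ge>0. W j t \<in> borel_measurable (F t)) \<and>
     (\<forall>s\<ge>0. \<forall>t>s.
        (\<forall>j<m. distributed P lborel (\<lambda>w. W j t w - W j s w) (normal_density 0 (sqrt (t - s)))) \<and>
        \<comment> \<open>the increments are jointly independent, also of the past \<open>F s\<close> (index \<open>m\<close>)\<close>
        prob_space.indep_sets P
          (\<lambda>j. if j = m then sets (F s)
               else {(\<lambda>w. W j t w - W j s w) -` B \<inter> space P | B. B \<in> sets borel}) {..m})"

definition partition_upto :: "real \<Rightarrow> nat \<Rightarrow> (nat \<Rightarrow> real) \<Rightarrow> bool" where
  "partition_upto t n \<tau> \<longleftrightarrow> \<tau> 0 = 0 \<and> \<tau> n = t \<and> (\<forall>i<n. \<tau> i \<le> \<tau> (Suc i))"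

text \<open>Convergence in probability of sums \<open>S n \<tau>\<close> over partitions of \<open>[0,t]\<close>, as the mesh tends to 0.\<close>

definition riemann_lim_in_prob ::
    "'w measure \<Rightarrow> real \<Rightarrow> (nat \<Rightarrow> (nat \<Rightarrow> real) \<Rightarrow> 'w \<Rightarrow> 'b::metric_space) \<Rightarrow> ('w \<Rightarrow> 'b) \<Rightarrow> bool" where
  "riemann_lim_in_prob P t S I \<longleftrightarrow> I \<in> borel_measurable P \<and>
     (\<forall>\<epsilon>>0. \<exists>\<delta>>0. \<forall>n \<tau>. partition_upto t n \<tau> \<longrightarrow> (\<forall>i<n. \<tau> (Suc i) - \<tau> i < \<delta>) \<longrightarrow>
        measure P {w \<in> space P. dist (S n \<tau> w) (I w) > \<epsilon>} < \<epsilon>)"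

text \<open>The Ito integral of a continuous adapted integrand.\<close>

definition ito_integral :: "'w measure \<Rightarrow> (real \<Rightarrow> 'w \<Rightarrow> 'b::real_normed_vector)
    \<Rightarrow> (real \<Rightarrow> 'w \<Rightarrow> real) \<Rightarrow> (real \<Rightarrow> 'w \<Rightarrow> 'b) \<Rightarrow> bool" where
  "ito_integral P Y W I \<longleftrightarrow> (\<forall>t\<ge>0. riemann_lim_in_prob P t
     (\<lambda>n \<tau> w. \<Sum>i<n. (W (\<tau> (Suc i)) w - W (\<tau> i) w) *\<^sub>R Y (\<tau> i) w) (I t))"

text \<open>The covariation process of continuous semimartingales: a continuous process of locally
  bounded variation.\<close>

definition covariation :: "'w measure \<Rightarrow> (real \<Rightarrow> 'w \<Rightarrow> 'b::real_normed_vector)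
    \<Rightarrow> (real \<Rightarrow> 'w \<Rightarrow> real) \<Rightarrow> (real \<Rightarrow> 'w \<Rightarrow> 'b) \<Rightarrow> bool" where
  "covariation P Y W C \<longleftrightarrow>
     (\<forall>t\<ge>0. riemann_lim_in_prob P t
       (\<lambda>n \<tau> w. \<Sum>i<n. (W (\<tau> (Suc i)) w - W (\<tau> i) w) *\<^sub>R (Y (\<tau> (Suc i)) w - Y (\<tau> i) w)) (C t)) \<and>
     (\<forall>w\<in>space P. continuous_on {0..} (\<lambda>t. C t w)) \<and>
     (\<forall>w\<in>space P. \<forall>t\<ge>0. \<exists>B. \<forall>n \<tau>. partition_upto t n \<tau> \<longrightarrow>
        (\<Sum>i<n. norm (C (\<tau> (Suc i)) w - C (\<tau> i) w)) \<le> B)"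

text \<open>\<open>\<integral> Y \<circ> dW = \<integral> Y dW + (1/2) [Y,W]\<close>, equivalently the limit of the sums with the symmetric
  averages \<open>(Y\<^sub>i + Y\<^sub>i\<^sub>+\<^sub>1) / 2\<close>.\<close>

definition stratonovich_integral :: "'w measure \<Rightarrow> (real \<Rightarrow> 'w \<Rightarrow> 'b::real_normed_vector)
    \<Rightarrow> (real \<Rightarrow> 'w \<Rightarrow> real) \<Rightarrow> (real \<Rightarrow> 'w \<Rightarrow> 'b) \<Rightarrow> bool" where
  "stratonovich_integral P Y W J \<longleftrightarrow> (\<exists>I C. ito_integral P Y W I \<and> covariation P Y W C \<and>
     (\<forall>t\<ge>0. AE w in P. J t w = I t w + (1/2) *\<^sub>R C t w))"

definition stratonovich_solution ::
    "'w measure \<Rightarrow> (real \<Rightarrow> 'w measure) \<Rightarrow> nat \<Rightarrow> (nat \<Rightarrow> real \<Rightarrow> 'w \<Rightarrow> real) \<Rightarrow>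
     'a::euclidean_space set \<Rightarrow> (nat \<Rightarrow> 'a \<Rightarrow> 'a) \<Rightarrow> 'a \<Rightarrow> (real \<Rightarrow> 'w \<Rightarrow> 'a) \<Rightarrow> bool" where
  "stratonovich_solution P F m W M X x Y \<longleftrightarrow>
     (\<forall>t\<ge>0. Y t \<in> F t \<rightarrow>\<^sub>M restrict_space borel M) \<and>
     (\<forall>w\<in>space P. Y 0 w = x \<and> continuous_on {0..} (\<lambda>t. Y t w)) \<and>
     (\<exists>J. (\<forall>j<m. stratonovich_integral P (\<lambda>t w. X j (Y t w)) (W j) (J j)) \<and>
          (\<forall>t\<ge>0. AE w in P. Y t w = x + (\<Sum>j<m. J j t w)))"

text \<open>The Markov process on \<open>M\<close> driven by the fields \<open>X\<close>: the family of solutions \<open>Y x\<close> started at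
  the points \<open>x\<close> of \<open>M\<close>, whose laws at time \<open>t\<close> form a probability kernel.\<close>

definition transition_kernel ::
    "'w measure \<Rightarrow> 'a::euclidean_space set \<Rightarrow> ('a \<Rightarrow> real \<Rightarrow> 'w \<Rightarrow> 'a) \<Rightarrow> real \<Rightarrow> 'a \<Rightarrow> 'a measure" where
  "transition_kernel P M Y t x = distr P (restrict_space borel M) (Y x t)"

definition stratonovich_process ::
    "'w measure \<Rightarrow> (real \<Rightarrow> 'w measure) \<Rightarrow> nat \<Rightarrow> (nat \<Rightarrow> real \<Rightarrow> 'w \<Rightarrow> real) \<Rightarrow>
     'a::euclidean_space set \<Rightarrow> (nat \<Rightarrow> 'a \<Rightarrow> 'a) \<Rightarrow> ('a \<Rightarrow> real \<Rightarrow> 'w \<Rightarrow> 'a) \<Rightarrow> bool" where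
  "stratonovich_process P F m W M X Y \<longleftrightarrow>
     (\<forall>x\<in>M. stratonovich_solution P F m W M X x (Y x)) \<and>
     (\<forall>t\<ge>0. transition_kernel P M Y t \<in> restrict_space borel M \<rightarrow>\<^sub>M prob_algebra (restrict_space borel M))"

definition invariant_probability ::
    "'w measure \<Rightarrow> 'a::euclidean_space set \<Rightarrow> ('a \<Rightarrow> real \<Rightarrow> 'w \<Rightarrow> 'a) \<Rightarrow> 'a measure \<Rightarrow> bool" where
  "invariant_probability P M Y \<mu> \<longleftrightarrow> prob_space \<mu> \<and> sets \<mu> = sets (restrict_space borel M) \<and>
     (\<forall>t\<ge>0. (\<mu> \<bind> transition_kernel P M Y t) = \<mu>)"

end

(*
Invariance of m\<kappa> under the fast process means that the expectation of f(Y_t), averaged over the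
starting point, does not depend on t.  Differentiating at t = 0 shows that the integral of L\<kappa> f
against m\<kappa> vanishes for every C^2 function f, where L\<kappa> is the generator of the perturbed fields.
Since L\<kappa> = L0 + \<kappa> R + \<kappa>^2 S with a bounded remainder S \<phi>, choosing f = \<phi> with L0 \<phi> equal to the flux
yields: the average of the flux against m\<kappa> is -\<kappa> times the integral of R \<phi> + \<kappa> S \<phi>, and by the
density expansion this is -\<kappa> times the integral of R \<phi> against the KKS measure, up to O(\<kappa>^2).

The differentiation at t = 0 is done for one starting point at a time.  The Ito integrals are
compared with X_j(x) W_j(t) by the Ito isometry; the covariations are limits of Riemann sums of the
drift DX_j(X_j); a second-order Taylor expansion then needs only the moments of Brownian motion.
*)
theory Submission
  imports Defs
begin

text \<open>The stochastic integrals are given only as limits in probability of Riemann sums, and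
  the covariations moreover as continuous processes with paths of bounded variation. Each second
  moment therefore passes from the sums to the limit by Fatou's lemma, and each mean by uniform
  integrability. Invariance enters only at the times 1/(n+1): there the difference quotients of
  \<phi> average exactly to zero, so their pointwise limit and a bound independent of the starting
  point are enough for dominated convergence. Compactness of the orbit supplies the bound.

  Two obstacles shape the estimates. Since \<phi> is merely C^2, its second-order Taylor remainder
  is o(|d|^2) without a rate, and a crude bound for long increments calls for fourth moments, which
  are at hand only for the Gaussian part of the increment. Moreover the increments of X_j(Y_t)
  contain those of the very covariations that are to be identified, so that no moment bound for
  these may be assumed beforehand. All derivatives are those of one extension to an open
  neighbourhood of the orbit; the equation for the flux enters on the orbit itself, where the
  measures live.\<close>

section \<open>Taylor expansions on a neighbourhood of a compact set\<close>

lemma Ck_on_FD: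
  "Ck_on (Suc k) U f \<Longrightarrow> x \<in> U \<Longrightarrow> (f has_derivative frechet_derivative f (at x)) (at x)"
  using frechet_derivative_works by auto

lemma Ck_on_differentiable_imp_continuous:
  assumes "Ck_on (Suc k) U f" shows "continuous_on U f"
  by (rule continuous_at_imp_continuous_on) (meson Ck_on_FD[OF assms] has_derivative_continuous)

lemma Ck_on_mono: "Ck_on k U f \<Longrightarrow> j \<le> k \<Longrightarrow> Ck_on j U f"
proof (induction j arbitrary: k f)
  case 0
  then show ?case by (cases k) (auto dest: Ck_on_differentiable_imp_continuous simp del: Ck_on.simps(2))
next
  case (Suc j)
  then obtain k' where "k = Suc k'" by (cases k) auto
  with Suc show ?case by auto
qed

lemma Ck_on_subset: "Ck_on k U f \<Longrightarrow> V \<subseteq> U \<Longrightarrow> Ck_on k V f"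
  by (induction k arbitrary: f) (auto intro: continuous_on_subset)

lemma linear_FD: "Ck_on (Suc k) U f \<Longrightarrow> x \<in> U \<Longrightarrow> linear (\<lambda>w. FD f x w)"
  using Ck_on_FD has_derivative_linear by blast

text \<open>Continuity in \<open>Ck_on\<close> is stated for one fixed direction at a time.
  Statements uniform in the direction are reduced to the finitely many basis directions through this
  expansion.\<close>

lemma FD_basis:
  fixes f :: "'a::euclidean_space \<Rightarrow> 'b::real_normed_vector"
  assumes "Ck_on (Suc k) U f" "x \<in> U"
  shows "FD f x w = (\<Sum>b\<in>Basis. inner w b *\<^sub>R FD f x b)"
proof -
  interpret linear "\<lambda>w. FD f x w" by (rule linear_FD[OF assms])
  have "FD f x w = FD f x (\<Sum>b\<in>Basis. inner w b *\<^sub>R b)" by (simp add: euclidean_representation)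
  thus ?thesis by (simp add: sum scale)
qed

lemma linear_norm_le_basis:
  fixes L :: "'a::euclidean_space \<Rightarrow> 'b::real_normed_vector"
  assumes "\<And>w. L w = (\<Sum>b\<in>Basis. inner w b *\<^sub>R L b)"
  shows "norm (L w) \<le> (\<Sum>b\<in>Basis. norm (L b)) * norm w"
proof -
  have "norm (L w) \<le> (\<Sum>b\<in>Basis. norm (inner w b *\<^sub>R L b))"
    by (subst assms) (rule norm_sum)
  also have "\<dots> \<le> (\<Sum>b\<in>Basis. norm (L b) * norm w)"
  proof (rule sum_mono)
    fix b :: 'a assume "b \<in> Basis"
    from mult_right_mono[OF Basis_le_norm[OF this, of w], of "norm (L b)"]
    show "norm (inner w b *\<^sub>R L b) \<le> norm (L b) * norm w" by (simp add: mult.commute)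
  qed
  finally show ?thesis by (simp add: sum_distrib_right)
qed

lemma FD_continuous:
  assumes "Ck_on (Suc k) U f" shows "continuous_on U (\<lambda>x. FD f x w)"
  using assms Ck_on_mono[of k U "\<lambda>x. FD f x w" 0] by simp

lemma FD_bound:
  fixes f :: "'a::euclidean_space \<Rightarrow> 'b::real_normed_vector"
  assumes f: "Ck_on (Suc k) U f" and N: "compact N" "N \<subseteq> U"
  obtains K where "K \<ge> 0" "\<And>x w. x \<in> N \<Longrightarrow> norm (FD f x w) \<le> K * norm w"
proof -
  let ?g = "\<lambda>x. \<Sum>b\<in>Basis. norm (FD f x b)"
  have "continuous_on N ?g"
    by (intro continuous_intros continuous_on_subset[OF FD_continuous[OF f] N(2)])
  then have "bounded (?g ` N)" using N compact_continuous_image compact_imp_bounded by blast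
  then obtain K where K: "K > 0" "\<And>x. x \<in> N \<Longrightarrow> norm (?g x) \<le> K"
    unfolding bounded_pos by auto
  have "norm (FD f x w) \<le> K * norm w" if "x \<in> N" for x w
  proof -
    have "norm (FD f x w) \<le> ?g x * norm w"
      using FD_basis[OF f] that N(2) by (intro linear_norm_le_basis) auto
    also have "\<dots> \<le> K * norm w" using K(2)[OF that] by (intro mult_right_mono) auto
    finally show ?thesis .
  qed
  with K(1) show ?thesis by (intro that[of K]) auto
qed

lemma Ck_on_imp_FD: "Ck_on (Suc k) U f \<Longrightarrow> Ck_on k U (\<lambda>x. FD f x w)"
  by simp

text \<open>In \<open>FD2 f x u w\<close> the direction \<open>w\<close> is frozen while
  \<open>FD f y w\<close> is differentiated in \<open>y\<close>, so linearity in \<open>u\<close> is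
  immediate but linearity in \<open>w\<close> is not. It holds because the basis expansion of
  \<open>FD f y w\<close> is valid for all \<open>y\<close> near \<open>x\<close>, which is where
  openness of \<open>U\<close> enters.\<close>

lemma FD2_basis_right:
  fixes f :: "'a::euclidean_space \<Rightarrow> 'b::real_normed_vector"
  assumes f: "Ck_on (Suc (Suc k)) U f" and U: "open U" "x \<in> U"
  shows "FD2 f x u w = (\<Sum>b\<in>Basis. inner w b *\<^sub>R FD2 f x u b)"
proof -
  have "((\<lambda>y. \<Sum>b\<in>Basis. inner w b *\<^sub>R FD f y b) has_derivative
      (\<lambda>u. \<Sum>b\<in>Basis. inner w b *\<^sub>R FD2 f x u b)) (at x)"
    unfolding FD2_def
    by (intro has_derivative_sum has_derivative_scaleR_right Ck_on_FD[OF Ck_on_imp_FD[OF f] U(2)])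
  then have "((\<lambda>y. FD f y w) has_derivative (\<lambda>u. \<Sum>b\<in>Basis. inner w b *\<^sub>R FD2 f x u b)) (at x)"
    by (rule has_derivative_transform_within_open[OF _ U]) (rule FD_basis[OF f, symmetric])
  from frechet_derivative_at[OF this, THEN fun_cong, of u] show ?thesis
    by (subst FD2_def) (rule sym)
qed

lemma linear_FD2_right:
  fixes f :: "'a::euclidean_space \<Rightarrow> 'b::real_normed_vector"
  assumes f: "Ck_on (Suc (Suc k)) U f" and U: "open U" "x \<in> U"
  shows "linear (FD2 f x u)"
proof (rule linearI)
  note E = FD2_basis_right[OF f U, of u]
  show "FD2 f x u (a + b) = FD2 f x u a + FD2 f x u b" for a b
    by (simp add: E[of "a + b"] E[of a] E[of b] inner_add_left scaleR_left_distrib sum.distrib)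
  show "FD2 f x u (r *\<^sub>R a) = r *\<^sub>R FD2 f x u a" for r a
    by (simp add: E[of "r *\<^sub>R a"] E[of a] scaleR_sum_right)
qed

lemma linear_FD2_left:
  assumes f: "Ck_on (Suc (Suc k)) U f" and U: "x \<in> U"
  shows "linear (\<lambda>u. FD2 f x u w)"
  unfolding FD2_def by (rule linear_FD[OF Ck_on_imp_FD[OF f] U])

lemma FD2_bound:
  fixes f :: "'a::euclidean_space \<Rightarrow> 'b::real_normed_vector"
  assumes f: "Ck_on (Suc (Suc k)) U f" and U: "open U" and N: "compact N" "N \<subseteq> U"
  obtains K where "K \<ge> 0" "\<And>x u w. x \<in> N \<Longrightarrow> norm (FD2 f x u w) \<le> K * norm u * norm w"
proof -
  have "\<exists>K\<ge>0. \<forall>x\<in>N. \<forall>u. norm (FD2 f x u b) \<le> K * norm u" for b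
    using FD_bound[OF Ck_on_imp_FD[OF f] N, of b] unfolding FD2_def by metis
  then obtain K where K: "\<And>b. K b \<ge> 0" "\<And>b x u. x \<in> N \<Longrightarrow> norm (FD2 f x u b) \<le> K b * norm u"
    by metis
  have "norm (FD2 f x u w) \<le> (\<Sum>b\<in>Basis. K b) * norm u * norm w" if "x \<in> N" for x u w
  proof -
    have "norm (FD2 f x u w) \<le> (\<Sum>b\<in>Basis. norm (FD2 f x u b)) * norm w"
      using FD2_basis_right[OF f U] that N by (intro linear_norm_le_basis) auto
    also have "\<dots> \<le> (\<Sum>b\<in>Basis. K b * norm u) * norm w"
      by (intro mult_right_mono sum_mono K(2) that) auto
    finally show ?thesis by (simp add: sum_distrib_right)
  qed
  with K(1) show ?thesis by (intro that[of "\<Sum>b\<in>Basis. K b"]) (auto intro: sum_nonneg)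
qed

section \<open>First-order Taylor estimates with quadratic remainder\<close>

lemma FD_FD_Lipschitz:
  fixes f :: "'a::euclidean_space \<Rightarrow> 'b::real_normed_vector"
  assumes f: "Ck_on (Suc (Suc k)) U f" and S: "convex S" "S \<subseteq> U"
    and K: "\<And>y u w. y \<in> S \<Longrightarrow> norm (FD2 f y u w) \<le> K * norm u * norm w"
    and "x \<in> S" "y \<in> S"
  shows "norm (FD f y w - FD f x w) \<le> K * norm w * norm (y - x)"
proof (rule differentiable_bound[OF S(1) _ _ \<open>y \<in> S\<close> \<open>x \<in> S\<close>])
  fix p assume p: "p \<in> S"
  show "((\<lambda>y. FD f y w) has_derivative (\<lambda>u. FD2 f p u w)) (at p within S)"
    unfolding FD2_def
    by (rule has_derivative_at_withinI[OF Ck_on_FD[OF Ck_on_imp_FD[OF f]]]) (use p S in auto)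
  show "onorm (\<lambda>u. FD2 f p u w) \<le> K * norm w"
    using K[OF p] by (intro onorm_le) (simp add: mult_ac)
qed

text \<open>The mean value inequality applied to \<open>f\<close> minus its linear part at
  \<open>x\<close>: on the segment from \<open>x\<close> to \<open>y\<close> the derivative of this
  difference has norm at most \<open>K * norm (y - x)\<close>.\<close>

lemma Taylor1_convex:
  fixes f :: "'a::euclidean_space \<Rightarrow> 'b::real_normed_vector"
  assumes f: "Ck_on (Suc (Suc k)) U f" and S: "convex S" "S \<subseteq> U"
    and K: "K \<ge> 0" "\<And>y u w. y \<in> S \<Longrightarrow> norm (FD2 f y u w) \<le> K * norm u * norm w"
    and xy: "x \<in> S" "y \<in> S"
  shows "norm (f y - f x - FD f x (y - x)) \<le> K * (norm (y - x))\<^sup>2"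
proof -
  let ?T = "closed_segment x y"
  have T: "?T \<subseteq> S" by (rule closed_segment_subset[OF xy S(1)])
  interpret linear "\<lambda>w. FD f x w" by (rule linear_FD[OF f]) (use xy S in auto)
  have "norm ((f y - FD f x y) - (f x - FD f x x)) \<le> K * norm (y - x) * norm (y - x)"
  proof (rule differentiable_bound[OF convex_closed_segment[of x y]])
    fix p assume p: "p \<in> ?T"
    have bl: "bounded_linear (\<lambda>w. FD f x w)"
      using Ck_on_FD[OF f, of x] xy S has_derivative_bounded_linear by blast
    show "((\<lambda>y. f y - FD f x y) has_derivative (\<lambda>w. FD f p w - FD f x w)) (at p within ?T)"
      by (intro has_derivative_diff has_derivative_at_withinI[OF Ck_on_FD[OF f]]
          bounded_linear_imp_has_derivative bl) (use p T S in auto)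
    show "onorm (\<lambda>w. FD f p w - FD f x w) \<le> K * norm (y - x)"
    proof (rule onorm_le)
      fix w
      have "norm (FD f p w - FD f x w) \<le> K * norm w * norm (p - x)"
        by (rule FD_FD_Lipschitz[OF f S K(2)]) (use p T xy in auto)
      also have "\<dots> \<le> K * norm w * norm (y - x)"
        using segment_bound1[OF p] K(1) by (intro mult_left_mono) auto
      finally show "norm (FD f p w - FD f x w) \<le> K * norm (y - x) * norm w" by (simp add: mult_ac)
    qed
  qed auto
  thus ?thesis by (simp add: diff algebra_simps power2_eq_square)
qed

text \<open>\<open>M\<close> need not be convex. Points closer than \<delta> lie in a common ball
  inside a compact neighbourhood of \<open>M\<close> within \<open>U\<close>, where the convex case
  applies. For distant points boundedness of \<open>f\<close> and of its derivative is enough, at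
  the price of powers of 1/\<delta>.\<close>

lemma Taylor1_compact:
  fixes f :: "'a::euclidean_space \<Rightarrow> 'b::real_normed_vector"
  assumes f: "Ck_on (Suc (Suc k)) U f" and U: "open U" and M: "compact M" "M \<subseteq> U"
  obtains K where "K \<ge> 0" "\<And>x y. x \<in> M \<Longrightarrow> y \<in> M \<Longrightarrow>
    norm (f y - f x - FD f x (y - x)) \<le> K * (norm (y - x))\<^sup>2"
proof (cases "M = {}")
  case True
  then show ?thesis using that[of 0] by auto
next
  case False
  obtain \<delta> where \<delta>: "\<delta> > 0" "{x. infdist x M \<le> \<delta>} \<subseteq> U"
    using compact_in_open_separated[OF False M(1) U M(2)] by blast
  define N where "N = {x. infdist x M \<le> \<delta>}"
  have N: "compact N" "N \<subseteq> U"
    unfolding N_def using \<delta> by (simp_all add: compact_infdist_le[OF False M(1) \<delta>(1)])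
  obtain K2 where K2: "K2 \<ge> 0" "\<And>x u w. x \<in> N \<Longrightarrow> norm (FD2 f x u w) \<le> K2 * norm u * norm w"
    using FD2_bound[OF f U N] by blast
  obtain K1 where K1: "K1 \<ge> 0" "\<And>x w. x \<in> M \<Longrightarrow> norm (FD f x w) \<le> K1 * norm w"
    using FD_bound[OF f M] by blast
  have "continuous_on M f"
    using Ck_on_differentiable_imp_continuous[OF f] M continuous_on_subset by blast
  then have "bounded (f ` M)" using M compact_continuous_image compact_imp_bounded by blast
  then obtain B where B: "B > 0" "\<And>x. x \<in> M \<Longrightarrow> norm (f x) \<le> B"
    unfolding bounded_pos by auto
  \<comment> \<open>The first summand serves pairs at distance at most \<delta>, the other two serve
    distant pairs, for which 1 is at most the distance divided by \<delta>.\<close>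
  let ?K = "K2 + 2 * B / \<delta>\<^sup>2 + K1 / \<delta>"
  have "norm (f y - f x - FD f x (y - x)) \<le> ?K * (norm (y - x))\<^sup>2"
    if xy: "x \<in> M" "y \<in> M" for x y
  proof (cases "norm (y - x) \<le> \<delta>")
    case True
    have c: "cball x \<delta> \<subseteq> N"
    proof
      fix p assume "p \<in> cball x \<delta>"
      then have "infdist p M \<le> \<delta>" by (intro infdist_le2[OF xy(1)]) (simp add: dist_commute)
      then show "p \<in> N" by (simp add: N_def)
    qed
    have "norm (f y - f x - FD f x (y - x)) \<le> K2 * (norm (y - x))\<^sup>2"
    proof (rule Taylor1_convex[OF f convex_cball subset_trans[OF c N(2)] K2(1)])
      show "norm (FD2 f p u w) \<le> K2 * norm u * norm w" if "p \<in> cball x \<delta>" for p u w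
        using K2(2) that c by blast
      show "x \<in> cball x \<delta>" "y \<in> cball x \<delta>"
        using True \<delta>(1) by (simp_all add: dist_norm norm_minus_commute)
    qed
    also have "\<dots> \<le> ?K * (norm (y - x))\<^sup>2"
      using B(1) K1(1) \<delta>(1) by (intro mult_right_mono) auto
    finally show ?thesis .
  next
    case False
    let ?d = "norm (y - x)"
    have d: "1 \<le> ?d / \<delta>" using False \<delta> by (simp add: field_simps)
    have "norm (f y - f x - FD f x (y - x)) \<le> norm (f y) + norm (f x) + norm (FD f x (y - x))"
      using norm_triangle_ineq4[of "f y - f x" "FD f x (y - x)"] norm_triangle_ineq4[of "f y" "f x"]
      by linarith
    also have "\<dots> \<le> 2 * B * 1 + K1 * ?d * 1" using B(2)[OF xy(1)] B(2)[OF xy(2)] K1(2)[OF xy(1), of "y - x"] by linarith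
    also have "\<dots> \<le> 2 * B * (?d / \<delta>)\<^sup>2 + K1 * ?d * (?d / \<delta>)"
      using d B(1) K1(1) \<delta>(1) by (intro add_mono mult_left_mono) (auto simp: one_le_power)
    also have "\<dots> = (2 * B / \<delta>\<^sup>2 + K1 / \<delta>) * ?d\<^sup>2"
      by (simp add: power_divide algebra_simps power2_eq_square)
    also have "\<dots> \<le> ?K * ?d\<^sup>2" using K2(1) by (intro mult_right_mono) auto
    finally show ?thesis .
  qed
  moreover have "?K \<ge> 0" using B(1) K1(1) K2(1) \<delta>(1) by simp
  ultimately show ?thesis by (rule that[rotated]) auto
qed

section \<open>Second-order expansion and symmetry of the second derivative\<close>

text \<open>Differentiability of \<open>FD f y b\<close> in \<open>y\<close> is used for each basis
  vector \<open>b\<close> with tolerance \<open>\<eta> / DIM('a)\<close>; the sum over the basis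
  restores \<eta>, uniformly in \<open>w\<close>.\<close>

lemma FD_expansion:
  fixes f :: "'a::euclidean_space \<Rightarrow> 'b::real_normed_vector"
  assumes f: "Ck_on (Suc (Suc k)) U f" and U: "open U" "x \<in> U" and \<eta>: "\<eta> > 0"
  obtains \<delta> where "\<delta> > 0" "ball x \<delta> \<subseteq> U"
    "\<And>d w. norm d < \<delta> \<Longrightarrow> norm (FD f (x + d) w - FD f x w - FD2 f x d w) \<le> \<eta> * norm d * norm w"
proof -
  define \<eta>' where "\<eta>' = \<eta> / DIM('a)"
  have \<eta>': "\<eta>' > 0" using \<eta> by (simp add: \<eta>'_def)
  have "\<forall>\<^sub>F y in at x. norm (FD f y b - FD f x b - FD2 f x (y - x) b) \<le> \<eta>' * norm (y - x)" for b
  proof -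
    have "((\<lambda>y. FD f y b) has_derivative (\<lambda>u. FD2 f x u b)) (at x)"
      unfolding FD2_def by (rule Ck_on_FD[OF Ck_on_imp_FD[OF f] U(2)])
    from this[unfolded has_derivative_at_within] have
      "((\<lambda>y. norm ((FD f y b - FD f x b - FD2 f x (y - x) b) /\<^sub>R norm (y - x))) \<longlongrightarrow> 0) (at x)"
      using tendsto_norm_zero by (force simp: diff_diff_eq)
    from order_tendstoD(2)[OF this \<eta>'] show ?thesis
      using eventually_neq_at_within[of x x]
    proof eventually_elim
      case (elim y)
      then have "norm (FD f y b - FD f x b - FD2 f x (y - x) b) / norm (y - x) < \<eta>'"
        by (simp only: norm_scaleR) (simp add: divide_inverse mult.commute)
      with elim(2) show ?case by (simp add: pos_divide_less_eq)
    qed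
  qed
  then have "\<forall>\<^sub>F y in at x. \<forall>b\<in>Basis. norm (FD f y b - FD f x b - FD2 f x (y - x) b) \<le> \<eta>' * norm (y - x)"
    by (simp add: eventually_ball_finite)
  then obtain \<delta>1 where \<delta>1: "\<delta>1 > 0" "\<And>y b. y \<noteq> x \<Longrightarrow> dist y x < \<delta>1 \<Longrightarrow> b \<in> Basis \<Longrightarrow>
      norm (FD f y b - FD f x b - FD2 f x (y - x) b) \<le> \<eta>' * norm (y - x)"
    unfolding eventually_at by blast
  obtain \<delta>2 where \<delta>2: "\<delta>2 > 0" "ball x \<delta>2 \<subseteq> U" using U open_contains_ball by blast
  show ?thesis
  proof (rule that[of "min \<delta>1 \<delta>2"])
    show "min \<delta>1 \<delta>2 > 0" "ball x (min \<delta>1 \<delta>2) \<subseteq> U" using \<delta>1 \<delta>2 by auto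
    fix d w :: 'a assume d: "norm d < min \<delta>1 \<delta>2"
    have xd: "x + d \<in> U" using d \<delta>2(2) by (auto simp: dist_norm)
    interpret linear "\<lambda>d. FD2 f x d w" for w by (rule linear_FD2_left[OF f U(2)])
    let ?L = "\<lambda>w. FD f (x + d) w - FD f x w - FD2 f x d w"
    have b: "norm (?L b) \<le> \<eta>' * norm d" if "b \<in> Basis" for b
    proof (cases "d = 0")
      case True
      then show ?thesis by (simp add: zero)
    next
      case False
      then show ?thesis using \<delta>1(2)[of "x + d" b] d that by (simp add: dist_norm)
    qed
    have "norm (?L w) \<le> (\<Sum>b\<in>Basis. norm (?L b)) * norm w"
    proof (rule linear_norm_le_basis)
      fix w show "?L w = (\<Sum>b\<in>Basis. inner w b *\<^sub>R ?L b)"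
        using FD_basis[OF f xd, of w] FD_basis[OF f U(2), of w] FD2_basis_right[OF f U, of d w]
        by (simp add: scaleR_diff_right sum_subtractf)
    qed
    also have "\<dots> \<le> (\<Sum>b\<in>(Basis::'a set). \<eta>' * norm d) * norm w"
      by (intro mult_right_mono sum_mono b) auto
    also have "\<dots> = \<eta> * norm d * norm w" by (simp add: \<eta>'_def)
    finally show "norm (?L w) \<le> \<eta> * norm d * norm w" .
  qed
qed

lemma Taylor2:
  fixes f :: "'a::euclidean_space \<Rightarrow> 'b::real_normed_vector"
  assumes f: "Ck_on (Suc (Suc k)) U f" and U: "open U" "x \<in> U" and \<eta>: "\<eta> > 0"
  obtains \<delta> where "\<delta> > 0"
    "\<And>d. norm d < \<delta> \<Longrightarrow> norm (f (x + d) - f x - FD f x d - (1/2) *\<^sub>R FD2 f x d d) \<le> \<eta> * (norm d)\<^sup>2"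
proof -
  obtain \<delta> where \<delta>: "\<delta> > 0" "ball x \<delta> \<subseteq> U"
    "\<And>d w. norm d < \<delta> \<Longrightarrow> norm (FD f (x + d) w - FD f x w - FD2 f x d w) \<le> \<eta> * norm d * norm w"
    using FD_expansion[OF f U \<eta>] by blast
  show ?thesis
  proof (rule that[OF \<delta>(1)])
    fix d :: 'a assume d: "norm d < \<delta>"
    have sd: "norm (s *\<^sub>R d) < \<delta>" "norm (s *\<^sub>R d) \<le> norm d" if "s \<in> {0..1}" for s
    proof -
      show "norm (s *\<^sub>R d) \<le> norm d" using that by (simp add: mult_left_le_one_le)
      then show "norm (s *\<^sub>R d) < \<delta>" using d by linarith
    qed
    interpret B: linear "\<lambda>u. FD2 f x u w" for w by (rule linear_FD2_left[OF f U(2)])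
    \<comment> \<open>The Taylor polynomial is subtracted along the segment: \<open>g 0 = 0\<close>,
      and the derivative of \<open>g\<close> at \<open>s\<close> is the error that
      \<open>FD_expansion\<close> controls for the displacement
      \<open>s *\<^sub>R d\<close>.\<close>
    define g where "g s = f (x + s *\<^sub>R d) - f x - s *\<^sub>R FD f x d - (s\<^sup>2/2) *\<^sub>R FD2 f x d d" for s :: real
    have "norm (g 1 - g 0) \<le> (\<eta> * (norm d)\<^sup>2) * norm (1 - 0 :: real)"
    proof (rule differentiable_bound[of "{0..1::real}"])
      fix s :: real assume s: "s \<in> {0..1}"
      have xs: "x + s *\<^sub>R d \<in> U" using sd(1)[OF s] \<delta>(2) by (auto simp: dist_norm)
      have "((\<lambda>s. f (x + s *\<^sub>R d)) has_derivative (\<lambda>r. FD f (x + s *\<^sub>R d) (r *\<^sub>R d))) (at s within {0..1})"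
        by (rule has_derivative_compose[where f = "\<lambda>s. x + s *\<^sub>R d" and g = f and f' = "\<lambda>r. r *\<^sub>R d"
              and g' = "\<lambda>w. FD f (x + s *\<^sub>R d) w"])
          (auto intro!: derivative_eq_intros Ck_on_FD[OF f xs])
      then show "(g has_derivative (\<lambda>r. r *\<^sub>R (FD f (x + s *\<^sub>R d) d - FD f x d - s *\<^sub>R FD2 f x d d)))
          (at s within {0..1})"
        unfolding g_def linear_scale[OF linear_FD[OF f xs]]
        by (auto intro!: derivative_eq_intros simp: algebra_simps)
      show "onorm (\<lambda>r. r *\<^sub>R (FD f (x + s *\<^sub>R d) d - FD f x d - s *\<^sub>R FD2 f x d d)) \<le> \<eta> * (norm d)\<^sup>2"
      proof (rule onorm_le)
        fix r :: real
        have "norm (FD f (x + s *\<^sub>R d) d - FD f x d - s *\<^sub>R FD2 f x d d) \<le> \<eta> * norm (s *\<^sub>R d) * norm d"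
          using \<delta>(3)[OF sd(1)[OF s], of d] by (simp only: B.scale)
        also have "\<dots> \<le> \<eta> * norm d * norm d"
          using sd(2)[OF s] \<eta> by (intro mult_right_mono mult_left_mono) auto
        finally have "norm (FD f (x + s *\<^sub>R d) d - FD f x d - s *\<^sub>R FD2 f x d d) \<le> \<eta> * (norm d)\<^sup>2"
          by (simp add: power2_eq_square mult_ac)
        from mult_left_mono[OF this, of "norm r"]
        show "norm (r *\<^sub>R (FD f (x + s *\<^sub>R d) d - FD f x d - s *\<^sub>R FD2 f x d d)) \<le> \<eta> * (norm d)\<^sup>2 * norm r"
          by (simp add: mult_ac)
      qed
    qed auto
    then show "norm (f (x + d) - f x - FD f x d - (1/2) *\<^sub>R FD2 f x d d) \<le> \<eta> * (norm d)\<^sup>2"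
      by (simp add: g_def)
  qed
qed

text \<open>The analytic half of Schwarz's theorem: the second difference of \<open>f\<close> over
  the parallelogram spanned by \<open>s *\<^sub>R u\<close> and \<open>s *\<^sub>R w\<close>
  determines the second derivative. The mean value inequality is applied along \<open>u\<close> to
  the difference of \<open>f\<close> across \<open>w\<close>.\<close>

lemma FD2_second_difference:
  fixes f :: "'a::euclidean_space \<Rightarrow> 'b::real_normed_vector"
  assumes f: "Ck_on (Suc (Suc k)) U f" and U: "open U" "x \<in> U" and \<eta>: "\<eta> > 0"
  obtains \<delta> where "\<delta> > 0" "\<And>s. 0 < s \<Longrightarrow> s < \<delta> \<Longrightarrow>
    norm (f (x + s *\<^sub>R w + s *\<^sub>R u) - f (x + s *\<^sub>R u) - f (x + s *\<^sub>R w) + f x - s\<^sup>2 *\<^sub>R FD2 f x w u) \<le> \<eta> * s\<^sup>2"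
proof -
  define c where "c = norm u + norm w"
  \<comment> \<open>Every displacement below has norm at most \<open>s * c\<close>, and the final
    error is \<open>2 * \<eta>0 * c * norm u * s\<^sup>2\<close>. The added 1 keeps the denominator
    positive when \<open>u = 0\<close>.\<close>
  define \<eta>0 where "\<eta>0 = \<eta> / (2 * c * norm u + 1)"
  have c: "c \<ge> 0" by (simp add: c_def)
  have \<eta>0: "\<eta>0 > 0" "2 * \<eta>0 * c * norm u \<le> \<eta>"
  proof -
    have *: "0 < 2 * c * norm u + 1" using c by (simp add: add_nonneg_pos)
    then show "\<eta>0 > 0" using \<eta> by (simp add: \<eta>0_def)
    then show "2 * \<eta>0 * c * norm u \<le> \<eta>"
      using * \<eta> by (simp add: \<eta>0_def field_simps)
  qed
  obtain \<delta> where \<delta>: "\<delta> > 0" "ball x \<delta> \<subseteq> U"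
    "\<And>d w. norm d < \<delta> \<Longrightarrow> norm (FD f (x + d) w - FD f x w - FD2 f x d w) \<le> \<eta>0 * norm d * norm w"
    using FD_expansion[OF f U \<eta>0(1)] by blast
  interpret B: linear "\<lambda>d. FD2 f x d v" for v by (rule linear_FD2_left[OF f U(2)])
  show ?thesis
  proof (rule that[of "\<delta> / (c + 1)"])
    show "\<delta> / (c + 1) > 0" using \<delta>(1) c by simp
    fix s :: real assume s: "0 < s" "s < \<delta> / (c + 1)"
    then have sc: "s * c < \<delta>" using c by (simp add: field_simps)
    define g where "g r = f (x + s *\<^sub>R w + r *\<^sub>R u) - f (x + r *\<^sub>R u) - r *\<^sub>R s *\<^sub>R FD2 f x w u" for r
    have n: "norm (s *\<^sub>R w + r *\<^sub>R u) \<le> s * c" "norm (r *\<^sub>R u) \<le> s * c" if "r \<in> {0..s}" for r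
    proof -
      have 1: "norm (r *\<^sub>R u) \<le> s * norm u" using that by (simp add: mult_right_mono)
      have "norm (s *\<^sub>R w + r *\<^sub>R u) \<le> norm (s *\<^sub>R w) + norm (r *\<^sub>R u)"
        by (rule norm_triangle_ineq)
      also have "\<dots> \<le> s * norm w + s * norm u" by (intro add_mono 1) (use s in simp)
      finally show "norm (s *\<^sub>R w + r *\<^sub>R u) \<le> s * c" by (simp add: c_def distrib_left add.commute)
      have "s * norm u \<le> s * c" using s by (simp add: c_def)
      with 1 show "norm (r *\<^sub>R u) \<le> s * c" by (rule order_trans)
    qed
    have "norm (g s - g 0) \<le> (2 * \<eta>0 * (s * c) * norm u) * norm (s - 0)"
    proof (rule differentiable_bound[of "{0..s}"])
      fix r assume r: "r \<in> {0..s}"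
      have xU: "x + s *\<^sub>R w + r *\<^sub>R u \<in> U" "x + r *\<^sub>R u \<in> U"
      proof -
        have "x + v \<in> U" if "norm v < \<delta>" for v
          using that by (intro subsetD[OF \<delta>(2)]) (simp add: dist_norm)
        from this[OF le_less_trans[OF n(1)[OF r] sc]] this[OF le_less_trans[OF n(2)[OF r] sc]]
        show "x + s *\<^sub>R w + r *\<^sub>R u \<in> U" "x + r *\<^sub>R u \<in> U" by (simp_all only: add.assoc)
      qed
      have D: "((\<lambda>r. f (p + r *\<^sub>R u)) has_derivative (\<lambda>h. FD f (p + r *\<^sub>R u) (h *\<^sub>R u))) (at r within {0..s})"
        if "p + r *\<^sub>R u \<in> U" for p
        by (rule has_derivative_compose[where f = "\<lambda>r. p + r *\<^sub>R u" and g = f and f' = "\<lambda>h. h *\<^sub>R u"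
              and g' = "\<lambda>w. FD f (p + r *\<^sub>R u) w"])
          (auto intro!: derivative_eq_intros Ck_on_FD[OF f that])
      let ?D = "FD f (x + s *\<^sub>R w + r *\<^sub>R u) u - FD f (x + r *\<^sub>R u) u - s *\<^sub>R FD2 f x w u"
      show "(g has_derivative (\<lambda>h. h *\<^sub>R ?D)) (at r within {0..s})"
        using D[OF xU(1)] D[OF xU(2)]
        unfolding g_def linear_scale[OF linear_FD[OF f xU(1)]] linear_scale[OF linear_FD[OF f xU(2)]]
        by (auto intro!: derivative_eq_intros simp: algebra_simps)
      \<comment> \<open>By linearity in the displacement, the second-derivative terms at the two
        displaced points differ by exactly the one in direction \<open>s *\<^sub>R w\<close>, which
        leaves two errors of \<open>FD_expansion\<close>.\<close>
      have "?D = (FD f (x + (s *\<^sub>R w + r *\<^sub>R u)) u - FD f x u - FD2 f x (s *\<^sub>R w + r *\<^sub>R u) u) -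
          (FD f (x + r *\<^sub>R u) u - FD f x u - FD2 f x (r *\<^sub>R u) u)"
        by (simp add: B.add B.scale add.assoc)
      also have "norm \<dots> \<le> \<eta>0 * norm (s *\<^sub>R w + r *\<^sub>R u) * norm u + \<eta>0 * norm (r *\<^sub>R u) * norm u"
        by (intro order_trans[OF norm_triangle_ineq4] add_mono \<delta>(3) le_less_trans[OF n(1)[OF r] sc]
            le_less_trans[OF n(2)[OF r] sc])
      also have "\<dots> \<le> \<eta>0 * (s * c) * norm u + \<eta>0 * (s * c) * norm u"
        using n[OF r] \<eta>0 by (intro add_mono mult_right_mono mult_left_mono) auto
      finally have D': "norm ?D \<le> 2 * \<eta>0 * (s * c) * norm u" by (simp add: mult_ac)
      show "onorm (\<lambda>h. h *\<^sub>R ?D) \<le> 2 * \<eta>0 * (s * c) * norm u"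
      proof (rule onorm_le)
        fix h show "norm (h *\<^sub>R ?D) \<le> 2 * \<eta>0 * (s * c) * norm u * norm h"
          using mult_left_mono[OF D', of "norm h"] by (simp add: mult_ac)
      qed
    qed (use s in auto)
    also have "\<dots> = (2 * \<eta>0 * c * norm u) * s\<^sup>2" using s by (simp add: power2_eq_square)
    also have "\<dots> \<le> \<eta> * s\<^sup>2" by (intro mult_right_mono \<eta>0) auto
    finally show "norm (f (x + s *\<^sub>R w + s *\<^sub>R u) - f (x + s *\<^sub>R u) - f (x + s *\<^sub>R w) + f x - s\<^sup>2 *\<^sub>R FD2 f x w u)
        \<le> \<eta> * s\<^sup>2"
      by (simp add: g_def power2_eq_square algebra_simps)
  qed
qed

text \<open>Both second derivatives approximate the same second difference, which does not change
  when \<open>u\<close> and \<open>w\<close> are exchanged. Symmetry is what merges the two mixed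
  terms of the perturbed generator into one.\<close>

lemma FD2_symmetric:
  fixes f :: "'a::euclidean_space \<Rightarrow> 'b::real_normed_vector"
  assumes f: "Ck_on (Suc (Suc k)) U f" and U: "open U" "x \<in> U"
  shows "FD2 f x u w = FD2 f x w u"
proof -
  have "norm (FD2 f x w u - FD2 f x u w) \<le> 0 + e" if "e > 0" for e
  proof -
    have "e / 2 > 0" using that by simp
    obtain \<delta>1 where \<delta>1: "\<delta>1 > 0" "\<And>s. 0 < s \<Longrightarrow> s < \<delta>1 \<Longrightarrow>
      norm (f (x + s *\<^sub>R w + s *\<^sub>R u) - f (x + s *\<^sub>R u) - f (x + s *\<^sub>R w) + f x - s\<^sup>2 *\<^sub>R FD2 f x w u) \<le> e/2 * s\<^sup>2"
      using FD2_second_difference[OF f U \<open>e / 2 > 0\<close>, of w u] by blast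
    obtain \<delta>2 where \<delta>2: "\<delta>2 > 0" "\<And>s. 0 < s \<Longrightarrow> s < \<delta>2 \<Longrightarrow>
      norm (f (x + s *\<^sub>R u + s *\<^sub>R w) - f (x + s *\<^sub>R w) - f (x + s *\<^sub>R u) + f x - s\<^sup>2 *\<^sub>R FD2 f x u w) \<le> e/2 * s\<^sup>2"
      using FD2_second_difference[OF f U \<open>e / 2 > 0\<close>, of u w] by blast
    define s where "s = min \<delta>1 \<delta>2 / 2"
    have s: "0 < s" "s < \<delta>1" "s < \<delta>2" using \<delta>1(1) \<delta>2(1) by (auto simp: s_def)
    let ?A = "f (x + s *\<^sub>R w + s *\<^sub>R u) - f (x + s *\<^sub>R u) - f (x + s *\<^sub>R w) + f x"
    have "f (x + s *\<^sub>R u + s *\<^sub>R w) - f (x + s *\<^sub>R w) - f (x + s *\<^sub>R u) + f x = ?A"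
      by (simp add: algebra_simps)
    with \<delta>1(2)[OF s(1,2)] \<delta>2(2)[OF s(1,3)]
    have "norm (?A - s\<^sup>2 *\<^sub>R FD2 f x w u) \<le> e/2 * s\<^sup>2" "norm (?A - s\<^sup>2 *\<^sub>R FD2 f x u w) \<le> e/2 * s\<^sup>2"
      by simp_all
    then have "norm ((?A - s\<^sup>2 *\<^sub>R FD2 f x u w) - (?A - s\<^sup>2 *\<^sub>R FD2 f x w u)) \<le> e * s\<^sup>2"
      using norm_triangle_ineq4[of "?A - s\<^sup>2 *\<^sub>R FD2 f x u w" "?A - s\<^sup>2 *\<^sub>R FD2 f x w u"] by linarith
    moreover have "(?A - s\<^sup>2 *\<^sub>R FD2 f x u w) - (?A - s\<^sup>2 *\<^sub>R FD2 f x w u) = s\<^sup>2 *\<^sub>R (FD2 f x w u - FD2 f x u w)"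
      by (simp add: scaleR_diff_right)
    ultimately have "s\<^sup>2 * norm (FD2 f x w u - FD2 f x u w) \<le> s\<^sup>2 * e"
      by (simp only: norm_scaleR) (simp add: mult.commute)
    then show ?thesis using s(1) by simp
  qed
  then have "norm (FD2 f x w u - FD2 f x u w) \<le> 0" by (rule field_le_epsilon)
  then show ?thesis by simp
qed

text \<open>The increment is split as \<open>d1 + d2\<close> with \<open>d2\<close> of smaller order, so that only the
  explicit part \<open>d1\<close> enters the second-order term and needs a fourth moment.\<close>

lemma Taylor2_split:
  fixes f :: "'a::euclidean_space \<Rightarrow> real"
  assumes f: "Ck_on (Suc (Suc k)) U f" and U: "open U" and M: "compact M" "M \<subseteq> U" "x \<in> M" and \<eta>: "\<eta> > 0"
  obtains K where "K \<ge> 0" "\<And>d1 d2. x + (d1 + d2) \<in> M \<Longrightarrow>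
    \<bar>f (x + (d1 + d2)) - f x - FD f x (d1 + d2) - FD2 f x d1 d1 / 2\<bar>
      \<le> \<eta> * (norm d1)\<^sup>2 + K * ((norm d1)^4 + (norm d2)\<^sup>2)"
proof -
  have xU: "x \<in> U" using M by auto
  obtain K1 where K1: "K1 \<ge> 0" "\<And>x y. x \<in> M \<Longrightarrow> y \<in> M \<Longrightarrow> norm (f y - f x - FD f x (y - x)) \<le> K1 * (norm (y - x))\<^sup>2"
    using Taylor1_compact[OF f U M(1,2)] by blast
  obtain K2 where K2: "K2 \<ge> 0" "\<And>x u w. x \<in> M \<Longrightarrow> norm (FD2 f x u w) \<le> K2 * norm u * norm w"
    using FD2_bound[OF f U M(1,2)] by blast
  have "\<eta> / 4 > 0" using \<eta> by simp
  obtain \<delta> where \<delta>: "\<delta> > 0"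
    "\<And>d. norm d < \<delta> \<Longrightarrow> norm (f (x + d) - f x - FD f x d - (1/2) *\<^sub>R FD2 f x d d) \<le> \<eta>/4 * (norm d)\<^sup>2"
    using Taylor2[OF f U xU \<open>\<eta> / 4 > 0\<close>] by blast
  define A where "A = 2 * K1 + K2"
  have A: "A \<ge> 0" using K1(1) K2(1) by (simp add: A_def)
  \<comment> \<open>The first three summands absorb the terms containing \<open>d2\<close> when the
    increment is short. For a long increment, \<open>4 * A/\<delta>\<^sup>2\<close> turns a large
    |d1|^2 into |d1|^4, and \<open>A + 2 * K1\<close> pays for the case in which \<open>d2\<close>
    dominates.\<close>
  define K where "K = \<eta>/2 + K2 + K2\<^sup>2/(2*\<eta>) + 4 * A/\<delta>\<^sup>2 + A + 2 * K1"
  have K: "K \<ge> \<eta>/2 + K2 + K2\<^sup>2/(2*\<eta>)" "K \<ge> A + 2 * K1" "K \<ge> 4 * A/\<delta>\<^sup>2" "K \<ge> 2 * K1" "K \<ge> 0"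
    using K1(1) K2(1) A \<eta> \<delta>(1) by (simp_all add: K_def)
  show ?thesis
  proof (rule that[OF K(5)])
    fix d1 d2 assume xM: "x + (d1 + d2) \<in> M"
    let ?a = "norm d1" and ?b = "norm d2" and ?d = "d1 + d2"
    let ?T = "f (x + ?d) - f x - FD f x ?d"
    let ?R = "\<eta> * ?a\<^sup>2 + K * (?a^4 + ?b\<^sup>2)"
    have a4: "?a^4 = ?a\<^sup>2 * ?a\<^sup>2" by (simp add: power2_eq_square power4_eq_xxxx)
    have Kb: "L * ?b\<^sup>2 \<le> K * ?b\<^sup>2" if "L \<le> K" for L using that by (intro mult_right_mono) auto
    have Ka: "0 \<le> K * ?a^4" "0 \<le> K * ?b\<^sup>2" using K(5) by auto
    have "(norm ?d)\<^sup>2 \<le> (?a + ?b)\<^sup>2" by (intro power_mono norm_triangle_ineq) auto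
    also have "\<dots> \<le> 2 * ?a\<^sup>2 + 2 * ?b\<^sup>2" using sum_squares_bound[of ?a ?b] by (simp add: power2_sum)
    finally have d2: "(norm ?d)\<^sup>2 \<le> 2 * ?a\<^sup>2 + 2 * ?b\<^sup>2" .
    show "\<bar>?T - FD2 f x d1 d1 / 2\<bar> \<le> ?R"
    proof (cases "norm ?d < \<delta>")
      case True
      have 1: "\<bar>?T - FD2 f x ?d ?d / 2\<bar> \<le> \<eta>/4 * (norm ?d)\<^sup>2" using \<delta>(2)[OF True] by simp
      interpret L: linear "\<lambda>u. FD2 f x u w" for w by (rule linear_FD2_left[OF f xU])
      interpret R: linear "\<lambda>w. FD2 f x u w" for u using linear_FD2_right[OF f U xU] .
      have 2: "FD2 f x ?d ?d = FD2 f x d1 d1 + FD2 f x d1 d2 + FD2 f x d2 d1 + FD2 f x d2 d2"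
        by (simp add: L.add R.add)
      have 3: "\<bar>FD2 f x d1 d2\<bar> \<le> K2 * ?a * ?b" "\<bar>FD2 f x d2 d1\<bar> \<le> K2 * ?a * ?b" "\<bar>FD2 f x d2 d2\<bar> \<le> K2 * ?b\<^sup>2"
        using K2(2)[OF M(3), of d1 d2] K2(2)[OF M(3), of d2 d1] K2(2)[OF M(3), of d2 d2]
        by (simp_all add: power2_eq_square mult_ac)
      \<comment> \<open>Completing the square moves the mixed term into a small multiple of |d1|^2
        and a large multiple of |d2|^2, in accordance with the different orders of the two
        parts.\<close>
      have "0 \<le> (\<eta> * ?a - K2 * ?b)\<^sup>2 / (2 * \<eta>)" using \<eta> by simp
      also have "\<dots> = \<eta>/2 * ?a\<^sup>2 + K2\<^sup>2/(2*\<eta>) * ?b\<^sup>2 - K2 * ?a * ?b"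
        using \<eta> by (simp add: field_simps power2_eq_square)
      finally have 4: "K2 * ?a * ?b \<le> \<eta>/2 * ?a\<^sup>2 + K2\<^sup>2/(2*\<eta>) * ?b\<^sup>2" by simp
      have 5: "\<eta>/4 * (norm ?d)\<^sup>2 \<le> \<eta>/2 * ?a\<^sup>2 + \<eta>/2 * ?b\<^sup>2"
        using mult_left_mono[OF d2, of "\<eta>/4"] \<eta> by (simp add: algebra_simps)
      have 7: "0 \<le> K2 * ?b\<^sup>2" using K2(1) by simp
      have 6: "(\<eta>/2 + K2 + K2\<^sup>2/(2*\<eta>)) * ?b\<^sup>2 = \<eta>/2 * ?b\<^sup>2 + K2 * ?b\<^sup>2 + K2\<^sup>2/(2*\<eta>) * ?b\<^sup>2"
        by (simp only: distrib_right)
      show ?thesis using 1 2 3 4 5 6 7 Kb[OF K(1)] Ka unfolding distrib_left by linarith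
    next
      case False
      \<comment> \<open>A long increment is treated by the first-order estimate on \<open>M\<close>.
        Either |d1| is at least \<delta>/2, and a fourth power dominates the square, or |d2| exceeds
        |d1|.\<close>
      have "\<bar>?T\<bar> \<le> K1 * (norm ?d)\<^sup>2" using K1(2)[OF M(3) xM] by simp
      also have "\<dots> \<le> K1 * (2 * ?a\<^sup>2 + 2 * ?b\<^sup>2)" by (intro mult_left_mono d2 K1)
      finally have "\<bar>?T\<bar> \<le> 2 * K1 * ?a\<^sup>2 + 2 * K1 * ?b\<^sup>2" by (simp add: algebra_simps)
      moreover have "\<bar>FD2 f x d1 d1\<bar> \<le> K2 * ?a\<^sup>2"
        using K2(2)[OF M(3), of d1 d1] by (simp add: power2_eq_square mult_ac)
      moreover have "0 \<le> K2 * ?a\<^sup>2" using K2 by simp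
      ultimately have 1: "\<bar>?T - FD2 f x d1 d1 / 2\<bar> \<le> A * ?a\<^sup>2 + 2 * K1 * ?b\<^sup>2"
        unfolding A_def distrib_right by linarith
      have e: "0 \<le> \<eta> * ?a\<^sup>2" using \<eta> by simp
      show ?thesis
      proof (cases "?a \<ge> \<delta> / 2")
        case True
        then have "(\<delta> / 2)\<^sup>2 \<le> ?a\<^sup>2" using \<delta>(1) by (intro power_mono) auto
        then have "1 \<le> 4/\<delta>\<^sup>2 * ?a\<^sup>2" using \<delta>(1) by (simp add: field_simps power2_eq_square)
        then have "A * ?a\<^sup>2 * 1 \<le> A * ?a\<^sup>2 * (4/\<delta>\<^sup>2 * ?a\<^sup>2)" using A by (intro mult_left_mono) auto
        then have "A * ?a\<^sup>2 \<le> 4 * A/\<delta>\<^sup>2 * ?a^4" unfolding a4 by (simp only: mult_1_right times_divide_eq_left times_divide_eq_right mult_ac)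
        also have "\<dots> \<le> K * ?a^4" by (intro mult_right_mono K) auto
        finally show ?thesis using 1 Kb[OF K(4)] e unfolding distrib_left by linarith
      next
        case False
        then have "?a \<le> ?b" using \<open>\<not> norm ?d < \<delta>\<close> norm_triangle_ineq[of d1 d2] by linarith
        then have "A * ?a\<^sup>2 \<le> A * ?b\<^sup>2" using A by (intro mult_left_mono power_mono) auto
        moreover have "A * ?b\<^sup>2 + 2 * K1 * ?b\<^sup>2 \<le> K * ?b\<^sup>2"
          using Kb[OF K(2)] by (simp only: distrib_right)
        ultimately show ?thesis using 1 e Ka unfolding distrib_left by linarith
      qed
    qed
  qed
qed

section \<open>Second moments and convergence in probability\<close>

text \<open>The nonnegative integral makes integrability part of the bound and lets it pass to
  limits by Fatou's lemma. The condition on \<open>B\<close> is there because \<open>ennreal\<close>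
  sends negative numbers to 0.\<close>

definition second_moment_le :: "'w measure \<Rightarrow> ('w \<Rightarrow> 'b::euclidean_space) \<Rightarrow> real \<Rightarrow> bool" where
  "second_moment_le M f B \<longleftrightarrow> f \<in> borel_measurable M \<and> 0 \<le> B \<and>
     (\<integral>\<^sup>+ w. ennreal ((norm (f w))\<^sup>2) \<partial>M) \<le> ennreal B"

lemma second_moment_leI:
  assumes "f \<in> borel_measurable M" "integrable M (\<lambda>w. (norm (f w))\<^sup>2)" "(\<integral>w. (norm (f w))\<^sup>2 \<partial>M) \<le> B"
  shows "second_moment_le M f B"
proof -
  have "0 \<le> (\<integral>w. (norm (f w))\<^sup>2 \<partial>M)" by simp
  then have "0 \<le> B" using assms(3) by linarith
  with assms show ?thesis
    unfolding second_moment_le_def by (auto simp: nn_integral_eq_integral intro: ennreal_leI)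
qed

lemma second_moment_le_measurable: "second_moment_le M f B \<Longrightarrow> f \<in> borel_measurable M"
  by (simp add: second_moment_le_def)

lemma second_moment_le_integrable_sq:
  assumes "second_moment_le M f B"
  shows "integrable M (\<lambda>w. (norm (f w))\<^sup>2)"
proof -
  have [measurable]: "f \<in> borel_measurable M" and B: "(\<integral>\<^sup>+ w. ennreal ((norm (f w))\<^sup>2) \<partial>M) \<le> ennreal B"
    using assms by (auto simp: second_moment_le_def)
  show ?thesis
    by (rule integrableI_bounded) (use le_less_trans[OF B] in auto)
qed

lemma second_moment_le_integral:
  assumes "second_moment_le M f B"
  shows "(\<integral>w. (norm (f w))\<^sup>2 \<partial>M) \<le> B"
proof -
  have "ennreal (\<integral>w. (norm (f w))\<^sup>2 \<partial>M) \<le> ennreal B"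
    using assms nn_integral_eq_integral[OF second_moment_le_integrable_sq[OF assms]]
    by (simp add: second_moment_le_def)
  then show ?thesis using assms by (simp add: second_moment_le_def)
qed

lemma second_moment_le_mono: "second_moment_le M f B \<Longrightarrow> B \<le> B' \<Longrightarrow> second_moment_le M f B'"
  unfolding second_moment_le_def using ennreal_leI order_trans by fastforce

lemma norm_sum_sq_le: "(norm (\<Sum>i\<in>A. f i))\<^sup>2 \<le> real (card A) * (\<Sum>i\<in>A. (norm (f i))\<^sup>2)"
proof -
  have "(norm (\<Sum>i\<in>A. f i))\<^sup>2 \<le> (\<Sum>i\<in>A. norm (f i))\<^sup>2"
    by (intro power_mono norm_sum) auto
  also have "\<dots> \<le> real (card A) * (\<Sum>i\<in>A. (norm (f i))\<^sup>2)"
    using Cauchy_Schwarz_ineq_sum[of "\<lambda>_. 1" "\<lambda>i. norm (f i)" A] by (simp add: mult.commute)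
  finally show ?thesis .
qed

text \<open>The factor \<open>card A\<close> is the Cauchy-Schwarz price for summands whose
  correlations are unknown; sums against Brownian increments get the sharper orthogonal bound
  later.\<close>

lemma second_moment_le_sum:
  assumes "\<And>i. i \<in> A \<Longrightarrow> second_moment_le M (f i) (B i)"
  shows "second_moment_le M (\<lambda>w. \<Sum>i\<in>A. f i w) (real (card A) * (\<Sum>i\<in>A. B i))"
proof (rule second_moment_leI)
  have [measurable]: "f i \<in> borel_measurable M" if "i \<in> A" for i
    using assms[OF that] by (rule second_moment_le_measurable)
  show m: "(\<lambda>w. \<Sum>i\<in>A. f i w) \<in> borel_measurable M" by measurable
  have i: "integrable M (\<lambda>w. real (card A) * (\<Sum>i\<in>A. (norm (f i w))\<^sup>2))"
    using assms by (intro integrable_mult_right Bochner_Integration.integrable_sum second_moment_le_integrable_sq)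
  show i2: "integrable M (\<lambda>w. (norm (\<Sum>i\<in>A. f i w))\<^sup>2)"
  proof (rule Bochner_Integration.integrable_bound[OF i])
    show "AE w in M. norm ((norm (\<Sum>i\<in>A. f i w))\<^sup>2) \<le> norm (real (card A) * (\<Sum>i\<in>A. (norm (f i w))\<^sup>2))"
      unfolding real_norm_def abs_power2 abs_norm_cancel power2_abs
      by (rule AE_I2) (rule order_trans[OF norm_sum_sq_le abs_ge_self])
  qed (use m in measurable)
  have "(\<integral>w. (norm (\<Sum>i\<in>A. f i w))\<^sup>2 \<partial>M) \<le> (\<integral>w. real (card A) * (\<Sum>i\<in>A. (norm (f i w))\<^sup>2) \<partial>M)"
    by (intro integral_mono i i2 norm_sum_sq_le)
  also have "\<dots> = real (card A) * (\<Sum>i\<in>A. \<integral>w. (norm (f i w))\<^sup>2 \<partial>M)"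
    using Bochner_Integration.integral_sum[OF second_moment_le_integrable_sq[OF assms], of A "\<lambda>i. i"] by simp
  also have "\<dots> \<le> real (card A) * (\<Sum>i\<in>A. B i)"
    using assms by (intro mult_left_mono sum_mono second_moment_le_integral) auto
  finally show "(\<integral>w. (norm (\<Sum>i\<in>A. f i w))\<^sup>2 \<partial>M) \<le> real (card A) * (\<Sum>i\<in>A. B i)" .
qed

lemma second_moment_le_add:
  assumes f: "second_moment_le M f A" and g: "second_moment_le M g B"
  shows "second_moment_le M (\<lambda>w. f w + g w) (2 * (A + B))"
proof -
  have "second_moment_le M (\<lambda>w. \<Sum>b\<in>UNIV. (if b then f else g) w) (real (card (UNIV::bool set)) * (\<Sum>b\<in>UNIV. if b then A else B))"
    by (rule second_moment_le_sum) (use f g in auto)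
  then show ?thesis by (simp add: UNIV_bool add.commute)
qed

lemma second_moment_le_scaleR:
  assumes "second_moment_le M f B"
  shows "second_moment_le M (\<lambda>w. c *\<^sub>R f w) (c\<^sup>2 * B)"
proof (rule second_moment_leI)
  note [measurable] = second_moment_le_measurable[OF assms]
  show "(\<lambda>w. c *\<^sub>R f w) \<in> borel_measurable M" by measurable
  show "integrable M (\<lambda>w. (norm (c *\<^sub>R f w))\<^sup>2)"
    using second_moment_le_integrable_sq[OF assms] by (simp add: power_mult_distrib)
  show "(\<integral>w. (norm (c *\<^sub>R f w))\<^sup>2 \<partial>M) \<le> c\<^sup>2 * B"
    using second_moment_le_integral[OF assms] by (simp add: power_mult_distrib mult_left_mono)
qed

lemma second_moment_le_diff:
  assumes f: "second_moment_le M f A" and g: "second_moment_le M g B"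
  shows "second_moment_le M (\<lambda>w. f w - g w) (2 * (A + B))"
  using second_moment_le_add[OF f second_moment_le_scaleR[OF g, of "-1"]] by simp

lemma second_moment_le_AE_cong:
  assumes "second_moment_le M f B" "g \<in> borel_measurable M" "AE w in M. f w = g w"
  shows "second_moment_le M g B"
proof -
  have "(\<integral>\<^sup>+ w. ennreal ((norm (f w))\<^sup>2) \<partial>M) = (\<integral>\<^sup>+ w. ennreal ((norm (g w))\<^sup>2) \<partial>M)"
    by (rule nn_integral_cong_AE) (use assms(3) in auto)
  with assms show ?thesis by (simp add: second_moment_le_def)
qed

lemma (in finite_measure) second_moment_le_integrable:
  assumes "second_moment_le M f B"
  shows "integrable M f"
proof (rule Bochner_Integration.integrable_bound)
  show "integrable M (\<lambda>w. 1 + (norm (f w))\<^sup>2)"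
    using second_moment_le_integrable_sq[OF assms] by simp
  have "norm (f w) \<le> 1 + (norm (f w))\<^sup>2" for w
    using zero_le_power2[of "norm (f w) - 1"] by (simp add: power2_diff) (smt (verit) norm_ge_zero)
  then show "AE w in M. norm (f w) \<le> norm (1 + (norm (f w))\<^sup>2)" by (auto intro!: AE_I2)
qed (rule second_moment_le_measurable[OF assms])

lemma (in prob_space) second_moment_le_bounded:
  assumes "f \<in> borel_measurable M" "AE w in M. norm (f w) \<le> K" "K \<ge> 0"
  shows "second_moment_le M f (K\<^sup>2)"
proof (rule second_moment_leI)
  note [measurable] = assms(1)
  have b: "AE w in M. (norm (f w))\<^sup>2 \<le> K\<^sup>2" using assms(2) by eventually_elim (auto intro: power_mono)
  then show i: "integrable M (\<lambda>w. (norm (f w))\<^sup>2)" by (intro integrable_const_bound[where B="K\<^sup>2"]) auto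
  have "(\<integral>w. (norm (f w))\<^sup>2 \<partial>M) \<le> (\<integral>w. K\<^sup>2 \<partial>M)" by (intro integral_mono_AE i b) auto
  then show "(\<integral>w. (norm (f w))\<^sup>2 \<partial>M) \<le> K\<^sup>2" by (simp add: prob_space)
qed (rule assms(1))

section \<open>Convergence in probability\<close>

text \<open>Convergence in probability is metrized by the expected truncated distance, which turns
  it into convergence in L^1: triangle inequality, dominated convergence and almost surely
  convergent subsequences become directly available.\<close>

definition tends_in_prob :: "'w measure \<Rightarrow> (nat \<Rightarrow> 'w \<Rightarrow> 'b::euclidean_space) \<Rightarrow> ('w \<Rightarrow> 'b) \<Rightarrow> bool" where
  "tends_in_prob M X Y \<longleftrightarrow> (\<forall>n. X n \<in> borel_measurable M) \<and> Y \<in> borel_measurable M \<and>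
     (\<lambda>n. \<integral>w. min 1 (norm (X n w - Y w)) \<partial>M) \<longlonglongrightarrow> 0"

context prob_space
begin

lemma integrable_min_1_norm: "f \<in> borel_measurable M \<Longrightarrow> integrable M (\<lambda>w. min 1 (norm (f w)))"
  by (intro integrable_const_bound[where B=1]) auto

lemma tends_in_prob_le:
  assumes [measurable]: "\<And>n. X n \<in> borel_measurable M" "Y \<in> borel_measurable M"
    and le: "\<And>n. (\<integral>w. min 1 (norm (X n w - Y w)) \<partial>M) \<le> a n" and a: "a \<longlonglongrightarrow> 0"
  shows "tends_in_prob M X Y"
  unfolding tends_in_prob_def
proof (intro conjI allI)
  show "(\<lambda>n. \<integral>w. min 1 (norm (X n w - Y w)) \<partial>M) \<longlonglongrightarrow> 0"
    by (rule tendsto_sandwich[OF _ _ tendsto_const a]) (use le in \<open>auto intro!: always_eventually integral_nonneg_AE\<close>)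
qed measurable

lemma tends_in_prob_L2:
  assumes s: "\<And>n. second_moment_le M (\<lambda>w. X n w - Y w) (a n)" and a: "a \<longlonglongrightarrow> 0"
    and m: "\<And>n. X n \<in> borel_measurable M" "Y \<in> borel_measurable M"
  shows "tends_in_prob M X Y"
proof -
  note [measurable] = m
  have a0: "a n \<ge> 0" for n using s[of n] by (simp add: second_moment_le_def)
  show ?thesis
  proof (rule tends_in_prob_le[OF m])
    fix n
    let ?D = "\<lambda>w. norm (X n w - Y w)"
    have i: "integrable M ?D" "integrable M (\<lambda>w. (?D w)\<^sup>2)"
      using second_moment_le_integrable[OF s[of n]] second_moment_le_integrable_sq[OF s[of n]] by auto
    have "(\<integral>w. min 1 (?D w) \<partial>M) \<le> (\<integral>w. ?D w \<partial>M)"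
      by (intro integral_mono integrable_min_1_norm i) auto
    also have "(\<integral>w. ?D w \<partial>M) \<le> sqrt (\<integral>w. (?D w)\<^sup>2 \<partial>M)"
    proof (rule real_le_rsqrt)
      have "0 \<le> variance ?D" by (rule variance_positive)
      then show "(\<integral>w. ?D w \<partial>M)\<^sup>2 \<le> (\<integral>w. (?D w)\<^sup>2 \<partial>M)" using variance_eq[OF i] by simp
    qed
    also have "\<dots> \<le> sqrt (a n)" using second_moment_le_integral[OF s[of n]] by simp
    finally show "(\<integral>w. min 1 (?D w) \<partial>M) \<le> sqrt (a n)" .
  next
    show "(\<lambda>n. sqrt (a n)) \<longlonglongrightarrow> 0" using tendsto_real_sqrt[OF a] by simp
  qed
qed

lemma tends_in_prob_AE:
  assumes [measurable]: "\<And>n. X n \<in> borel_measurable M" "Y \<in> borel_measurable M"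
    and lim: "AE w in M. (\<lambda>n. X n w) \<longlonglongrightarrow> Y w"
  shows "tends_in_prob M X Y"
  unfolding tends_in_prob_def
proof (intro conjI allI)
  have "(\<lambda>n. \<integral>w. min 1 (norm (X n w - Y w)) \<partial>M) \<longlonglongrightarrow> (\<integral>w. 0 \<partial>M)"
  proof (rule integral_dominated_convergence[where w="\<lambda>_. 1"])
    show "AE w in M. (\<lambda>n. min 1 (norm (X n w - Y w))) \<longlonglongrightarrow> 0"
      using lim
    proof eventually_elim
      case (elim w)
      then have "(\<lambda>n. norm (X n w - Y w)) \<longlonglongrightarrow> 0" using LIM_zero tendsto_norm_zero by blast
      from tendsto_min[OF tendsto_const[of 1] this] show ?case by simp
    qed
  qed auto
  then show "(\<lambda>n. \<integral>w. min 1 (norm (X n w - Y w)) \<partial>M) \<longlonglongrightarrow> 0" by simp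
qed measurable

lemma tends_in_prob_diff:
  fixes X X' :: "nat \<Rightarrow> 'a \<Rightarrow> 'b::euclidean_space"
  assumes X: "tends_in_prob M X Y" and X': "tends_in_prob M X' Y'"
  shows "tends_in_prob M (\<lambda>n w. X n w - X' n w) (\<lambda>w. Y w - Y' w)"
proof -
  have [measurable]: "\<And>n. X n \<in> borel_measurable M" "Y \<in> borel_measurable M"
    "\<And>n. X' n \<in> borel_measurable M" "Y' \<in> borel_measurable M"
    using X X' by (auto simp: tends_in_prob_def)
  show ?thesis
  proof (rule tends_in_prob_le)
    fix n
    have "min 1 (norm (a - a' - (b - b'))) \<le> min 1 (norm (a - b)) + min 1 (norm (a' - b'))" for a a' b b' :: 'b
    proof -
      have "a - a' - (b - b') = (a - b) - (a' - b')" by simp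
      then have "norm (a - a' - (b - b')) \<le> norm (a - b) + norm (a' - b')"
        using norm_triangle_ineq4[of "a - b" "a' - b'"] by (simp only:)
      then show ?thesis using norm_ge_zero[of "a - b"] norm_ge_zero[of "a' - b'"] by linarith
    qed
    then have "(\<integral>w. min 1 (norm (X n w - X' n w - (Y w - Y' w))) \<partial>M) \<le>
        (\<integral>w. min 1 (norm (X n w - Y w)) + min 1 (norm (X' n w - Y' w)) \<partial>M)"
      by (intro integral_mono integrable_min_1_norm Bochner_Integration.integrable_add) auto
    then show "(\<integral>w. min 1 (norm (X n w - X' n w - (Y w - Y' w))) \<partial>M) \<le>
        (\<integral>w. min 1 (norm (X n w - Y w)) \<partial>M) + (\<integral>w. min 1 (norm (X' n w - Y' w)) \<partial>M)"
      by (simp add: integrable_min_1_norm)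
  next
    show "(\<lambda>n. (\<integral>w. min 1 (norm (X n w - Y w)) \<partial>M) + (\<integral>w. min 1 (norm (X' n w - Y' w)) \<partial>M)) \<longlonglongrightarrow> 0"
      using tendsto_add[of _ 0 _ _ 0] X X' by (force simp: tends_in_prob_def)
  qed auto
qed

lemma tends_in_prob_subseq:
  assumes X: "tends_in_prob M X Y"
  obtains r :: "nat \<Rightarrow> nat" where "strict_mono r" "AE w in M. (\<lambda>n. X (r n) w) \<longlonglongrightarrow> Y w"
proof -
  have [measurable]: "\<And>n. X n \<in> borel_measurable M" "Y \<in> borel_measurable M"
    using X by (auto simp: tends_in_prob_def)
  have "\<exists>r::nat\<Rightarrow>nat. strict_mono r \<and> (AE w in M. (\<lambda>n. min 1 (norm (X (r n) w - Y w))) \<longlonglongrightarrow> 0)"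
    by (rule tendsto_L1_AE_subseq) (use X in \<open>auto simp: tends_in_prob_def intro!: integrable_min_1_norm\<close>)
  then obtain r :: "nat \<Rightarrow> nat" where r: "strict_mono r"
    "AE w in M. (\<lambda>n. min 1 (norm (X (r n) w - Y w))) \<longlonglongrightarrow> 0" by blast
  have "AE w in M. (\<lambda>n. X (r n) w) \<longlonglongrightarrow> Y w"
    using r(2)
  proof eventually_elim
    case (elim w)
    \<comment> \<open>Once the truncated distance is below 1, the truncation is inactive.\<close>
    have "\<forall>\<^sub>F n in sequentially. min 1 (norm (X (r n) w - Y w)) < 1"
      using order_tendstoD(2)[OF elim, of 1] by simp
    then have "\<forall>\<^sub>F n in sequentially. norm (X (r n) w - Y w) = min 1 (norm (X (r n) w - Y w))"
      by (rule eventually_mono) (simp add: min_def split: if_splits)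
    with elim have "(\<lambda>n. norm (X (r n) w - Y w)) \<longlonglongrightarrow> 0"
      by (simp add: tendsto_cong)
    then show ?case by (simp add: LIM_zero_iff tendsto_norm_zero_iff)
  qed
  with r(1) show ?thesis by (rule that)
qed

lemma tends_in_prob_unique:
  assumes X: "tends_in_prob M X Y" and X': "tends_in_prob M X Y'"
  shows "AE w in M. Y w = Y' w"
proof -
  have "tends_in_prob M (\<lambda>n w. 0) (\<lambda>w. Y w - Y' w)" using tends_in_prob_diff[OF X X'] by simp
  then obtain r :: "nat \<Rightarrow> nat" where "AE w in M. (\<lambda>n. 0) \<longlonglongrightarrow> Y w - Y' w"
    using tends_in_prob_subseq by blast
  then show ?thesis by eventually_elim (simp add: LIMSEQ_const_iff)
qed

text \<open>Fatou's lemma along a subsequence that converges almost surely.\<close>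

lemma second_moment_le_limit:
  assumes X: "tends_in_prob M X Y" and B: "\<And>n. second_moment_le M (X n) B"
  shows "second_moment_le M Y B"
proof -
  have [measurable]: "\<And>n. X n \<in> borel_measurable M" "Y \<in> borel_measurable M"
    using X by (auto simp: tends_in_prob_def)
  obtain r where r: "AE w in M. (\<lambda>n. X (r n) w) \<longlonglongrightarrow> Y w" using tends_in_prob_subseq[OF X] by blast
  have "AE w in M. ennreal ((norm (Y w))\<^sup>2) = liminf (\<lambda>n. ennreal ((norm (X (r n) w))\<^sup>2))"
    using r
  proof eventually_elim
    case (elim w)
    have "(\<lambda>n. ennreal ((norm (X (r n) w))\<^sup>2)) \<longlonglongrightarrow> ennreal ((norm (Y w))\<^sup>2)"
      by (intro tendsto_ennrealI tendsto_power tendsto_norm elim)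
    from lim_imp_Liminf[OF _ this] show ?case by simp
  qed
  then have "(\<integral>\<^sup>+ w. ennreal ((norm (Y w))\<^sup>2) \<partial>M) = (\<integral>\<^sup>+ w. liminf (\<lambda>n. ennreal ((norm (X (r n) w))\<^sup>2)) \<partial>M)"
    by (rule nn_integral_cong_AE)
  also have "\<dots> \<le> liminf (\<lambda>n. \<integral>\<^sup>+ w. ennreal ((norm (X (r n) w))\<^sup>2) \<partial>M)"
    by (rule nn_integral_liminf) measurable
  also have "\<dots> \<le> liminf (\<lambda>n. ennreal B)"
    using B by (intro Liminf_mono always_eventually) (simp add: second_moment_le_def)
  also have "\<dots> = ennreal B" by (simp add: Liminf_const)
  finally show ?thesis using B[of 0] by (simp add: second_moment_le_def)
qed

text \<open>Bounded second moments make the sequence uniformly integrable, so means converge along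
  with the variables. This is made quantitative by splitting the distance into a small multiple of
  its square and a large multiple of its truncation.\<close>

lemma tends_in_prob_mean_zero:
  assumes X: "tends_in_prob M X Y" and B: "\<And>n. second_moment_le M (X n) B"
    and zero: "\<And>n. (\<integral>w. X n w \<partial>M) = 0"
  shows "(\<integral>w. Y w \<partial>M) = 0"
proof -
  note Y = second_moment_le_limit[OF X B]
  note D = second_moment_le_diff[OF B Y]
  have B0: "B \<ge> 0" using Y by (simp add: second_moment_le_def)
  have [measurable]: "\<And>n. X n \<in> borel_measurable M" "Y \<in> borel_measurable M"
    using X by (auto simp: tends_in_prob_def)
  have *: "norm (\<integral>w. Y w \<partial>M) \<le> \<eta> * (4 * B) + 1/\<eta> * (\<integral>w. min 1 (norm (X n w - Y w)) \<partial>M)"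
    if \<eta>: "0 < \<eta>" "\<eta> \<le> 1" for \<eta> n
  proof -
    let ?d = "\<lambda>w. norm (X n w - Y w)"
    \<comment> \<open>Up to \<open>1/\<eta>\<close> the truncated term dominates \<open>d\<close>,
      beyond it the square does.\<close>
    have pw: "d \<le> \<eta> * d\<^sup>2 + 1/\<eta> * min 1 d" if "d \<ge> 0" for d :: real
    proof (cases "d \<le> 1/\<eta>")
      case True
      have "d \<le> 1/\<eta> * min 1 d"
        using True \<eta> that mult_left_le_one_le[of d \<eta>]
        by (cases "d \<le> 1") (auto simp: min_def field_simps)
      moreover have "0 \<le> \<eta> * d\<^sup>2" using \<eta> by simp
      ultimately show ?thesis by linarith
    next
      case False
      then have "1 \<le> \<eta> * d" using \<eta> by (simp add: field_simps)
      from mult_right_mono[OF this that] have "d \<le> \<eta> * d\<^sup>2" by (simp add: power2_eq_square mult_ac)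
      moreover have "0 \<le> 1/\<eta> * min 1 d" using \<eta> that by simp
      ultimately show ?thesis by linarith
    qed
    have "norm (\<integral>w. Y w \<partial>M) = norm (\<integral>w. X n w - Y w \<partial>M)"
      by (simp add: second_moment_le_integrable[OF Y] second_moment_le_integrable[OF B] zero)
    also have "\<dots> \<le> (\<integral>w. ?d w \<partial>M)" by (rule integral_norm_bound)
    also have "\<dots> \<le> (\<integral>w. \<eta> * (?d w)\<^sup>2 + 1/\<eta> * min 1 (?d w) \<partial>M)"
      using second_moment_le_integrable[OF D] second_moment_le_integrable_sq[OF D]
      by (intro integral_mono Bochner_Integration.integrable_add integrable_mult_right integrable_min_1_norm pw) auto
    also have "\<dots> = \<eta> * (\<integral>w. (?d w)\<^sup>2 \<partial>M) + 1/\<eta> * (\<integral>w. min 1 (?d w) \<partial>M)"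
      using second_moment_le_integrable_sq[OF D] integrable_min_1_norm[of "\<lambda>w. X n w - Y w"] by simp
    also have "\<dots> \<le> \<eta> * (4 * B) + 1/\<eta> * (\<integral>w. min 1 (?d w) \<partial>M)"
      using second_moment_le_integral[OF D] \<eta> by (intro add_right_mono mult_left_mono) auto
    finally show ?thesis .
  qed
  have **: "norm (\<integral>w. Y w \<partial>M) \<le> \<eta> * (4 * B)" if \<eta>: "0 < \<eta>" "\<eta> \<le> 1" for \<eta>
  proof -
    have "(\<lambda>n. \<eta> * (4 * B) + 1/\<eta> * (\<integral>w. min 1 (norm (X n w - Y w)) \<partial>M)) \<longlonglongrightarrow> \<eta> * (4 * B) + 1/\<eta> * 0"
      using X by (intro tendsto_intros) (auto simp: tends_in_prob_def)
    from tendsto_lowerbound[OF this always_eventually] *[OF \<eta>] show ?thesis by auto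
  qed
  have "norm (\<integral>w. Y w \<partial>M) \<le> 0 + e" if "e > 0" for e
  proof -
    define \<eta> where "\<eta> = min 1 (e / (4 * B + 1))"
    have \<eta>: "0 < \<eta>" "\<eta> \<le> 1" "\<eta> \<le> e / (4 * B + 1)" using that B0 by (auto simp: \<eta>_def)
    have "\<eta> * (4 * B) \<le> \<eta> * (4 * B + 1)" using \<eta> by (intro mult_left_mono) auto
    also have "\<dots> \<le> e" using \<eta>(3) B0 by (simp add: pos_le_divide_eq)
    finally show ?thesis using **[OF \<eta>(1,2)] by linarith
  qed
  then have "norm (\<integral>w. Y w \<partial>M) \<le> 0" by (rule field_le_epsilon)
  then show ?thesis by simp
qed

text \<open>The limit over all fine partitions is evaluated along one chosen sequence with vanishing
  mesh. The expected truncated distance is at most \<open>e/2\<close> plus the probability of a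
  deviation larger than \<open>e/2\<close>.\<close>

lemma riemann_lim_tends_in_prob:
  assumes R: "riemann_lim_in_prob M t S I"
    and \<tau>: "\<And>n. partition_upto t (k n) (\<tau> n)"
    and mesh: "\<And>n i. i < k n \<Longrightarrow> \<tau> n (Suc i) - \<tau> n i \<le> d n" "d \<longlonglongrightarrow> 0"
    and m: "\<And>n. S (k n) (\<tau> n) \<in> borel_measurable M"
  shows "tends_in_prob M (\<lambda>n. S (k n) (\<tau> n)) I"
  unfolding tends_in_prob_def
proof (intro conjI allI m)
  have I[measurable]: "I \<in> borel_measurable M" using R by (simp add: riemann_lim_in_prob_def)
  then show "I \<in> borel_measurable M" .
  note [measurable] = m
  show "(\<lambda>n. \<integral>w. min 1 (norm (S (k n) (\<tau> n) w - I w)) \<partial>M) \<longlonglongrightarrow> 0"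
  proof (rule LIMSEQ_I)
    fix e :: real assume "0 < e"
    then obtain \<delta> where \<delta>: "\<delta> > 0" "\<And>n \<tau>. partition_upto t n \<tau> \<Longrightarrow> (\<forall>i<n. \<tau> (Suc i) - \<tau> i < \<delta>) \<Longrightarrow>
        measure M {w \<in> space M. dist (S n \<tau> w) (I w) > e/2} < e/2"
      using R unfolding riemann_lim_in_prob_def by (meson half_gt_zero)
    obtain n0 where n0: "\<And>n. n \<ge> n0 \<Longrightarrow> d n < \<delta>"
      using order_tendstoD(2)[OF mesh(2) \<delta>(1)] unfolding eventually_sequentially by blast
    show "\<exists>n0. \<forall>n\<ge>n0. norm ((\<integral>w. min 1 (norm (S (k n) (\<tau> n) w - I w)) \<partial>M) - 0) < e"
    proof (intro exI allI impI)
      fix n assume "n \<ge> n0"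
      let ?X = "S (k n) (\<tau> n)"
      let ?E = "{w \<in> space M. dist (?X w) (I w) > e/2}"
      have "measure M ?E < e/2"
        using n0[OF \<open>n \<ge> n0\<close>] mesh(1)[of _ n] by (intro \<delta>(2) \<tau>) (meson le_less_trans)
      have iE: "integrable M (\<lambda>w. indicator ?E w :: real)"
        by (intro integrable_real_indicator) (auto simp: less_top[symmetric])
      have "(\<integral>w. min 1 (norm (?X w - I w)) \<partial>M) \<le> (\<integral>w. e/2 + indicator ?E w \<partial>M)"
      proof (intro integral_mono integrable_min_1_norm)
        show "integrable M (\<lambda>w. e/2 + indicator ?E w)"
          by (intro Bochner_Integration.integrable_add iE) simp
      qed (use \<open>0 < e\<close> in \<open>auto simp: dist_norm indicator_def\<close>)
      also have "\<dots> = e/2 + measure M ?E"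
        by (subst Bochner_Integration.integral_add[OF _ iE]) (auto simp: prob_space)
      finally have "(\<integral>w. min 1 (norm (?X w - I w)) \<partial>M) < e" using \<open>measure M ?E < e/2\<close> by linarith
      moreover have "0 \<le> (\<integral>w. min 1 (norm (?X w - I w)) \<partial>M)" by (intro integral_nonneg_AE) auto
      ultimately show "norm ((\<integral>w. min 1 (norm (?X w - I w)) \<partial>M) - 0) < e" by simp
    qed
  qed
qed

end

section \<open>Sums against independent increments\<close>

context prob_space
begin

text \<open>A centred square-integrable variable independent of the \<open>\<sigma>\<close>-algebra of \<open>G\<close>; independence
  is tested against real \<open>G\<close>-measurable variables.\<close>

definition fresh :: "'a measure \<Rightarrow> ('a \<Rightarrow> real) \<Rightarrow> bool" where
  "fresh G \<xi> \<longleftrightarrow> \<xi> \<in> borel_measurable M \<and> integrable M (\<lambda>w. (\<xi> w)\<^sup>2) \<and> expectation \<xi> = 0 \<and>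
     (\<forall>U. U \<in> borel_measurable G \<longrightarrow> indep_var borel \<xi> borel (U :: 'a \<Rightarrow> real))"

lemma fresh_integrable: "fresh G \<xi> \<Longrightarrow> integrable M \<xi>"
  by (rule square_integrable_imp_integrable) (simp_all add: fresh_def)

lemma fresh_mult:
  assumes "fresh G \<xi>" "U \<in> borel_measurable G" "integrable M U"
  shows "integrable M (\<lambda>w. \<xi> w * U w)" "expectation (\<lambda>w. \<xi> w * U w) = 0"
proof -
  have i: "indep_var borel \<xi> borel U" and z: "expectation \<xi> = 0"
    using assms(1,2) by (simp_all add: fresh_def)
  show "integrable M (\<lambda>w. \<xi> w * U w)"
    by (rule indep_var_integrable[OF i fresh_integrable[OF assms(1)] assms(3)])
  show "expectation (\<lambda>w. \<xi> w * U w) = 0"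
    by (subst indep_var_lebesgue_integral[OF i fresh_integrable[OF assms(1)] assms(3)]) (simp add: z)
qed

lemma fresh_sq_mult:
  assumes "fresh G \<xi>" "U \<in> borel_measurable G" "integrable M U"
  shows "integrable M (\<lambda>w. (\<xi> w)\<^sup>2 * U w)"
    "expectation (\<lambda>w. (\<xi> w)\<^sup>2 * U w) = expectation (\<lambda>w. (\<xi> w)\<^sup>2) * expectation U"
proof -
  have "indep_var borel \<xi> borel U" and sq: "integrable M (\<lambda>w. (\<xi> w)\<^sup>2)"
    using assms(1,2) by (simp_all add: fresh_def)
  have "indep_var borel ((\<lambda>x. x\<^sup>2) \<circ> \<xi>) borel ((\<lambda>x. x) \<circ> U)"
    by (rule indep_var_compose[OF \<open>indep_var borel \<xi> borel U\<close>]) measurable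
  then have i: "indep_var borel (\<lambda>w. (\<xi> w)\<^sup>2) borel U" unfolding comp_def .
  show "integrable M (\<lambda>w. (\<xi> w)\<^sup>2 * U w)"
    by (rule indep_var_integrable[OF i sq assms(3)])
  show "expectation (\<lambda>w. (\<xi> w)\<^sup>2 * U w) = expectation (\<lambda>w. (\<xi> w)\<^sup>2) * expectation U"
    by (rule indep_var_lebesgue_integral[OF i sq assms(3)])
qed

lemma fresh_scaleR:
  fixes Z :: "'a \<Rightarrow> 'b::euclidean_space"
  assumes \<xi>: "fresh G \<xi>" and G: "subalgebra M G" and Z: "Z \<in> borel_measurable G" "second_moment_le M Z z"
  shows "integrable M (\<lambda>w. (norm (\<xi> w *\<^sub>R Z w))\<^sup>2)"
    "expectation (\<lambda>w. (norm (\<xi> w *\<^sub>R Z w))\<^sup>2) = expectation (\<lambda>w. (\<xi> w)\<^sup>2) * expectation (\<lambda>w. (norm (Z w))\<^sup>2)"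
    "integrable M (\<lambda>w. \<xi> w *\<^sub>R Z w)" "expectation (\<lambda>w. \<xi> w *\<^sub>R Z w) = 0"
proof -
  have [measurable]: "\<xi> \<in> borel_measurable M" "Z \<in> borel_measurable M"
    using \<xi> measurable_from_subalg[OF G Z(1)] by (simp_all add: fresh_def)
  have "(\<lambda>w. (norm (Z w))\<^sup>2) \<in> borel_measurable G" using Z(1) by measurable
  note sq = fresh_sq_mult[OF \<xi> this second_moment_le_integrable_sq[OF Z(2)]]
  show i: "integrable M (\<lambda>w. (norm (\<xi> w *\<^sub>R Z w))\<^sup>2)"
    "expectation (\<lambda>w. (norm (\<xi> w *\<^sub>R Z w))\<^sup>2) = expectation (\<lambda>w. (\<xi> w)\<^sup>2) * expectation (\<lambda>w. (norm (Z w))\<^sup>2)"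
    using sq by (simp_all add: power_mult_distrib)
  show iZ: "integrable M (\<lambda>w. \<xi> w *\<^sub>R Z w)"
    by (rule second_moment_le_integrable[OF second_moment_leI[OF _ i(1) order_refl]]) measurable
  show "expectation (\<lambda>w. \<xi> w *\<^sub>R Z w) = 0"
  proof (rule euclidean_eqI)
    fix b :: 'b
    have "(\<lambda>w. inner (Z w) b) \<in> borel_measurable G" using Z(1) by measurable
    from fresh_mult(2)[OF \<xi> this] second_moment_le_integrable[OF Z(2)]
    have "expectation (\<lambda>w. inner (\<xi> w *\<^sub>R Z w) b) = 0" by simp
    then show "inner (expectation (\<lambda>w. \<xi> w *\<^sub>R Z w)) b = inner 0 b"
      using integral_inner_left[OF iZ, of b] by simp
  qed
qed

text \<open>A discrete Ito isometry. When the summand with index \<open>k\<close> is added, the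
  cross term is \<xi>_k times the inner product of the earlier partial sum with \<open>Z k\<close>;
  that inner product is measurable with respect to \<open>G k\<close>, so independence and centring
  of \<xi>_k make the mean vanish.\<close>

lemma sum_fresh_orthogonal:
  fixes Z :: "nat \<Rightarrow> 'a \<Rightarrow> 'b::euclidean_space"
  assumes \<xi>: "\<And>i. i < n \<Longrightarrow> fresh (G i) (\<xi> i)"
    and adapted: "\<And>i j. i < j \<Longrightarrow> j < n \<Longrightarrow> \<xi> i \<in> borel_measurable (G j)"
    and mono: "\<And>i j. i \<le> j \<Longrightarrow> j < n \<Longrightarrow> sets (G i) \<subseteq> sets (G j)"
    and sub: "\<And>i. i < n \<Longrightarrow> subalgebra M (G i)"
    and Z: "\<And>i. i < n \<Longrightarrow> Z i \<in> borel_measurable (G i)" "\<And>i w. i < n \<Longrightarrow> w \<in> space M \<Longrightarrow> norm (Z i w) \<le> K"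
    and v: "\<And>i. i < n \<Longrightarrow> expectation (\<lambda>w. (\<xi> i w)\<^sup>2) \<le> v i"
    and z: "\<And>i. i < n \<Longrightarrow> second_moment_le M (Z i) (z i)"
  shows "second_moment_le M (\<lambda>w. \<Sum>i<n. \<xi> i w *\<^sub>R Z i w) (\<Sum>i<n. v i * z i)"
    and "expectation (\<lambda>w. \<Sum>i<n. \<xi> i w *\<^sub>R Z i w) = 0"
proof -
  have sq: "integrable M (\<lambda>w. (norm (\<xi> i w *\<^sub>R Z i w))\<^sup>2)"
    "expectation (\<lambda>w. (norm (\<xi> i w *\<^sub>R Z i w))\<^sup>2) \<le> v i * z i"
    "integrable M (\<lambda>w. \<xi> i w *\<^sub>R Z i w)" "expectation (\<lambda>w. \<xi> i w *\<^sub>R Z i w) = 0" if "i < n" for i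
  proof -
    note f = fresh_scaleR[OF \<xi>[OF that] sub[OF that] Z(1)[OF that] z[OF that]]
    show "integrable M (\<lambda>w. (norm (\<xi> i w *\<^sub>R Z i w))\<^sup>2)"
      "integrable M (\<lambda>w. \<xi> i w *\<^sub>R Z i w)" "expectation (\<lambda>w. \<xi> i w *\<^sub>R Z i w) = 0" by (rule f)+
    have "0 \<le> expectation (\<lambda>w. (\<xi> i w)\<^sup>2)" by simp
    then show "expectation (\<lambda>w. (norm (\<xi> i w *\<^sub>R Z i w))\<^sup>2) \<le> v i * z i"
      unfolding f(2) using v[OF that] second_moment_le_integral[OF z[OF that]]
      by (intro mult_mono order_trans[OF _ v[OF that]]) auto
  qed
  have "second_moment_le M (\<lambda>w. \<Sum>i<k. \<xi> i w *\<^sub>R Z i w) (\<Sum>i<k. v i * z i)" if "k \<le> n" for k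
    using that
  proof (induction k)
    case 0
    then show ?case by (simp add: second_moment_le_def)
  next
    case (Suc k)
    then have k: "k < n" and IH: "second_moment_le M (\<lambda>w. \<Sum>i<k. \<xi> i w *\<^sub>R Z i w) (\<Sum>i<k. v i * z i)" by auto
    let ?S = "\<lambda>w. \<Sum>i<k. \<xi> i w *\<^sub>R Z i w"
    have [measurable]: "\<xi> i \<in> borel_measurable (G k)" "Z i \<in> borel_measurable (G k)" if "i < k" for i
    proof -
      have "subalgebra (G k) (G i)"
        using sub[of i] sub[OF k] mono[of i k] that k by (auto simp: subalgebra_def)
      from measurable_from_subalg[OF this] show "Z i \<in> borel_measurable (G k)" using Z(1)[of i] that k by simp
    qed (use adapted k that in auto)
    have mS: "?S \<in> borel_measurable (G k)" by measurable
    then have mU: "(\<lambda>w. inner (?S w) (Z k w)) \<in> borel_measurable (G k)" using Z(1)[OF k] by measurable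
    have [measurable]: "?S \<in> borel_measurable M" "Z k \<in> borel_measurable M" "\<xi> k \<in> borel_measurable M"
      using measurable_from_subalg[OF sub[OF k] mS] measurable_from_subalg[OF sub[OF k] Z(1)[OF k]] \<xi>[OF k]
      by (simp_all add: fresh_def)
    \<comment> \<open>The uniform bound \<open>K\<close> on \<open>Z k\<close> makes the cross term
      integrable: the earlier sum is only square-integrable.\<close>
    have iU: "integrable M (\<lambda>w. inner (?S w) (Z k w))"
    proof (rule Bochner_Integration.integrable_bound)
      show "integrable M (\<lambda>w. norm (?S w) * K)" using second_moment_le_integrable[OF IH] by simp
      show "AE w in M. norm (inner (?S w) (Z k w)) \<le> norm (norm (?S w) * K)"
      proof (rule AE_I2)
        fix w assume "w \<in> space M"
        then have "norm (Z k w) \<le> K" using Z(2)[OF k] by auto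
        have "norm (inner (?S w) (Z k w)) \<le> norm (?S w) * norm (Z k w)" by (simp add: Cauchy_Schwarz_ineq2)
        also have "\<dots> \<le> norm (?S w) * K" using \<open>norm (Z k w) \<le> K\<close> by (intro mult_left_mono) auto
        finally show "norm (inner (?S w) (Z k w)) \<le> norm (norm (?S w) * K)" by simp
      qed
    qed measurable
    note c = fresh_mult[OF \<xi>[OF k] mU iU]
    have e: "(norm (\<Sum>i<Suc k. \<xi> i w *\<^sub>R Z i w))\<^sup>2
        = (norm (?S w))\<^sup>2 + 2 * (\<xi> k w * inner (?S w) (Z k w)) + (norm (\<xi> k w *\<^sub>R Z k w))\<^sup>2" for w
      unfolding power2_norm_eq_inner
      by (simp add: inner_add_left inner_add_right inner_commute)
    show ?case
    proof (rule second_moment_leI)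
      show "(\<lambda>w. \<Sum>i<Suc k. \<xi> i w *\<^sub>R Z i w) \<in> borel_measurable M" by simp
      show "integrable M (\<lambda>w. (norm (\<Sum>i<Suc k. \<xi> i w *\<^sub>R Z i w))\<^sup>2)"
        unfolding e using second_moment_le_integrable_sq[OF IH] c(1) sq(1)[OF k] by simp
      have "expectation (\<lambda>w. (norm (\<Sum>i<Suc k. \<xi> i w *\<^sub>R Z i w))\<^sup>2)
          = expectation (\<lambda>w. (norm (?S w))\<^sup>2) + expectation (\<lambda>w. (norm (\<xi> k w *\<^sub>R Z k w))\<^sup>2)"
        unfolding e using second_moment_le_integrable_sq[OF IH] c sq(1)[OF k] by simp
      then show "expectation (\<lambda>w. (norm (\<Sum>i<Suc k. \<xi> i w *\<^sub>R Z i w))\<^sup>2) \<le> (\<Sum>i<Suc k. v i * z i)"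
        using second_moment_le_integral[OF IH] sq(2)[OF k] by simp
    qed
  qed
  then show "second_moment_le M (\<lambda>w. \<Sum>i<n. \<xi> i w *\<^sub>R Z i w) (\<Sum>i<n. v i * z i)" by simp
  show "expectation (\<lambda>w. \<Sum>i<n. \<xi> i w *\<^sub>R Z i w) = 0"
    by (subst Bochner_Integration.integral_sum) (use sq in auto)
qed

end

section \<open>Increments of Brownian motions\<close>

locale brownian =
  fixes P :: "'w measure" and F :: "real \<Rightarrow> 'w measure" and m :: nat and W :: "nat \<Rightarrow> real \<Rightarrow> 'w \<Rightarrow> real"
  assumes brownian: "brownian_motions P F m W"

sublocale brownian \<subseteq> prob_space P
  using brownian by (simp add: brownian_motions_def)

context brownian
begin

lemma subalgebra_F: "subalgebra P (F t)"
  using brownian by (simp add: brownian_motions_def)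

lemma space_F: "space (F t) = space P"
  using subalgebra_F by (simp add: subalgebra_def)

lemma sets_F_mono: "s \<le> t \<Longrightarrow> sets (F s) \<subseteq> sets (F t)"
  using brownian filtration.sets_F_mono unfolding brownian_motions_def by blast

lemma measurable_F_mono: "s \<le> t \<Longrightarrow> f \<in> F s \<rightarrow>\<^sub>M N \<Longrightarrow> f \<in> F t \<rightarrow>\<^sub>M N"
  by (rule measurable_from_subalg[of "F t" "F s"]) (auto simp: subalgebra_def space_F sets_F_mono)

lemma measurable_F: "f \<in> F s \<rightarrow>\<^sub>M N \<Longrightarrow> f \<in> P \<rightarrow>\<^sub>M N"
  by (rule measurable_from_subalg[OF subalgebra_F])

lemma W_measurable_F: "j < m \<Longrightarrow> 0 \<le> s \<Longrightarrow> s \<le> t \<Longrightarrow> W j s \<in> borel_measurable (F t)"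
  using brownian measurable_F_mono[of s t] unfolding brownian_motions_def by blast

lemma W_measurable: "j < m \<Longrightarrow> 0 \<le> t \<Longrightarrow> W j t \<in> borel_measurable P"
  using W_measurable_F measurable_F by blast

lemma W_0: "j < m \<Longrightarrow> w \<in> space P \<Longrightarrow> W j 0 w = 0"
  using brownian by (simp add: brownian_motions_def)

lemma W_continuous: "j < m \<Longrightarrow> w \<in> space P \<Longrightarrow> continuous_on {0..} (\<lambda>t. W j t w)"
  using brownian by (simp add: brownian_motions_def)

definition dW :: "nat \<Rightarrow> real \<Rightarrow> real \<Rightarrow> 'w \<Rightarrow> real" where
  "dW j s t w = W j t w - W j s w"

lemma dW_measurable[measurable]: "j < m \<Longrightarrow> 0 \<le> s \<Longrightarrow> s \<le> t \<Longrightarrow> dW j s t \<in> borel_measurable P"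
  unfolding dW_def[abs_def] using W_measurable[of j s] W_measurable[of j t] by auto

lemma dW_measurable_F: "j < m \<Longrightarrow> 0 \<le> s \<Longrightarrow> s \<le> t \<Longrightarrow> t \<le> u \<Longrightarrow> dW j s t \<in> borel_measurable (F u)"
  unfolding dW_def[abs_def] using W_measurable_F[of j s u] W_measurable_F[of j t u] by auto

text \<open>The even moments of a centred normal variable with variance \<sigma>^2 are (2k)!
  \<sigma>^(2k) / (2^k k!). The strict inequality between the times keeps the normal density
  nondegenerate.\<close>

lemma dW_moments:
  assumes j: "j < m" and st: "0 \<le> s" "s < t"
  shows "integrable P (\<lambda>w. (dW j s t w)^k)" "expectation (dW j s t) = 0"
    "expectation (\<lambda>w. (dW j s t w)\<^sup>2) = t - s" "expectation (\<lambda>w. (dW j s t w)^4) = 3 * (t - s)\<^sup>2"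
proof -
  define \<sigma> where "\<sigma> = sqrt (t - s)"
  have \<sigma>: "0 < \<sigma>" using st by (simp add: \<sigma>_def)
  have D: "distributed P lborel (dW j s t) (normal_density 0 \<sigma>)"
    using brownian j st unfolding brownian_motions_def dW_def[abs_def] \<sigma>_def by auto
  have nn: "\<And>x. 0 \<le> normal_density 0 \<sigma> x" using \<sigma> by (intro normal_density_nonneg)
  show "integrable P (\<lambda>w. (dW j s t w)^k)"
    using distributed_integrable[OF D, of "\<lambda>x. x^k"] integrable_normal_moment[OF \<sigma>, of 0 k] nn by simp
  show "expectation (dW j s t) = 0" by (rule normal_distributed_expectation[OF \<sigma> D])
  have E: "expectation (\<lambda>w. (dW j s t w)^(2*k)) = fact (2 * k) / ((2 / \<sigma>\<^sup>2)^k * fact k)" for k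
    using distributed_integral[OF D, of "\<lambda>x. x^(2*k)"] integral_normal_moment_even[OF \<sigma>, of 0 k] nn by simp
  have \<sigma>2: "\<sigma>\<^sup>2 = t - s" using st by (simp add: \<sigma>_def)
  show "expectation (\<lambda>w. (dW j s t w)\<^sup>2) = t - s"
    using E[of 1] \<sigma> by (simp add: fact_numeral \<sigma>2)
  show "expectation (\<lambda>w. (dW j s t w)^4) = 3 * (t - s)\<^sup>2"
    using E[of 2] \<sigma> st by (simp add: fact_numeral \<sigma>2 power_divide)
qed

text \<open>The past occupies the spare index \<open>m\<close> next to the \<open>m\<close>
  increments. Independence of the past from a single increment or from a pair is then a restriction
  to blocks of indices.\<close>

lemma indep_increments:
  assumes st: "0 \<le> s" "s < t" and U: "U \<in> borel_measurable (F s)"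
  shows "indep_vars (\<lambda>_. borel) (\<lambda>j. if j = m then U else dW j s t) {..m}"
proof -
  have I: "indep_sets (\<lambda>j. if j = m then sets (F s)
      else {(\<lambda>w. W j t w - W j s w) -` B \<inter> space P | B. B \<in> sets borel}) {..m}"
    using brownian st by (simp add: brownian_motions_def)
  show ?thesis
    unfolding indep_vars_def2
  proof (intro conjI ballI)
    fix i assume "i \<in> {..m}"
    then show "random_variable borel (if i = m then U else dW i s t)"
      using U st measurable_F dW_measurable[of i s t] by auto
  next
    show "indep_sets (\<lambda>i. {(if i = m then U else dW i s t) -` A \<inter> space P |A. A \<in> sets borel}) {..m}"
      by (rule indep_sets_mono_sets[OF I])
        (use measurable_sets[OF U] in \<open>auto simp: dW_def[abs_def] space_F\<close>)
  qed
qed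

lemma fresh_dW:
  assumes j: "j < m" and st: "0 \<le> s" "s < t"
  shows "fresh (F s) (dW j s t)"
  unfolding fresh_def
proof (intro conjI allI impI)
  fix U :: "'w \<Rightarrow> real" assume U: "U \<in> borel_measurable (F s)"
  have "indep_var (PiM {j} (\<lambda>_. borel)) (\<lambda>\<omega>. restrict (\<lambda>i. (if i = m then U else dW i s t) \<omega>) {j})
      (PiM {m} (\<lambda>_. borel)) (\<lambda>\<omega>. restrict (\<lambda>i. (if i = m then U else dW i s t) \<omega>) {m})"
    by (rule indep_var_restrict[OF indep_increments[OF st U]]) (use j in auto)
  from indep_var_compose[OF this measurable_component_singleton measurable_component_singleton, of j m]
  show "indep_var borel (dW j s t) borel U" using j by (simp add: comp_def)
qed (use assms dW_moments[OF assms] in auto)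

text \<open>The compensated products are what the quadratic part of a covariation sum consists of.
  Their variance is 2(t-s)^2 for equal indices, by the fourth normal moment, and (t-s)^2 otherwise;
  the constant 3 covers both cases.\<close>

lemma fresh_dW_mult:
  assumes j: "j < m" "l < m" and st: "0 \<le> s" "s < t"
  defines "\<xi> \<equiv> \<lambda>w. dW j s t w * dW l s t w - (if j = l then t - s else 0)"
  shows "fresh (F s) \<xi>" "expectation (\<lambda>w. (\<xi> w)\<^sup>2) \<le> 3 * (t - s)\<^sup>2"
proof -
  note mom = dW_moments[OF j(1) st] dW_moments[OF j(2) st]
  have [measurable]: "dW j s t \<in> borel_measurable P" "dW l s t \<in> borel_measurable P" using j st by auto
  have ind: "expectation (\<lambda>w. f (dW j s t w) * f (dW l s t w)) =
      expectation (\<lambda>w. f (dW j s t w)) * expectation (\<lambda>w. f (dW l s t w))"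
    "integrable P (\<lambda>w. f (dW j s t w) * f (dW l s t w))"
    if "j \<noteq> l" and f[measurable]: "f \<in> borel_measurable borel" "integrable P (\<lambda>w. f (dW j s t w))" "integrable P (\<lambda>w. f (dW l s t w))"
    for f :: "real \<Rightarrow> real"
  proof -
    \<comment> \<open>The slot of the past is filled with the constant 0, since only two increments
      are compared here.\<close>
    have "indep_var (PiM {j} (\<lambda>_. borel)) (\<lambda>\<omega>. restrict (\<lambda>i. (if i = m then (\<lambda>_. 0) else dW i s t) \<omega>) {j})
        (PiM {l} (\<lambda>_. borel)) (\<lambda>\<omega>. restrict (\<lambda>i. (if i = m then (\<lambda>_. 0) else dW i s t) \<omega>) {l})"
      by (rule indep_var_restrict[OF indep_increments[OF st]]) (use j that in auto)
    then have "indep_var borel ((\<lambda>g. f (g j)) \<circ> (\<lambda>\<omega>. restrict (\<lambda>i. (if i = m then (\<lambda>_. 0) else dW i s t) \<omega>) {j}))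
        borel ((\<lambda>g. f (g l)) \<circ> (\<lambda>\<omega>. restrict (\<lambda>i. (if i = m then (\<lambda>_. 0) else dW i s t) \<omega>) {l}))"
      by (rule indep_var_compose) measurable
    then have "indep_var borel (\<lambda>w. f (dW j s t w)) borel (\<lambda>w. f (dW l s t w))" using j by (simp add: comp_def)
    from indep_var_lebesgue_integral[OF this f(2,3)] indep_var_integrable[OF this f(2,3)]
    show "expectation (\<lambda>w. f (dW j s t w) * f (dW l s t w)) =
      expectation (\<lambda>w. f (dW j s t w)) * expectation (\<lambda>w. f (dW l s t w))"
      "integrable P (\<lambda>w. f (dW j s t w) * f (dW l s t w))" by auto
  qed
  have "integrable P \<xi> \<and> expectation \<xi> = 0 \<and> integrable P (\<lambda>w. (\<xi> w)\<^sup>2) \<and> expectation (\<lambda>w. (\<xi> w)\<^sup>2) \<le> 3 * (t - s)\<^sup>2"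
  proof (cases "j = l")
    case True
    have i: "integrable P (\<lambda>w. (dW l s t w)\<^sup>2)" "integrable P (\<lambda>w. (dW l s t w)^4)" using mom by auto
    have e: "\<xi> = (\<lambda>w. (dW l s t w)\<^sup>2 - (t - s))" using True by (simp add: \<xi>_def power2_eq_square)
    have e2: "(\<lambda>w. (\<xi> w)\<^sup>2) = (\<lambda>w. (dW l s t w)^4 - 2 * (t - s) * (dW l s t w)\<^sup>2 + (t - s)\<^sup>2)"
    proof -
      have "(y\<^sup>2 - a)\<^sup>2 = y^4 - 2 * a * y\<^sup>2 + a\<^sup>2" for y a :: real
        by (simp add: power2_eq_square power4_eq_xxxx algebra_simps)
      then show ?thesis by (simp only: e)
    qed
    have "expectation (\<lambda>w. (\<xi> w)\<^sup>2) = 3 * (t - s)\<^sup>2 - 2 * (t - s) * (t - s) + (t - s)\<^sup>2"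
      unfolding e2 using i mom by (simp add: prob_space)
    also have "\<dots> = 2 * (t - s)\<^sup>2" by (simp add: power2_eq_square algebra_simps)
    also have "\<dots> \<le> 3 * (t - s)\<^sup>2" by (intro mult_right_mono) auto
    finally have "expectation (\<lambda>w. (\<xi> w)\<^sup>2) \<le> 3 * (t - s)\<^sup>2" .
    moreover have "integrable P (\<lambda>w. (\<xi> w)\<^sup>2)" unfolding e2 using i by simp
    moreover have "integrable P \<xi>" "expectation \<xi> = 0" unfolding e using i mom by (simp_all add: prob_space)
    ultimately show ?thesis by blast
  next
    case False
    have i1: "integrable P (\<lambda>w. dW j s t w)" "integrable P (\<lambda>w. dW l s t w)"
      using mom(1)[of 1] mom(5)[of 1] by auto
    have e2: "(\<xi> w)\<^sup>2 = (dW j s t w)\<^sup>2 * (dW l s t w)\<^sup>2" for w using False by (simp add: \<xi>_def power_mult_distrib)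
    show ?thesis
      unfolding e2
      using ind[OF False, of "\<lambda>x. x", OF _ i1] ind[OF False, of "\<lambda>x. x\<^sup>2", OF _ mom(1,5)] False mom(2,3,6,7)
        zero_le_power2[of "t - s"]
      by (simp add: \<xi>_def flip: power2_eq_square)
  qed
  note mt = this
  show "expectation (\<lambda>w. (\<xi> w)\<^sup>2) \<le> 3 * (t - s)\<^sup>2" using mt by blast
  show "fresh (F s) \<xi>"
    unfolding fresh_def
  proof (intro conjI allI impI)
    show "\<xi> \<in> borel_measurable P" unfolding \<xi>_def by measurable
    fix U :: "'w \<Rightarrow> real" assume U: "U \<in> borel_measurable (F s)"
    \<comment> \<open>The product depends on the block of indices \<open>{j,l}\<close> only, which
      is independent of the block \<open>{m}\<close> that carries \<open>U\<close>.\<close>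
    have "indep_var (PiM {j,l} (\<lambda>_. borel)) (\<lambda>\<omega>. restrict (\<lambda>i. (if i = m then U else dW i s t) \<omega>) {j,l})
        (PiM {m} (\<lambda>_. borel)) (\<lambda>\<omega>. restrict (\<lambda>i. (if i = m then U else dW i s t) \<omega>) {m})"
      by (rule indep_var_restrict[OF indep_increments[OF st U]]) (use j in auto)
    then have "indep_var borel ((\<lambda>f. f j * f l - (if j = l then t - s else 0)) \<circ> (\<lambda>\<omega>. restrict (\<lambda>i. (if i = m then U else dW i s t) \<omega>) {j,l}))
        borel ((\<lambda>f. f m) \<circ> (\<lambda>\<omega>. restrict (\<lambda>i. (if i = m then U else dW i s t) \<omega>) {m}))"
      by (rule indep_var_compose) measurable
    then show "indep_var borel \<xi> borel U" using j by (simp add: comp_def \<xi>_def)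
  qed (use mt in auto)
qed

end

section \<open>Ito increments of a Stratonovich solution\<close>

lemma sum_lessThan_add: "(\<Sum>i<n + k. f i) = (\<Sum>i<n. f i) + (\<Sum>i<k. f (n + i))"
  for f :: "nat \<Rightarrow> 'b::comm_monoid_add"
  by (induction k) (simp_all add: add.assoc)

text \<open>\<open>N\<close> equal steps on [0,s] are followed by \<open>N\<close> equal steps on
  [s,u]. A single sequence thus approximates the integrals up to \<open>s\<close> and up to
  \<open>u\<close>, and the difference of the two Riemann sums is a sum over [s,u]. For
  \<open>s = 0\<close> the first points coincide, which \<open>partition_upto\<close>
  permits.\<close>

definition two_step_partition :: "real \<Rightarrow> real \<Rightarrow> nat \<Rightarrow> nat \<Rightarrow> real" where
  "two_step_partition s u N i = (if i \<le> N then s * (i / N) else s + (u - s) * (real (i - N) / N))"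

lemma two_step_partition:
  assumes su: "0 \<le> s" "s \<le> u" and N: "N > 0"
  shows "partition_upto u (2 * N) (two_step_partition s u N)" "partition_upto s N (two_step_partition s u N)"
    "\<And>i. i < 2 * N \<Longrightarrow> two_step_partition s u N (Suc i) - two_step_partition s u N i \<le> u / N"
    "\<And>i. two_step_partition s u N (N + i) = s + (u - s) * (i / N)"
proof -
  let ?\<tau> = "two_step_partition s u N"
  show ti: "?\<tau> (N + i) = s + (u - s) * (i / N)" for i
    using N by (cases i) (auto simp: two_step_partition_def)
  have d: "?\<tau> (Suc i) - ?\<tau> i = (if i < N then s / N else (u - s) / N)" for i
  proof (cases "i < N")
    case True
    then show ?thesis using N by (simp add: two_step_partition_def field_simps)
  next
    case False
    define k where "k = i - N"
    have "i = N + k" using False by (simp add: k_def)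
    moreover have "?\<tau> (N + Suc k) - ?\<tau> (N + k) = (u - s) / N"
      unfolding ti by (simp add: add_divide_distrib distrib_left)
    ultimately show ?thesis using False by simp
  qed
  have d0: "?\<tau> i \<le> ?\<tau> (Suc i)" for i
  proof -
    have "0 \<le> ?\<tau> (Suc i) - ?\<tau> i" unfolding d using su by simp
    then show ?thesis by simp
  qed
  have "?\<tau> (2 * N) = u" using ti[of N] N by (simp add: mult_2)
  moreover have "?\<tau> 0 = 0" "?\<tau> N = s" using N by (simp_all add: two_step_partition_def)
  ultimately show "partition_upto u (2 * N) ?\<tau>" "partition_upto s N ?\<tau>"
    using d0 unfolding partition_upto_def by simp_all
  show "?\<tau> (Suc i) - ?\<tau> i \<le> u / N" for i
    unfolding d using su N by (auto intro: divide_right_mono)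
qed

text \<open>\<open>D j y\<close> plays the role of the derivative of \<open>X j\<close> at \<open>y\<close>, and \<open>K\<close> is a common bound on \<open>M\<close>.  The
  Stratonovich integrals are given through their Ito parts \<open>I\<close> and covariations \<open>C\<close>.\<close>

locale stratonovich_diffusion = brownian P F m W
  for P :: "'w measure" and F :: "real \<Rightarrow> 'w measure" and m :: nat and W :: "nat \<Rightarrow> real \<Rightarrow> 'w \<Rightarrow> real" +
  fixes M :: "'a::euclidean_space set" and X :: "nat \<Rightarrow> 'a \<Rightarrow> 'a" and D :: "nat \<Rightarrow> 'a \<Rightarrow> 'a \<Rightarrow> 'a"
    and K :: real and x :: 'a and Y :: "real \<Rightarrow> 'w \<Rightarrow> 'a"
    and I C :: "nat \<Rightarrow> real \<Rightarrow> 'w \<Rightarrow> 'a"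
  assumes compact: "compact M" and xM: "x \<in> M" and K: "K \<ge> 0"
    and X_cont: "j < m \<Longrightarrow> continuous_on M (X j)"
    and D_linear: "j < m \<Longrightarrow> y \<in> M \<Longrightarrow> linear (D j y)"
    and D_bound: "j < m \<Longrightarrow> y \<in> M \<Longrightarrow> norm (D j y u) \<le> K * norm u"
    and DX_cont: "j < m \<Longrightarrow> l < m \<Longrightarrow> continuous_on M (\<lambda>y. D j y (X l y))"
    and M_bound: "y \<in> M \<Longrightarrow> norm y \<le> K"
    and X_bound: "j < m \<Longrightarrow> y \<in> M \<Longrightarrow> norm (X j y) \<le> K"
    and X_Taylor: "j < m \<Longrightarrow> y \<in> M \<Longrightarrow> y' \<in> M \<Longrightarrow>
      norm (X j y' - X j y - D j y (y' - y)) \<le> K * (norm (y' - y))\<^sup>2"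
    and Y_measurable: "0 \<le> t \<Longrightarrow> Y t \<in> F t \<rightarrow>\<^sub>M restrict_space borel M"
    and Y_0: "w \<in> space P \<Longrightarrow> Y 0 w = x"
    and Y_cont: "w \<in> space P \<Longrightarrow> continuous_on {0..} (\<lambda>t. Y t w)"
    and I: "j < m \<Longrightarrow> ito_integral P (\<lambda>t w. X j (Y t w)) (W j) (I j)"
    and C: "j < m \<Longrightarrow> covariation P (\<lambda>t w. X j (Y t w)) (W j) (C j)"
    and Y_eq: "0 \<le> t \<Longrightarrow> AE w in P. Y t w = x + (\<Sum>j<m. I j t w + (1/2) *\<^sub>R C j t w)"
begin

lemma Y_in_M: "0 \<le> t \<Longrightarrow> w \<in> space P \<Longrightarrow> Y t w \<in> M"
  using measurable_space[OF Y_measurable, of t w] by (simp add: space_F space_restrict_space)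

lemma fY_measurable_F:
  fixes f :: "'a \<Rightarrow> 'b::topological_space"
  assumes "continuous_on M f" "0 \<le> s" "s \<le> t"
  shows "(\<lambda>w. f (Y s w)) \<in> borel_measurable (F t)"
  by (rule measurable_F_mono[OF \<open>s \<le> t\<close> measurable_compose[OF Y_measurable[OF \<open>0 \<le> s\<close>]
        borel_measurable_continuous_on_restrict[OF assms(1)]]])

lemma fY_measurable:
  fixes f :: "'a \<Rightarrow> 'b::topological_space"
  assumes "continuous_on M f" "0 \<le> s"
  shows "(\<lambda>w. f (Y s w)) \<in> borel_measurable P"
  using fY_measurable_F[OF assms order_refl] by (rule measurable_F)

lemma fY_bounded:
  fixes f :: "'a \<Rightarrow> 'b::euclidean_space"
  assumes "continuous_on M f"
  obtains B where "B \<ge> 0" "\<And>y. y \<in> M \<Longrightarrow> norm (f y) \<le> B"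
proof -
  have "bounded (f ` M)" using assms compact compact_continuous_image compact_imp_bounded by blast
  then obtain B where "B > 0" "\<And>y. y \<in> M \<Longrightarrow> norm (f y) \<le> B" unfolding bounded_pos by auto
  then show ?thesis by (intro that[of B]) auto
qed

text \<open>The supremum over nearby pairs of times is taken outside the expectation, so no
  measurability of a pathwise modulus of continuity is involved. It tends to 0 by dominated
  convergence along pairs that almost attain it, because each path is uniformly continuous.\<close>

lemma time_modulus:
  fixes f :: "'a \<Rightarrow> 'b::euclidean_space"
  assumes f: "continuous_on M f" and t: "t \<ge> 0"
  obtains \<epsilon> :: "nat \<Rightarrow> real" where "\<epsilon> \<longlonglongrightarrow> 0"
    "\<And>n s r. s \<in> {0..t} \<Longrightarrow> r \<in> {0..t} \<Longrightarrow> \<bar>s - r\<bar> \<le> t / real (Suc n) \<Longrightarrow>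
       second_moment_le P (\<lambda>w. f (Y s w) - f (Y r w)) (\<epsilon> n)"
proof -
  obtain B where B: "B \<ge> 0" "\<And>y. y \<in> M \<Longrightarrow> norm (f y) \<le> B"
    using fY_bounded[OF f] by blast
  have B2: "norm (f (Y s w) - f (Y r w)) \<le> 2 * B" if "s \<ge> 0" "r \<ge> 0" "w \<in> space P" for s r w
    using norm_triangle_ineq4[of "f (Y s w)" "f (Y r w)"] B(2)[OF Y_in_M[of s w]] B(2)[OF Y_in_M[of r w]] that by linarith
  have [measurable]: "(\<lambda>w. f (Y s w)) \<in> borel_measurable P" if "s \<ge> 0" for s using fY_measurable[OF f that] .
  define E where "E s r = expectation (\<lambda>w. (norm (f (Y s w) - f (Y r w)))\<^sup>2)" for s r
  have sm: "second_moment_le P (\<lambda>w. f (Y s w) - f (Y r w)) ((2 * B)\<^sup>2)" if "s \<ge> 0" "r \<ge> 0" for s r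
    using B2[OF that] B(1) that by (intro second_moment_le_bounded) auto
  define A where "A n = {(s, r). s \<in> {0..t} \<and> r \<in> {0..t} \<and> \<bar>s - r\<bar> \<le> t / real (Suc n)}" for n
  define \<epsilon> where "\<epsilon> n = (SUP p\<in>A n. E (fst p) (snd p))" for n
  have E_le: "E s r \<le> (2 * B)\<^sup>2" if "s \<ge> 0" "r \<ge> 0" for s r
    unfolding E_def using second_moment_le_integral[OF sm[OF that]] .
  have bdd: "bdd_above ((\<lambda>p. E (fst p) (snd p)) ` A n)" for n
    by (rule bdd_aboveI2[of _ _ "(2 * B)\<^sup>2"], rule E_le) (auto simp: A_def)
  have ne: "A n \<noteq> {}" for n using t by (auto simp: A_def intro!: exI[of _ 0])
  \<comment> \<open>A pair of times that attains the supremum up to \<open>inverse (Suc n)\<close>;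
    the convergence of the suprema is reduced to that along this sequence of pairs.\<close>
  have "\<exists>p\<in>A n. \<epsilon> n - inverse (Suc n) < E (fst p) (snd p)" for n
    using less_cSUP_iff[OF ne bdd, of "\<epsilon> n - inverse (Suc n)" n] by (simp add: \<epsilon>_def)
  then obtain p where p: "\<And>n. p n \<in> A n" "\<And>n. \<epsilon> n - inverse (Suc n) < E (fst (p n)) (snd (p n))" by metis
  have pt: "fst (p n) \<in> {0..t}" "snd (p n) \<in> {0..t}" "\<bar>fst (p n) - snd (p n)\<bar> \<le> t / real (Suc n)" for n
    using p(1)[of n] by (auto simp: A_def)
  have "(\<lambda>n. E (fst (p n)) (snd (p n))) \<longlonglongrightarrow> expectation (\<lambda>w. 0)"
    unfolding E_def
  proof (rule integral_dominated_convergence[where w="\<lambda>_. (2 * B)\<^sup>2"])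
    show "AE w in P. (\<lambda>n. (norm (f (Y (fst (p n)) w) - f (Y (snd (p n)) w)))\<^sup>2) \<longlonglongrightarrow> 0"
    proof (rule AE_I2)
      fix w assume w: "w \<in> space P"
      have "continuous_on {0..t} (\<lambda>s. f (Y s w))"
        by (rule continuous_on_compose2[OF f continuous_on_subset[OF Y_cont[OF w]]]) (use Y_in_M w in auto)
      then have "uniformly_continuous_on {0..t} (\<lambda>s. f (Y s w))"
        by (rule compact_uniformly_continuous) simp
      moreover have "(\<lambda>n. dist (fst (p n)) (snd (p n))) \<longlonglongrightarrow> 0"
      proof (rule tendsto_sandwich[OF _ _ tendsto_const])
        show "(\<lambda>n. t / real (Suc n)) \<longlonglongrightarrow> 0" by (rule LIMSEQ_Suc[OF lim_const_over_n])
      qed (use pt in \<open>auto simp: dist_real_def\<close>)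
      ultimately have "(\<lambda>n. dist (f (Y (fst (p n)) w)) (f (Y (snd (p n)) w))) \<longlonglongrightarrow> 0"
        using uniformly_continuous_on_sequentially[THEN iffD1, rule_format, of _ _ "\<lambda>n. fst (p n)" "\<lambda>n. snd (p n)"] pt(1,2)
        by blast
      from tendsto_power[OF this, of 2]
      show "(\<lambda>n. (norm (f (Y (fst (p n)) w) - f (Y (snd (p n)) w)))\<^sup>2) \<longlonglongrightarrow> 0"
        by (simp add: dist_norm)
    qed
    show "AE w in P. norm ((norm (f (Y (fst (p n)) w) - f (Y (snd (p n)) w)))\<^sup>2) \<le> (2 * B)\<^sup>2" for n
    proof (rule AE_I2)
      fix w assume w: "w \<in> space P"
      have "(norm (f (Y (fst (p n)) w) - f (Y (snd (p n)) w)))\<^sup>2 \<le> (2 * B)\<^sup>2"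
        using pt[of n] w by (intro power_mono B2) auto
      then show "norm ((norm (f (Y (fst (p n)) w) - f (Y (snd (p n)) w)))\<^sup>2) \<le> (2 * B)\<^sup>2" by simp
    qed
    show "(\<lambda>w. (norm (f (Y (fst (p n)) w) - f (Y (snd (p n)) w)))\<^sup>2) \<in> borel_measurable P" for n
      using pt(1,2)[of n] by auto
  qed auto
  then have lim0: "(\<lambda>n. E (fst (p n)) (snd (p n)) + inverse (Suc n)) \<longlonglongrightarrow> 0 + 0"
    by (intro tendsto_add LIMSEQ_inverse_real_of_nat) simp
  have E_\<epsilon>: "E s r \<le> \<epsilon> n" if "s \<in> {0..t}" "r \<in> {0..t}" "\<bar>s - r\<bar> \<le> t / real (Suc n)" for s r n
    using cSUP_upper[OF _ bdd, of "(s, r)" n] that by (simp add: \<epsilon>_def A_def)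
  have \<epsilon>0: "0 \<le> \<epsilon> n" for n using E_\<epsilon>[of 0 0 n] t by (simp add: E_def)
  have "\<epsilon> \<longlonglongrightarrow> 0"
    by (rule tendsto_sandwich[OF _ _ tendsto_const lim0[simplified]])
      (use p(2) \<epsilon>0 in \<open>auto intro!: always_eventually simp: less_imp_le algebra_simps diff_less_eq\<close>)
  then show ?thesis
  proof (rule that)
    fix n s r assume sr: "s \<in> {0..t}" "r \<in> {0..t}" "\<bar>s - r\<bar> \<le> t / real (Suc n)"
    then have sr0: "0 \<le> s" "0 \<le> r" by auto
    show "second_moment_le P (\<lambda>w. f (Y s w) - f (Y r w)) (\<epsilon> n)"
      by (rule second_moment_leI[OF second_moment_le_measurable[OF sm[OF sr0]]
            second_moment_le_integrable_sq[OF sm[OF sr0]]]) (use E_\<epsilon>[OF sr] in \<open>simp add: E_def\<close>)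
  qed
qed

text \<open>Along partitions of [s,u], the error of freezing the integrand at time \<open>s\<close>
  is a sum of Brownian increments against \<open>X j (Y r) - X j (Y s)\<close>. The isometry bounds
  its second moment by (u-s)\<epsilon>; the bound and the vanishing mean both survive the limit in
  probability.\<close>

lemma Ito_increment:
  assumes j: "j < m" and su: "0 \<le> s" "s < u"
    and \<epsilon>: "\<And>r. r \<in> {s..u} \<Longrightarrow> second_moment_le P (\<lambda>w. X j (Y r w) - X j (Y s w)) \<epsilon>"
  shows "second_moment_le P (\<lambda>w. I j u w - I j s w - dW j s u w *\<^sub>R X j (Y s w)) ((u - s) * \<epsilon>)"
    and "expectation (\<lambda>w. I j u w - I j s w - dW j s u w *\<^sub>R X j (Y s w)) = 0"
proof -
  define \<tau> where "\<tau> n = two_step_partition s u (Suc n)" for n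
  note \<tau> = two_step_partition[OF su(1) less_imp_le[OF su(2)] zero_less_Suc, folded \<tau>_def]
  define S where "S k t w = (\<Sum>i<k. (W j (t (Suc i)) w - W j (t i) w) *\<^sub>R X j (Y (t i) w))" for k :: nat and t w
  define \<sigma> where "\<sigma> n i = s + (u - s) * (i / Suc n)" for n i :: nat
  have \<sigma>: "\<sigma> n i \<in> {s..u}" if "i \<le> Suc n" for n i
  proof -
    have "real i / Suc n \<le> 1" using that by (simp add: divide_le_eq)
    define A where "A = (u - s) * (i / Suc n)"
    have "A \<le> (u - s) * 1" unfolding A_def using \<open>real i / Suc n \<le> 1\<close> su by (intro mult_left_mono) auto
    moreover have "0 \<le> A" using su by (simp add: A_def)
    ultimately show ?thesis unfolding \<sigma>_def A_def[symmetric] by simp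
  qed
  have \<sigma>_diff: "\<sigma> n (Suc i) - \<sigma> n i = (u - s) / Suc n" for n i
    by (simp add: \<sigma>_def algebra_simps add_divide_distrib diff_divide_distrib)
  have \<sigma>_mono: "\<sigma> n i \<le> \<sigma> n k" if "i \<le> k" for n i k
    using that su by (simp add: \<sigma>_def divide_right_mono mult_left_mono)
  have \<sigma>_less: "\<sigma> n i < \<sigma> n (Suc i)" for n i
  proof -
    have "0 < \<sigma> n (Suc i) - \<sigma> n i" unfolding \<sigma>_diff using su by simp
    then show ?thesis by simp
  qed
  have R: "riemann_lim_in_prob P t S (I j t)" if "t \<ge> 0" for t
    using I[OF j] that unfolding ito_integral_def S_def[abs_def] by blast
  have [measurable]: "(\<lambda>w. X j (Y r w)) \<in> borel_measurable P" "W j r \<in> borel_measurable P" if "r \<ge> 0" for r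
    using fY_measurable[OF X_cont[OF j] that] W_measurable[OF j that] by auto
  have mS: "S k \<tau>' \<in> borel_measurable P" if "\<And>i. i \<le> k \<Longrightarrow> 0 \<le> \<tau>' i" for k \<tau>'
    unfolding S_def[abs_def] using that by (intro borel_measurable_sum borel_measurable_scaleR borel_measurable_diff) auto
  have \<tau>0: "0 \<le> \<tau> n i" for n i
    unfolding \<tau>_def two_step_partition_def using su by auto
  have lim_u: "tends_in_prob P (\<lambda>n. S (2 * Suc n) (\<tau> n)) (I j u)"
    by (rule riemann_lim_tends_in_prob[OF R[of u] \<tau>(1) \<tau>(3) LIMSEQ_Suc[OF lim_const_over_n] mS])
      (use su \<tau>0 in auto)
  have lim_s: "tends_in_prob P (\<lambda>n. S (Suc n) (\<tau> n)) (I j s)"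
    by (rule riemann_lim_tends_in_prob[OF R[of s] \<tau>(2) \<tau>(3) LIMSEQ_Suc[OF lim_const_over_n] mS])
      (use su \<tau>0 in auto)
  define Q where "Q n w = (\<Sum>i<Suc n. dW j (\<sigma> n i) (\<sigma> n (Suc i)) w *\<^sub>R (X j (Y (\<sigma> n i) w) - X j (Y s w)))" for n w
  have Q_eq: "S (2 * Suc n) (\<tau> n) w - S (Suc n) (\<tau> n) w - dW j s u w *\<^sub>R X j (Y s w) = Q n w" for n w
  proof -
    have "S (2 * Suc n) (\<tau> n) w - S (Suc n) (\<tau> n) w =
       (\<Sum>i<Suc n. (W j (\<tau> n (Suc (Suc n + i))) w - W j (\<tau> n (Suc n + i)) w) *\<^sub>R X j (Y (\<tau> n (Suc n + i)) w))"
      unfolding S_def mult_2 sum_lessThan_add by (simp only: add_diff_cancel_left')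
    also have "\<dots> = (\<Sum>i<Suc n. dW j (\<sigma> n i) (\<sigma> n (Suc i)) w *\<^sub>R X j (Y (\<sigma> n i) w))"
      using \<tau>(4)[of n] by (simp only: dW_def \<sigma>_def add_Suc_right[symmetric])
    finally have 1: "S (2 * Suc n) (\<tau> n) w - S (Suc n) (\<tau> n) w = \<dots>" .
    have "(\<Sum>i<Suc n. dW j (\<sigma> n i) (\<sigma> n (Suc i)) w) = W j (\<sigma> n (Suc n)) w - W j (\<sigma> n 0) w"
      unfolding dW_def by (rule sum_lessThan_telescope)
    also have "\<dots> = dW j s u w" by (simp add: dW_def \<sigma>_def)
    finally have 2: "dW j s u w = (\<Sum>i<Suc n. dW j (\<sigma> n i) (\<sigma> n (Suc i)) w)" by simp
    show ?thesis unfolding 1 2 Q_def by (simp only: scaleR_diff_right sum_subtractf scaleR_sum_left)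
  qed
  have "tends_in_prob P (\<lambda>n w. dW j s u w *\<^sub>R X j (Y s w)) (\<lambda>w. dW j s u w *\<^sub>R X j (Y s w))"
    by (rule tends_in_prob_AE) (use su j in auto)
  from tends_in_prob_diff[OF tends_in_prob_diff[OF lim_u lim_s] this]
  have lim: "tends_in_prob P Q (\<lambda>w. I j u w - I j s w - dW j s u w *\<^sub>R X j (Y s w))"
    unfolding Q_eq .
  have Q: "second_moment_le P (Q n) ((u - s) * \<epsilon>) \<and> expectation (Q n) = 0" for n
  proof -
    have fr: "fresh (F (\<sigma> n i)) (dW j (\<sigma> n i) (\<sigma> n (Suc i)))" if "i < Suc n" for i
      using \<sigma>[of i n] that su \<sigma>_less by (intro fresh_dW[OF j]) auto
    have ad: "dW j (\<sigma> n i) (\<sigma> n (Suc i)) \<in> borel_measurable (F (\<sigma> n k))" if "i < k" "k < Suc n" for i k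
      using \<sigma>[of i n] that su less_imp_le[OF \<sigma>_less] \<sigma>_mono[of "Suc i" k] by (intro dW_measurable_F[OF j]) auto
    have mZ: "(\<lambda>w. X j (Y (\<sigma> n i) w) - X j (Y s w)) \<in> borel_measurable (F (\<sigma> n i))" if "i < Suc n" for i
      using \<sigma>[of i n] that su
      by (intro borel_measurable_diff fY_measurable_F[OF X_cont[OF j]]) auto
    have bZ: "norm (X j (Y (\<sigma> n i) w) - X j (Y s w)) \<le> K + K" if "i < Suc n" "w \<in> space P" for i w
      using \<sigma>[of i n] that su by (intro order_trans[OF norm_triangle_ineq4] add_mono X_bound[OF j] Y_in_M) auto
    have v: "expectation (\<lambda>w. (dW j (\<sigma> n i) (\<sigma> n (Suc i)) w)\<^sup>2) \<le> (u - s) / Suc n" if "i < Suc n" for i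
      using dW_moments(3)[OF j _ \<sigma>_less, of n i] \<sigma>[of i n] \<sigma>_diff[of n i] that su by simp
    have z: "second_moment_le P (\<lambda>w. X j (Y (\<sigma> n i) w) - X j (Y s w)) \<epsilon>" if "i < Suc n" for i
      using \<sigma>[of i n] that by (intro \<epsilon>) auto
    note o = sum_fresh_orthogonal[of "Suc n" "\<lambda>i. F (\<sigma> n i)" "\<lambda>i. dW j (\<sigma> n i) (\<sigma> n (Suc i))"
        "\<lambda>i w. X j (Y (\<sigma> n i) w) - X j (Y s w)" "K + K" "\<lambda>_. (u - s) / Suc n" "\<lambda>_. \<epsilon>",
        OF fr ad sets_F_mono[OF \<sigma>_mono] subalgebra_F mZ bZ v z]
    have "(\<Sum>i<Suc n. (u - s) / real (Suc n) * \<epsilon>) = (u - s) * \<epsilon>" by (simp add: field_simps)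
    with o show ?thesis unfolding Q_def[abs_def] by simp
  qed
  show "second_moment_le P (\<lambda>w. I j u w - I j s w - dW j s u w *\<^sub>R X j (Y s w)) ((u - s) * \<epsilon>)"
    by (rule second_moment_le_limit[OF lim]) (use Q in blast)
  show "expectation (\<lambda>w. I j u w - I j s w - dW j s u w *\<^sub>R X j (Y s w)) = 0"
    by (rule tends_in_prob_mean_zero[OF lim]) (use Q in blast)+
qed

text \<open>The interval [0,0] admits the partition with no subinterval, whose sum is empty. Limits
  in probability determine the integral only almost surely, so its value at time 0 needs this
  argument.\<close>

lemma riemann_lim_0:
  assumes "riemann_lim_in_prob P 0 S J" and S: "\<And>\<tau> w. S 0 \<tau> w = (0::'a)"
  shows "AE w in P. J w = 0"
proof -
  have "tends_in_prob P (\<lambda>n. S 0 (\<lambda>_. 0)) J"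
    by (rule riemann_lim_tends_in_prob[OF assms(1), of "\<lambda>_. 0" "\<lambda>_ _. 0" "\<lambda>_. 0"])
      (auto simp: partition_upto_def S cong: measurable_cong)
  moreover have "tends_in_prob P (\<lambda>n. S 0 (\<lambda>_. 0)) (\<lambda>_. 0)"
    by (rule tends_in_prob_AE) (auto simp: S cong: measurable_cong)
  ultimately show ?thesis by (rule tends_in_prob_unique)
qed

lemma I_0: "j < m \<Longrightarrow> AE w in P. I j 0 w = 0"
  by (rule riemann_lim_0[OF I[unfolded ito_integral_def, rule_format]]) auto

lemma I_measurable: "j < m \<Longrightarrow> 0 \<le> t \<Longrightarrow> I j t \<in> borel_measurable P"
  using I unfolding ito_integral_def riemann_lim_in_prob_def by blast

lemma C_measurable: "j < m \<Longrightarrow> 0 \<le> t \<Longrightarrow> C j t \<in> borel_measurable P"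
  using C unfolding covariation_def riemann_lim_in_prob_def by blast

end

section \<open>The covariation as a drift\<close>

definition grid :: "real \<Rightarrow> nat \<Rightarrow> nat \<Rightarrow> real" where
  "grid t n i = t / Suc n * i"

lemma grid_diff: "grid t n (Suc i) - grid t n i = t / Suc n"
  by (simp add: grid_def add_divide_distrib distrib_left)

lemma grid_nonneg: "0 \<le> t \<Longrightarrow> 0 \<le> grid t n i"
  by (simp add: grid_def)

lemma grid_less: "0 < t \<Longrightarrow> grid t n i < grid t n (Suc i)"
proof -
  assume "0 < t"
  then have "0 < t / Suc n" by simp
  then show ?thesis unfolding grid_diff[of t n i, symmetric] by simp
qed

lemma grid_mono: "0 \<le> t \<Longrightarrow> i \<le> k \<Longrightarrow> grid t n i \<le> grid t n k"
  unfolding grid_def by (intro mult_left_mono) auto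

lemma grid_last: "grid t n (Suc n) = t"
  by (simp add: grid_def)

lemma grid_mem: "0 \<le> t \<Longrightarrow> i \<le> Suc n \<Longrightarrow> grid t n i \<in> {0..t}"
  using grid_nonneg[of t n i] grid_mono[of t i "Suc n" n] by (simp add: grid_last)

lemma partition_grid: "0 \<le> t \<Longrightarrow> partition_upto t (Suc n) (grid t n)"
  unfolding partition_upto_def by (auto simp: grid_last intro: grid_mono) (simp add: grid_def)

lemma mesh_tendsto_0: "(\<lambda>n. t / real (Suc n)) \<longlonglongrightarrow> 0"
  by (rule LIMSEQ_Suc[OF lim_const_over_n])

text \<open>From |a| \<le> \<theta> + a^2/\<theta>: a cubic expression is traded for a small
  multiple of a second power and a large multiple of fourth powers, all of which have known Gaussian
  moments.\<close>

lemma abs_mult_sq_le: "\<theta> > 0 \<Longrightarrow> \<bar>a\<bar> * b\<^sup>2 \<le> \<theta> * b\<^sup>2 + (a^4 + b^4) / \<theta>" for a b \<theta> :: real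
proof -
  assume l: "\<theta> > 0"
  have "\<bar>a\<bar> \<le> \<theta> + a\<^sup>2 / \<theta>"
  proof (cases "\<bar>a\<bar> \<le> \<theta>")
    case False
    then have "\<theta> * \<bar>a\<bar> \<le> \<bar>a\<bar> * \<bar>a\<bar>" by (intro mult_right_mono) auto
    then have "\<bar>a\<bar> \<le> a\<^sup>2 / \<theta>" using l by (simp add: pos_le_divide_eq power2_eq_square mult.commute)
    then show ?thesis using l by simp
  qed (use l in \<open>simp add: add_increasing2\<close>)
  then have "\<bar>a\<bar> * b\<^sup>2 \<le> (\<theta> + a\<^sup>2 / \<theta>) * b\<^sup>2" by (intro mult_right_mono) auto
  also have "\<dots> = \<theta> * b\<^sup>2 + (a\<^sup>2 * b\<^sup>2) / \<theta>" by (simp add: distrib_right)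
  also have "a\<^sup>2 * b\<^sup>2 \<le> a^4 + b^4"
  proof -
    have "0 \<le> (a\<^sup>2 - b\<^sup>2)\<^sup>2" "0 \<le> a\<^sup>2 * b\<^sup>2" by auto
    moreover have "(a\<^sup>2 - b\<^sup>2)\<^sup>2 = a^4 + b^4 - 2 * (a\<^sup>2 * b\<^sup>2)" by (simp add: power2_eq_square power4_eq_xxxx algebra_simps)
    ultimately show ?thesis by linarith
  qed
  finally show ?thesis using l by (simp add: divide_right_mono)
qed

lemma abs_mult_le: "\<theta> > 0 \<Longrightarrow> \<bar>a\<bar> * b \<le> \<theta> * a\<^sup>2 + b\<^sup>2 / \<theta>" for a b \<theta> :: real
proof -
  assume l: "\<theta> > 0"
  have "0 \<le> (\<theta> * \<bar>a\<bar> - b)\<^sup>2 / \<theta>" using l by simp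
  also have "\<dots> = \<theta> * a\<^sup>2 + b\<^sup>2 / \<theta> - 2 * (\<bar>a\<bar> * b)" using l by (simp add: field_simps power2_eq_square)
  finally have "2 * (\<bar>a\<bar> * b) \<le> \<theta> * a\<^sup>2 + b\<^sup>2 / \<theta>" by simp
  moreover have "0 \<le> \<theta> * a\<^sup>2 + b\<^sup>2 / \<theta>" using l by simp
  ultimately show ?thesis by linarith
qed

context stratonovich_diffusion
begin

text \<open>The part \<open>d2\<close> enters to the first power, whatever its size: for |d2| \<le>
  1 its square is dominated by it, and for |d2| > 1 the squared increment is at most 4K^2, hence at
  most 4K^2 |d2|. One more |d2| comes from \<open>D j y d2\<close>, which gives the factor 3 +
  4K^2.\<close>

lemma X_increment_bound:
  assumes j: "j < m" and y: "y \<in> M" "y' \<in> M" and d: "y' - y = d1 + d2"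
  shows "norm (X j y' - X j y - D j y d1) \<le> K * (3 + 4 * K\<^sup>2) * ((norm d1)\<^sup>2 + norm d2)"
proof -
  interpret D: linear "D j y" by (rule D_linear[OF j y(1)])
  let ?a = "norm d1" and ?b = "norm d2" and ?d = "norm (y' - y)"
  have d2K: "?d \<le> 2 * K" using norm_triangle_ineq4[of y' y] M_bound[OF y(1)] M_bound[OF y(2)] by linarith
  have "?d\<^sup>2 \<le> 2 * ?a\<^sup>2 + (2 + 4 * K\<^sup>2) * ?b"
  proof (cases "?b \<le> 1")
    case True
    have "?d\<^sup>2 \<le> (?a + ?b)\<^sup>2" unfolding d by (intro power_mono norm_triangle_ineq) auto
    also have "\<dots> \<le> 2 * ?a\<^sup>2 + 2 * ?b\<^sup>2" using sum_squares_bound[of ?a ?b] by (simp add: power2_sum)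
    also have "?b\<^sup>2 \<le> ?b" using True by (simp add: power2_eq_square mult_left_le_one_le)
    finally have "?d\<^sup>2 \<le> 2 * ?a\<^sup>2 + 2 * ?b" by simp
    moreover have "0 \<le> 4 * K\<^sup>2 * ?b" by simp
    ultimately show ?thesis unfolding distrib_right by linarith
  next
    case False
    have "?d\<^sup>2 \<le> (2 * K)\<^sup>2" using d2K by (intro power_mono) auto
    also have "\<dots> = 4 * K\<^sup>2 * 1" by (simp add: power_mult_distrib)
    also have "\<dots> \<le> 4 * K\<^sup>2 * ?b" using False by (intro mult_left_mono) auto
    finally have "?d\<^sup>2 \<le> 4 * K\<^sup>2 * ?b" .
    moreover have "0 \<le> 2 * ?a\<^sup>2" "0 \<le> 2 * ?b" by auto
    ultimately show ?thesis unfolding distrib_right by linarith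
  qed
  then have 1: "K * ?d\<^sup>2 \<le> K * (2 * ?a\<^sup>2 + (2 + 4 * K\<^sup>2) * ?b)" using K by (intro mult_left_mono)
  have "X j y' - X j y - D j y d1 = (X j y' - X j y - D j y (y' - y)) + D j y d2"
    unfolding d by (simp add: D.add)
  then have "norm (X j y' - X j y - D j y d1) \<le> norm (X j y' - X j y - D j y (y' - y)) + norm (D j y d2)"
    by (metis norm_triangle_ineq)
  also have "\<dots> \<le> K * ?d\<^sup>2 + K * ?b" by (intro add_mono X_Taylor[OF j y] D_bound[OF j y(1)])
  also have "\<dots> \<le> K * (2 * ?a\<^sup>2 + (2 + 4 * K\<^sup>2) * ?b) + K * ?b" using 1 by simp
  also have "\<dots> \<le> K * (3 + 4 * K\<^sup>2) * (?a\<^sup>2 + ?b)"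
  proof -
    have "K * (3 + 4 * K\<^sup>2) * (?a\<^sup>2 + ?b) - (K * (2 * ?a\<^sup>2 + (2 + 4 * K\<^sup>2) * ?b) + K * ?b) = K * ((1 + 4 * K\<^sup>2) * ?a\<^sup>2)"
      by (simp add: algebra_simps)
    moreover have "0 \<le> K * ((1 + 4 * K\<^sup>2) * ?a\<^sup>2)" using K by simp
    ultimately show ?thesis by linarith
  qed
  finally show ?thesis .
qed

text \<open>A statement about a single path: the grid variations of the covariations stay bounded,
  while the increments of \<open>W j\<close> over a fine grid are uniformly small.\<close>

lemma covariation_remainder_tendsto_0:
  assumes j: "j < m" and t: "0 \<le> t" and w: "w \<in> space P"
  shows "(\<lambda>n. \<Sum>i<Suc n. \<bar>dW j (grid t n i) (grid t n (Suc i)) w\<bar> *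
     norm (\<Sum>l<m. (1/2) *\<^sub>R (C l (grid t n (Suc i)) w - C l (grid t n i) w))) \<longlonglongrightarrow> 0"
    (is "(\<lambda>n. \<Sum>i<Suc n. ?a n i * norm (?\<rho> n i)) \<longlonglongrightarrow> 0")
proof -
  have "\<exists>B. \<forall>n. (\<Sum>i<Suc n. norm (C l (grid t n (Suc i)) w - C l (grid t n i) w)) \<le> B" if "l < m" for l
    using C[OF that] t w partition_grid[OF t] unfolding covariation_def by meson
  then obtain B where B: "\<And>l n. l < m \<Longrightarrow> (\<Sum>i<Suc n. norm (C l (grid t n (Suc i)) w - C l (grid t n i) w)) \<le> B l"
    by metis
  \<comment> \<open>The added 1 makes \<open>b\<close> positive, so that \<open>e / (2 * b)\<close>
    is an admissible tolerance for the path of \<open>W j\<close>.\<close>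
  define b where "b = \<bar>\<Sum>l<m. B l\<bar> + 1"
  have b: "b > 0" "(\<Sum>l<m. B l) \<le> b" by (auto simp: b_def)
  have \<rho>: "(\<Sum>i<Suc n. norm (?\<rho> n i)) \<le> b" for n
  proof -
    have "(\<Sum>i<Suc n. norm (?\<rho> n i)) \<le> (\<Sum>i<Suc n. \<Sum>l<m. norm (C l (grid t n (Suc i)) w - C l (grid t n i) w))"
      by (intro sum_mono order_trans[OF norm_sum]) simp
    also have "\<dots> = (\<Sum>l<m. \<Sum>i<Suc n. norm (C l (grid t n (Suc i)) w - C l (grid t n i) w))"
      by (rule sum.swap)
    also have "\<dots> \<le> (\<Sum>l<m. B l)" by (intro sum_mono B) auto
    finally show ?thesis using b(2) by linarith
  qed
  have "uniformly_continuous_on {0..t} (\<lambda>s. W j s w)"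
    by (intro compact_uniformly_continuous continuous_on_subset[OF W_continuous[OF j w]]) auto
  note uc = this[unfolded uniformly_continuous_on_def, rule_format]
  show ?thesis
  proof (rule LIMSEQ_I)
    fix e :: real assume e: "0 < e"
    then have "e / (2 * b) > 0" using b by simp
    from uc[OF this] obtain \<delta> where \<delta>: "\<delta> > 0"
      "\<And>s r. s \<in> {0..t} \<Longrightarrow> r \<in> {0..t} \<Longrightarrow> dist r s < \<delta> \<Longrightarrow> dist (W j r w) (W j s w) < e / (2 * b)" by metis
    obtain n0 where n0: "\<And>n. n \<ge> n0 \<Longrightarrow> t / real (Suc n) < \<delta>"
      using order_tendstoD(2)[OF mesh_tendsto_0 \<delta>(1), of t] unfolding eventually_sequentially by blast
    show "\<exists>n0. \<forall>n\<ge>n0. norm ((\<Sum>i<Suc n. ?a n i * norm (?\<rho> n i)) - 0) < e"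
    proof (intro exI allI impI)
      fix n assume n: "n \<ge> n0"
      have a: "?a n i \<le> e / (2 * b)" if "i < Suc n" for i
      proof -
        have "dist (grid t n (Suc i)) (grid t n i) < \<delta>"
          unfolding dist_real_def grid_diff using n0[OF n] t by simp
        from \<delta>(2)[OF _ _ this] that t grid_mem[of t i n] grid_mem[of t "Suc i" n] show ?thesis
          by (simp add: dW_def dist_real_def)
      qed
      have "(\<Sum>i<Suc n. ?a n i * norm (?\<rho> n i)) \<le> (\<Sum>i<Suc n. e / (2 * b) * norm (?\<rho> n i))"
        by (intro sum_mono mult_right_mono a) auto
      also have "\<dots> = e / (2 * b) * (\<Sum>i<Suc n. norm (?\<rho> n i))" by (simp only: sum_distrib_left)
      also have "\<dots> \<le> e / (2 * b) * b" using e b by (intro mult_left_mono \<rho>) auto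
      also have "\<dots> < e" using e b by simp
      finally have "(\<Sum>i<Suc n. ?a n i * norm (?\<rho> n i)) < e" .
      moreover have "0 \<le> (\<Sum>i<Suc n. ?a n i * norm (?\<rho> n i))" by (intro sum_nonneg) simp
      ultimately show "norm ((\<Sum>i<Suc n. ?a n i * norm (?\<rho> n i)) - 0) < e" by simp
    qed
  qed
qed

text \<open>The increments of \<open>X j (Y t)\<close> contain those of \<open>C\<close> itself; these drop out because \<open>C\<close> has bounded
  variation along each path while the increments of \<open>W j\<close> tend uniformly to 0.  The quadratic terms
  \<open>dW j * dW l\<close> average to \<open>h\<close> or 0.  The weight \<open>\<theta> n\<close> in the inequality \<open>a b \<le> \<theta> a\<^sup>2 + b\<^sup>2 / \<theta>\<close> is chosen
  so that both terms vanish in the limit.\<close>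

lemma covariation_drift:
  assumes j: "j < m" and t: "0 < t"
  shows "tends_in_prob P (\<lambda>n w. (t / Suc n) *\<^sub>R (\<Sum>i<Suc n. D j (Y (grid t n i) w) (X j (Y (grid t n i) w)))) (C j t)"
proof -
  define h where "h n = t / real (Suc n)" for n
  have h: "h n > 0" for n using t by (simp add: h_def)
  have Nh: "real (Suc n) * h n = t" for n by (simp add: h_def)
  have t0: "0 \<le> t" using t by simp
  note g0 = grid_nonneg[OF t0] and gl = grid_less[OF t] and gm = grid_mem[OF t0]
  define modulus where "modulus l \<epsilon> \<longleftrightarrow> \<epsilon> \<longlonglongrightarrow> 0 \<and> (\<forall>n s r. s \<in> {0..t} \<longrightarrow> r \<in> {0..t} \<longrightarrow> \<bar>s - r\<bar> \<le> h n \<longrightarrow>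
       second_moment_le P (\<lambda>w. X l (Y s w) - X l (Y r w)) (\<epsilon> n))" for l and \<epsilon> :: "nat \<Rightarrow> real"
  have "\<exists>\<epsilon>. modulus l \<epsilon>" if "l < m" for l
    by (rule time_modulus[OF X_cont[OF that] t0]) (auto simp: modulus_def h_def)
  then have "\<forall>l. \<exists>\<epsilon>. l < m \<longrightarrow> modulus l \<epsilon>" by blast
  from choice[OF this] obtain \<epsilon> where mod: "\<And>l. l < m \<Longrightarrow> modulus l (\<epsilon> l)" by blast
  have \<epsilon>: "\<epsilon> l \<longlonglongrightarrow> 0" if "l < m" for l using mod[OF that] by (simp add: modulus_def)
  have \<epsilon>2: "second_moment_le P (\<lambda>w. X l (Y s w) - X l (Y r w)) (\<epsilon> l n)"
    if "l < m" "s \<in> {0..t}" "r \<in> {0..t}" "\<bar>s - r\<bar> \<le> h n" for l n s r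
    using mod[OF that(1)] that(2-4) unfolding modulus_def by blast
  have \<epsilon>0: "0 \<le> \<epsilon> l n" if "l < m" for l n
    using \<epsilon>2[OF that, of 0 0 n] t0 h[of n] by (auto simp: second_moment_le_def)
  define \<epsilon>s where "\<epsilon>s n = (\<Sum>l<m. \<epsilon> l n)" for n
  have \<epsilon>s: "\<epsilon>s \<longlonglongrightarrow> 0" "0 \<le> \<epsilon>s n" for n
  proof -
    have "\<epsilon>s \<longlonglongrightarrow> (\<Sum>l<m. 0)" unfolding \<epsilon>s_def[abs_def] by (intro tendsto_sum \<epsilon>) auto
    then show "\<epsilon>s \<longlonglongrightarrow> 0" by simp
  qed (auto simp: \<epsilon>s_def intro!: sum_nonneg \<epsilon>0)
  \<comment> \<open>With this choice both \<open>h n / \<theta> n\<close> and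
    \<open>\<epsilon>s n / \<theta> n\<close> are at most \<open>\<theta> n\<close>, which itself
    tends to 0.\<close>
  define \<theta> where "\<theta> n = sqrt (h n + \<epsilon>s n)" for n
  have \<theta>: "\<theta> n > 0" "\<theta> n * \<theta> n = h n + \<epsilon>s n" for n
    using h[of n] \<epsilon>s(2)[of n] by (auto simp: \<theta>_def add_pos_nonneg)
  have \<theta>_lim: "\<theta> \<longlonglongrightarrow> 0"
  proof -
    have "(\<lambda>n. h n + \<epsilon>s n) \<longlonglongrightarrow> 0 + 0" unfolding h_def by (intro tendsto_add \<epsilon>s mesh_tendsto_0)
    from tendsto_real_sqrt[OF this] show ?thesis by (simp add: \<theta>_def[abs_def])
  qed
  have h\<theta>: "h n / \<theta> n \<le> \<theta> n" "\<epsilon>s n / \<theta> n \<le> \<theta> n" for n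
    using \<theta>[of n] h[of n] \<epsilon>s(2)[of n] by (simp_all add: pos_divide_le_eq)
  define g where "g l y = D j y (X l y)" for l y
  have g_cont: "continuous_on M (g l)" if "l < m" for l using DX_cont[OF j that] by (simp add: g_def[abs_def])
  have g_bound: "norm (g l y) \<le> K * K" if "l < m" "y \<in> M" for l y
  proof -
    have "norm (g l y) \<le> K * norm (X l y)" unfolding g_def by (rule D_bound[OF j that(2)])
    also have "\<dots> \<le> K * K" using X_bound[OF that] K by (intro mult_left_mono)
    finally show ?thesis .
  qed
  define a where "a l n i w = dW l (grid t n i) (grid t n (Suc i)) w" for l n i w
  define y where "y n i w = Y (grid t n i) w" for n i w
  have yM: "y n i w \<in> M" if "w \<in> space P" for n i w using Y_in_M[OF g0 that] by (simp add: y_def)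
  define d1 where "d1 n i w = (\<Sum>l<m. a l n i w *\<^sub>R X l (y n i w))" for n i w
  \<comment> \<open>The increment of \<open>Y\<close> is \<open>d1 + (e + \<rho>)\<close>. The Ito
    error \<open>e\<close> is small in mean square, whereas for \<rho>, built from the unknown
    covariations, only pathwise information is available at this stage.\<close>
  define e where "e n i w = (\<Sum>l<m. I l (grid t n (Suc i)) w - I l (grid t n i) w - a l n i w *\<^sub>R X l (y n i w))" for n i w
  define \<rho> where "\<rho> n i w = (\<Sum>l<m. (1/2) *\<^sub>R (C l (grid t n (Suc i)) w - C l (grid t n i) w))" for n i w
  have m_a[measurable]: "a l n i \<in> borel_measurable P" if "l < m" for l n i
    unfolding a_def[abs_def] by (rule dW_measurable[OF that g0 less_imp_le[OF gl]])
  have m_X[measurable]: "(\<lambda>w. X l (y n i w)) \<in> borel_measurable P" if "l < m" for l n i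
    unfolding y_def by (rule fY_measurable[OF X_cont[OF that] g0])
  have m_g[measurable]: "(\<lambda>w. g l (y n i w)) \<in> borel_measurable P" if "l < m" for l n i
    unfolding y_def by (rule fY_measurable[OF g_cont[OF that] g0])
  have m_\<rho>[measurable]: "\<rho> n i \<in> borel_measurable P" for n i
    unfolding \<rho>_def[abs_def] using C_measurable[OF _ g0] by measurable
  have a_mom: "integrable P (\<lambda>w. (a l n i w)^k)" "expectation (\<lambda>w. (a l n i w)\<^sup>2) = h n"
    "expectation (\<lambda>w. (a l n i w)^4) = 3 * (h n)\<^sup>2" if "l < m" for l n i k
    using dW_moments[OF that g0 gl, of n i] unfolding a_def grid_diff h_def by auto
  have e_mom: "second_moment_le P (e n i) (m * h n * \<epsilon>s n)" if i: "i < Suc n" for n i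
  proof -
    have "second_moment_le P (\<lambda>w. I l (grid t n (Suc i)) w - I l (grid t n i) w - a l n i w *\<^sub>R X l (y n i w)) (h n * \<epsilon> l n)"
      if l: "l < m" for l
    proof -
      have "second_moment_le P (\<lambda>w. X l (Y r w) - X l (Y (grid t n i) w)) (\<epsilon> l n)"
        if "r \<in> {grid t n i..grid t n (Suc i)}" for r
        using gm[of i n] gm[of "Suc i" n] i that grid_diff[of t n i] by (intro \<epsilon>2[OF l]) (auto simp: h_def)
      from Ito_increment(1)[OF l g0 gl this] show ?thesis unfolding a_def y_def grid_diff h_def by simp
    qed
    then have "second_moment_le P (e n i) (real (card {..<m}) * (\<Sum>l<m. h n * \<epsilon> l n))"
      unfolding e_def[abs_def] by (intro second_moment_le_sum) auto
    then show ?thesis by (simp add: \<epsilon>s_def sum_distrib_left mult.assoc)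
  qed
  \<comment> \<open>\<open>T\<close> is the sum that defines the covariation, \<open>G\<close> the
    Riemann sum of the claimed drift, and \<open>A\<close> the compensated products of Brownian
    increments. It will be shown that \<open>A\<close> and \<open>T - G - A\<close> both tend to
    0.\<close>
  define T where "T n w = (\<Sum>i<Suc n. a j n i w *\<^sub>R (X j (y n (Suc i) w) - X j (y n i w)))" for n w
  define G where "G n w = h n *\<^sub>R (\<Sum>i<Suc n. g j (y n i w))" for n w
  define A where "A n w = (\<Sum>l<m. \<Sum>i<Suc n. (a j n i w * a l n i w - (if j = l then h n else 0)) *\<^sub>R g l (y n i w))" for n w
  have m_TGA[measurable]: "T n \<in> borel_measurable P" "G n \<in> borel_measurable P" "A n \<in> borel_measurable P" for n
    unfolding T_def[abs_def] G_def[abs_def] A_def[abs_def] using j by measurable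
  have "tends_in_prob P (\<lambda>n. (\<lambda>n \<tau> w. \<Sum>i<n. (W j (\<tau> (Suc i)) w - W j (\<tau> i) w) *\<^sub>R (X j (Y (\<tau> (Suc i)) w) - X j (Y (\<tau> i) w)))
       (Suc n) (grid t n)) (C j t)"
  proof (rule riemann_lim_tends_in_prob[OF _ partition_grid[OF t0] _ mesh_tendsto_0[of t]])
    show "riemann_lim_in_prob P t (\<lambda>n \<tau> w. \<Sum>i<n. (W j (\<tau> (Suc i)) w - W j (\<tau> i) w) *\<^sub>R (X j (Y (\<tau> (Suc i)) w) - X j (Y (\<tau> i) w))) (C j t)"
      using C[OF j] t0 unfolding covariation_def by blast
    show "(\<lambda>w. \<Sum>i<Suc n. (W j (grid t n (Suc i)) w - W j (grid t n i) w) *\<^sub>R (X j (Y (grid t n (Suc i)) w) - X j (Y (grid t n i) w)))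
        \<in> borel_measurable P" for n
      using m_TGA(1)[of n] unfolding T_def[abs_def] a_def dW_def y_def .
  qed (simp add: grid_diff)
  then have T_lim: "tends_in_prob P T (C j t)"
    unfolding T_def[abs_def] a_def dW_def y_def .
  have A_mom: "second_moment_le P (A n) (m * (m * (3 * t * h n * (K * K)\<^sup>2)))" for n
  proof -
    have "second_moment_le P (\<lambda>w. \<Sum>i<Suc n. (a j n i w * a l n i w - (if j = l then h n else 0)) *\<^sub>R g l (y n i w))
        (\<Sum>i<Suc n. 3 * (h n)\<^sup>2 * (K * K)\<^sup>2)" if l: "l < m" for l
    proof (rule sum_fresh_orthogonal(1)[of "Suc n" "\<lambda>i. F (grid t n i)"])
      fix i assume i: "i < Suc n"
      show "fresh (F (grid t n i)) (\<lambda>w. a j n i w * a l n i w - (if j = l then h n else 0))"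
        "expectation (\<lambda>w. (a j n i w * a l n i w - (if j = l then h n else 0))\<^sup>2) \<le> 3 * (h n)\<^sup>2"
        using fresh_dW_mult[OF j l g0 gl, of n i] unfolding a_def grid_diff h_def by auto
      show "(\<lambda>w. g l (y n i w)) \<in> borel_measurable (F (grid t n i))"
        unfolding y_def by (rule fY_measurable_F[OF g_cont[OF l] g0 order_refl])
      show "norm (g l (y n i w)) \<le> K * K" if "w \<in> space P" for w by (rule g_bound[OF l yM[OF that]])
      then show "second_moment_le P (\<lambda>w. g l (y n i w)) ((K * K)\<^sup>2)"
        using l K by (intro second_moment_le_bounded AE_I2) auto
    next
      fix i k assume ik: "i < k" "k < Suc n"
      have "a q n i \<in> borel_measurable (F (grid t n k))" if "q < m" for q
        unfolding a_def[abs_def] using ik by (intro dW_measurable_F[OF that g0 less_imp_le[OF gl]] grid_mono[OF t0]) auto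
      from this[OF j] this[OF l]
      show "(\<lambda>w. a j n i w * a l n i w - (if j = l then h n else 0)) \<in> borel_measurable (F (grid t n k))" by measurable
    next
      show "sets (F (grid t n i)) \<subseteq> sets (F (grid t n k))" if "i \<le> k" for i k
        by (rule sets_F_mono[OF grid_mono[OF t0 that]])
      show "subalgebra P (F (grid t n i))" for i by (rule subalgebra_F)
    qed
    then have "second_moment_le P (A n) (real (card {..<m}) * (\<Sum>l<m. \<Sum>i<Suc n. 3 * (h n)\<^sup>2 * (K * K)\<^sup>2))"
      unfolding A_def[abs_def] by (intro second_moment_le_sum) auto
    also have "real (card {..<m}) * (\<Sum>l<m. \<Sum>i<Suc n. 3 * (h n)\<^sup>2 * (K * K)\<^sup>2)
        = m * (m * (3 * (real (Suc n) * h n) * h n * (K * K)\<^sup>2))"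
      by (simp add: power2_eq_square algebra_simps)
    finally show ?thesis unfolding Nh .
  qed
  have A_lim: "tends_in_prob P A (\<lambda>_. 0)"
  proof (rule tends_in_prob_L2)
    show "second_moment_le P (\<lambda>w. A n w - 0) (m * (m * (3 * t * h n * (K * K)\<^sup>2)))" for n using A_mom[of n] by simp
    have "(\<lambda>n. m * (m * (3 * t * h n * (K * K)\<^sup>2))) \<longlonglongrightarrow> m * (m * (3 * t * 0 * (K * K)\<^sup>2))"
      unfolding h_def by (intro tendsto_intros mesh_tendsto_0)
    then show "(\<lambda>n. m * (m * (3 * t * h n * (K * K)\<^sup>2))) \<longlonglongrightarrow> 0" by simp
  qed auto
  define L where "L = K * (3 + 4 * K\<^sup>2)"
  have L: "L \<ge> 0" using K by (simp add: L_def)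
  \<comment> \<open>\<open>Q\<close> collects the errors controlled in mean; \<open>R\<close>,
    defined next, collects those that vanish along each path.\<close>
  define Q where "Q n w = (\<Sum>i<Suc n. real m * K\<^sup>2 * (\<Sum>l<m. \<theta> n * (a l n i w)\<^sup>2 + ((a j n i w)^4 + (a l n i w)^4) / \<theta> n)
      + (\<theta> n * (a j n i w)\<^sup>2 + (norm (e n i w))\<^sup>2 / \<theta> n))" for n w
  define R where "R n w = (\<Sum>i<Suc n. \<bar>a j n i w\<bar> * norm (\<rho> n i w))" for n w
  have m_R[measurable]: "R n \<in> borel_measurable P" for n unfolding R_def[abs_def] using j by measurable
  have Q_int: "integrable P (Q n)" and Q_exp: "expectation (Q n) \<le> t * \<theta> n * (7 * (real m)\<^sup>2 * K\<^sup>2 + 1 + m)" for n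
  proof -
    have i1: "integrable P (\<lambda>w. \<Sum>l<m. \<theta> n * (a l n i w)\<^sup>2 + ((a j n i w)^4 + (a l n i w)^4) / \<theta> n)" for i
      by (intro Bochner_Integration.integrable_sum Bochner_Integration.integrable_add integrable_mult_right
          integrable_divide a_mom(1)) (use j in auto)
    have i2: "integrable P (\<lambda>w. \<theta> n * (a j n i w)\<^sup>2 + (norm (e n i w))\<^sup>2 / \<theta> n)" if "i < Suc n" for i
      by (intro Bochner_Integration.integrable_add integrable_mult_right integrable_divide a_mom(1)[OF j]
          second_moment_le_integrable_sq[OF e_mom[OF that]])
    show "integrable P (Q n)"
      unfolding Q_def[abs_def]
      by (intro Bochner_Integration.integrable_sum Bochner_Integration.integrable_add integrable_mult_right i1 i2) auto
    have E1: "expectation (\<lambda>w. \<Sum>l<m. \<theta> n * (a l n i w)\<^sup>2 + ((a j n i w)^4 + (a l n i w)^4) / \<theta> n)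
        = m * (\<theta> n * h n + 6 * (h n)\<^sup>2 / \<theta> n)" for i
    proof -
      have "expectation (\<lambda>w. \<theta> n * (a l n i w)\<^sup>2 + ((a j n i w)^4 + (a l n i w)^4) / \<theta> n)
          = \<theta> n * h n + 6 * (h n)\<^sup>2 / \<theta> n" if "l < m" for l
        using a_mom[OF that] a_mom[OF j] by simp
      moreover have "integrable P (\<lambda>w. \<theta> n * (a l n i w)\<^sup>2 + ((a j n i w)^4 + (a l n i w)^4) / \<theta> n)" if "l < m" for l
        by (intro Bochner_Integration.integrable_add integrable_mult_right integrable_divide a_mom(1)) (use j that in auto)
      ultimately show ?thesis by (subst Bochner_Integration.integral_sum) auto
    qed
    have E2: "expectation (\<lambda>w. \<theta> n * (a j n i w)\<^sup>2 + (norm (e n i w))\<^sup>2 / \<theta> n) \<le> \<theta> n * h n + m * h n * \<epsilon>s n / \<theta> n"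
      if "i < Suc n" for i
    proof -
      have "expectation (\<lambda>w. \<theta> n * (a j n i w)\<^sup>2 + (norm (e n i w))\<^sup>2 / \<theta> n)
          = \<theta> n * h n + expectation (\<lambda>w. (norm (e n i w))\<^sup>2) / \<theta> n"
        using a_mom[OF j] second_moment_le_integrable_sq[OF e_mom[OF that]] by simp
      moreover have "expectation (\<lambda>w. (norm (e n i w))\<^sup>2) / \<theta> n \<le> m * h n * \<epsilon>s n / \<theta> n"
        using \<theta>(1)[of n] by (intro divide_right_mono second_moment_le_integral e_mom that) auto
      ultimately show ?thesis by linarith
    qed
    have "expectation (Q n) = (\<Sum>i<Suc n. real m * K\<^sup>2 * (m * (\<theta> n * h n + 6 * (h n)\<^sup>2 / \<theta> n))
        + expectation (\<lambda>w. \<theta> n * (a j n i w)\<^sup>2 + (norm (e n i w))\<^sup>2 / \<theta> n))"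
      unfolding Q_def using i1 i2
      by (subst Bochner_Integration.integral_sum; (intro sum.cong refl)?)
         (auto simp: E1 simp del: sum.lessThan_Suc intro!: Bochner_Integration.integrable_add integrable_mult_right)
    also have "\<dots> \<le> (\<Sum>i<Suc n. real m * K\<^sup>2 * (m * (\<theta> n * h n + 6 * (h n)\<^sup>2 / \<theta> n)) + (\<theta> n * h n + m * h n * \<epsilon>s n / \<theta> n))"
      by (intro sum_mono add_left_mono E2) auto
    \<comment> \<open>The 6 comes from two Gaussian fourth moments 3h^2. The common factor is the
      length \<open>t\<close> of the interval, so the sum over all cells remains of order
      \<theta>.\<close>
    also have "\<dots> = (real (Suc n) * h n) * (real m * K\<^sup>2 * m * (\<theta> n + 6 * (h n / \<theta> n)) + (\<theta> n + m * (\<epsilon>s n / \<theta> n)))"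
      by (simp add: power2_eq_square algebra_simps)
    also have "\<dots> \<le> (real (Suc n) * h n) * (real m * K\<^sup>2 * m * (\<theta> n + 6 * \<theta> n) + (\<theta> n + m * \<theta> n))"
      using h[of n] by (intro mult_left_mono add_mono h\<theta> order_refl) auto
    also have "\<dots> = t * \<theta> n * (7 * (real m)\<^sup>2 * K\<^sup>2 + 1 + m)"
      unfolding Nh by (simp add: power2_eq_square algebra_simps)
    finally show "expectation (Q n) \<le> t * \<theta> n * (7 * (real m)\<^sup>2 * K\<^sup>2 + 1 + m)" .
  qed
  have Y_incr: "AE w in P. \<forall>n i. y n (Suc i) w - y n i w = d1 n i w + (e n i w + \<rho> n i w)"
  proof -
    have "AE w in P. \<forall>n i. y n i w = x + (\<Sum>l<m. I l (grid t n i) w + (1/2) *\<^sub>R C l (grid t n i) w)"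
      unfolding AE_all_countable y_def using Y_eq[OF g0] by blast
    then show ?thesis
    proof eventually_elim
      case (elim w)
      then show ?case
        by (simp add: d1_def e_def \<rho>_def sum.distrib sum_subtractf scaleR_diff_right scaleR_sum_right[symmetric])
    qed
  qed
  have bound: "AE w in P. norm (T n w - G n w - A n w) \<le> L * Q n w + L * R n w" for n
    using Y_incr AE_space
  proof eventually_elim
    case (elim w)
    \<comment> \<open>The diagonal compensators in \<open>A\<close> reproduce \<open>G\<close>, so
      \<open>A + G\<close> is the sum \<open>T\<close> with the increments of \<open>X j\<close>
      replaced by their linearisation in \<open>d1\<close>.\<close>
    have TGA: "T n w - G n w - A n w = (\<Sum>i<Suc n. a j n i w *\<^sub>R (X j (y n (Suc i) w) - X j (y n i w) - D j (y n i w) (d1 n i w)))"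
    proof -
      have Dd1: "D j (y n i w) (d1 n i w) = (\<Sum>l<m. a l n i w *\<^sub>R g l (y n i w))" for i
      proof -
        interpret Dl: linear "D j (y n i w)" by (rule D_linear[OF j yM[OF elim(2)]])
        show ?thesis by (simp add: d1_def g_def Dl.sum Dl.scale)
      qed
      have "A n w = (\<Sum>i<Suc n. \<Sum>l<m. (a j n i w * a l n i w - (if j = l then h n else 0)) *\<^sub>R g l (y n i w))"
        unfolding A_def by (rule sum.swap)
      also have "\<dots> = (\<Sum>i<Suc n. a j n i w *\<^sub>R D j (y n i w) (d1 n i w) - h n *\<^sub>R g j (y n i w))"
      proof (rule sum.cong[OF refl])
        fix i
        have "(\<Sum>l<m. (if j = l then h n else 0) *\<^sub>R g l (y n i w)) = (\<Sum>l<m. if j = l then h n *\<^sub>R g l (y n i w) else 0)"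
          by (intro sum.cong) auto
        also have "\<dots> = h n *\<^sub>R g j (y n i w)" using j by simp
        finally show "(\<Sum>l<m. (a j n i w * a l n i w - (if j = l then h n else 0)) *\<^sub>R g l (y n i w))
            = a j n i w *\<^sub>R D j (y n i w) (d1 n i w) - h n *\<^sub>R g j (y n i w)"
          by (simp add: Dd1 scaleR_diff_left sum_subtractf scaleR_sum_right)
      qed
      finally have "A n w = \<dots>" .
      then show ?thesis
        unfolding T_def G_def by (simp only: scaleR_sum_right scaleR_diff_right sum_subtractf diff_diff_eq)
          (simp add: algebra_simps sum.distrib)
    qed
    have summand: "norm (a j n i w *\<^sub>R (X j (y n (Suc i) w) - X j (y n i w) - D j (y n i w) (d1 n i w)))
      \<le> L * (real m * K\<^sup>2 * (\<Sum>l<m. \<theta> n * (a l n i w)\<^sup>2 + ((a j n i w)^4 + (a l n i w)^4) / \<theta> n)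
      + (\<theta> n * (a j n i w)\<^sup>2 + (norm (e n i w))\<^sup>2 / \<theta> n)) + L * (\<bar>a j n i w\<bar> * norm (\<rho> n i w))" for i
    proof -
      let ?a = "\<bar>a j n i w\<bar>"
      have "norm (X j (y n (Suc i) w) - X j (y n i w) - D j (y n i w) (d1 n i w))
          \<le> L * ((norm (d1 n i w))\<^sup>2 + norm (e n i w + \<rho> n i w))"
        unfolding L_def by (rule X_increment_bound[OF j yM[OF elim(2)] yM[OF elim(2)]]) (use elim(1) in blast)
      also have "\<dots> \<le> L * ((norm (d1 n i w))\<^sup>2 + (norm (e n i w) + norm (\<rho> n i w)))"
        by (intro mult_left_mono add_left_mono norm_triangle_ineq L)
      finally have "?a * norm (X j (y n (Suc i) w) - X j (y n i w) - D j (y n i w) (d1 n i w))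
          \<le> ?a * (L * ((norm (d1 n i w))\<^sup>2 + (norm (e n i w) + norm (\<rho> n i w))))"
        by (intro mult_left_mono) auto
      also have "\<dots> = L * (?a * (norm (d1 n i w))\<^sup>2 + ?a * norm (e n i w)) + L * (?a * norm (\<rho> n i w))"
        by (simp add: algebra_simps)
      also have "\<dots> \<le> L * (real m * K\<^sup>2 * (\<Sum>l<m. \<theta> n * (a l n i w)\<^sup>2 + ((a j n i w)^4 + (a l n i w)^4) / \<theta> n)
          + (\<theta> n * (a j n i w)\<^sup>2 + (norm (e n i w))\<^sup>2 / \<theta> n)) + L * (?a * norm (\<rho> n i w))"
      proof (intro add_right_mono mult_left_mono add_mono L abs_mult_le[OF \<theta>(1)])
        have "(norm (d1 n i w))\<^sup>2 \<le> real m * (\<Sum>l<m. (norm (a l n i w *\<^sub>R X l (y n i w)))\<^sup>2)"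
          unfolding d1_def using norm_sum_sq_le[of "\<lambda>l. a l n i w *\<^sub>R X l (y n i w)" "{..<m}"]
          by (simp only: card_lessThan)
        also have "\<dots> \<le> real m * (\<Sum>l<m. (a l n i w)\<^sup>2 * K\<^sup>2)"
          using X_bound[OF _ yM[OF elim(2)]]
          by (intro mult_left_mono sum_mono) (auto simp: power_mult_distrib intro!: mult_left_mono power_mono)
        finally have "?a * (norm (d1 n i w))\<^sup>2 \<le> ?a * (real m * (\<Sum>l<m. (a l n i w)\<^sup>2 * K\<^sup>2))"
          by (intro mult_left_mono) auto
        also have "\<dots> = real m * K\<^sup>2 * (\<Sum>l<m. ?a * (a l n i w)\<^sup>2)"
          by (simp add: sum_distrib_left mult_ac)
        also have "\<dots> \<le> real m * K\<^sup>2 * (\<Sum>l<m. \<theta> n * (a l n i w)\<^sup>2 + ((a j n i w)^4 + (a l n i w)^4) / \<theta> n)"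
          by (intro mult_left_mono sum_mono abs_mult_sq_le[OF \<theta>(1)]) auto
        finally show "?a * (norm (d1 n i w))\<^sup>2 \<le> \<dots>" .
      qed
      finally show ?thesis by simp
    qed
    have "norm (T n w - G n w - A n w) \<le> (\<Sum>i<Suc n. norm (a j n i w *\<^sub>R (X j (y n (Suc i) w) - X j (y n i w) - D j (y n i w) (d1 n i w))))"
      unfolding TGA by (rule norm_sum)
    also have "\<dots> \<le> L * Q n w + L * R n w"
      unfolding Q_def R_def sum_distrib_left sum.distrib[symmetric] by (rule sum_mono) (use summand in \<open>simp only: sum_distrib_left\<close>)
    finally show ?case .
  qed
  have R_lim: "tends_in_prob P (\<lambda>n w. L * R n w) (\<lambda>_. 0)"
  proof (rule tends_in_prob_AE)
    show "AE w in P. (\<lambda>n. L * R n w) \<longlonglongrightarrow> 0"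
    proof (rule AE_I2)
      fix w assume "w \<in> space P"
      from covariation_remainder_tendsto_0[OF j t0 this]
      have "(\<lambda>n. R n w) \<longlonglongrightarrow> 0" unfolding R_def a_def \<rho>_def .
      then show "(\<lambda>n. L * R n w) \<longlonglongrightarrow> 0" by (rule tendsto_mult_right_zero)
    qed
  qed auto
  have "tends_in_prob P (\<lambda>n w. T n w - G n w - A n w) (\<lambda>_. 0)"
  proof (rule tends_in_prob_le)
    fix n
    have Q0: "0 \<le> Q n w" for w
      unfolding Q_def using \<theta>(1)[of n] by (intro sum_nonneg add_nonneg_nonneg mult_nonneg_nonneg divide_nonneg_nonneg) auto
    \<comment> \<open>Truncation is kept on the pathwise error \<open>R\<close> alone, for which no
      moment is known; the part \<open>Q\<close> is integrated in full.\<close>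
    have "(\<integral>w. min 1 (norm (T n w - G n w - A n w - 0)) \<partial>P) \<le> (\<integral>w. L * Q n w + min 1 (norm (L * R n w - 0)) \<partial>P)"
    proof (rule integral_mono_AE)
      show "AE w in P. min 1 (norm (T n w - G n w - A n w - 0)) \<le> L * Q n w + min 1 (norm (L * R n w - 0))"
        using bound[of n]
      proof eventually_elim
        case (elim w)
        have "0 \<le> L * Q n w" using L Q0 by simp
        moreover have "L * R n w \<le> norm (L * R n w)" by simp
        ultimately show ?case using elim by (simp add: min_def)
      qed
      show "integrable P (\<lambda>w. L * Q n w + min 1 (norm (L * R n w - 0)))"
        by (intro Bochner_Integration.integrable_add integrable_mult_right Q_int integrable_min_1_norm) measurable
    qed (intro integrable_min_1_norm, measurable)
    also have "\<dots> = L * expectation (Q n) + (\<integral>w. min 1 (norm (L * R n w - 0)) \<partial>P)"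
    proof -
      have "integrable P (\<lambda>w. min 1 (norm (L * R n w - 0)))" by (intro integrable_min_1_norm) measurable
      then show ?thesis using Q_int[of n] by simp
    qed
    also have "\<dots> \<le> L * (t * \<theta> n * (7 * (real m)\<^sup>2 * K\<^sup>2 + 1 + m)) + (\<integral>w. min 1 (norm (L * R n w - 0)) \<partial>P)"
      by (intro add_right_mono mult_left_mono Q_exp L)
    finally show "(\<integral>w. min 1 (norm (T n w - G n w - A n w - 0)) \<partial>P) \<le>
      L * (t * \<theta> n * (7 * (real m)\<^sup>2 * K\<^sup>2 + 1 + m)) + (\<integral>w. min 1 (norm (L * R n w - 0)) \<partial>P)" .
  next
    have "(\<lambda>n. L * (t * \<theta> n * (7 * (real m)\<^sup>2 * K\<^sup>2 + 1 + m)) + (\<integral>w. min 1 (norm (L * R n w - 0)) \<partial>P))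
        \<longlonglongrightarrow> L * (t * 0 * (7 * (real m)\<^sup>2 * K\<^sup>2 + 1 + m)) + 0"
      using R_lim unfolding tends_in_prob_def by (intro tendsto_intros \<theta>_lim) auto
    then show "(\<lambda>n. L * (t * \<theta> n * (7 * (real m)\<^sup>2 * K\<^sup>2 + 1 + m)) + (\<integral>w. min 1 (norm (L * R n w - 0)) \<partial>P)) \<longlonglongrightarrow> 0"
      by simp
  qed auto
  from tends_in_prob_diff[OF tends_in_prob_diff[OF T_lim this] A_lim]
  have "tends_in_prob P G (C j t)" by simp
  then show ?thesis unfolding G_def[abs_def] g_def h_def y_def .
qed

text \<open>Identification with the drift finally gives moments of the covariation. In the Riemann
  sum the squared step (t/(n+1))^2 meets (n+1)^2 from Cauchy-Schwarz, so the bound does not depend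
  on \<open>n\<close>.\<close>

lemma covariation_moment_diff:
  assumes j: "j < m" and t: "0 < t"
    and \<epsilon>: "\<And>r. r \<in> {0..t} \<Longrightarrow> second_moment_le P (\<lambda>w. D j (Y r w) (X j (Y r w)) - c) \<epsilon>"
  shows "second_moment_le P (\<lambda>w. C j t w - t *\<^sub>R c) (t\<^sup>2 * \<epsilon>)"
proof -
  let ?h = "\<lambda>n. t / real (Suc n)"
  have "tends_in_prob P (\<lambda>n w. t *\<^sub>R c) (\<lambda>w. t *\<^sub>R c)" by (rule tends_in_prob_AE) auto
  from tends_in_prob_diff[OF covariation_drift[OF j t] this]
  show ?thesis
  proof (rule second_moment_le_limit)
    fix n
    have "second_moment_le P (\<lambda>w. \<Sum>i<Suc n. D j (Y (grid t n i) w) (X j (Y (grid t n i) w)) - c)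
        (real (card {..<Suc n}) * (\<Sum>i<Suc n. \<epsilon>))"
      using t grid_mem[of t _ n] by (intro second_moment_le_sum \<epsilon>) auto
    from second_moment_le_scaleR[OF this, of "?h n"]
    have "second_moment_le P (\<lambda>w. ?h n *\<^sub>R (\<Sum>i<Suc n. D j (Y (grid t n i) w) (X j (Y (grid t n i) w)) - c))
        ((?h n)\<^sup>2 * (real (card {..<Suc n}) * (\<Sum>i<Suc n. \<epsilon>)))" .
    moreover have "(?h n)\<^sup>2 * (real (card {..<Suc n}) * (\<Sum>i<Suc n. \<epsilon>)) = t\<^sup>2 * \<epsilon>"
      by (simp add: power2_eq_square del: of_nat_Suc)
    moreover have "?h n *\<^sub>R (\<Sum>i<Suc n. f i - c) = ?h n *\<^sub>R (\<Sum>i<Suc n. f i) - t *\<^sub>R c" for f :: "nat \<Rightarrow> 'a"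
      by (simp add: sum_subtractf scaleR_diff_right sum_constant_scaleR del: of_nat_Suc sum.lessThan_Suc)
    ultimately show "second_moment_le P (\<lambda>w. ?h n *\<^sub>R (\<Sum>i<Suc n. D j (Y (grid t n i) w) (X j (Y (grid t n i) w))) - t *\<^sub>R c)
        (t\<^sup>2 * \<epsilon>)" by (simp only:)
  qed
qed

lemma covariation_moment:
  assumes j: "j < m" and t: "0 < t"
  shows "second_moment_le P (C j t) (t\<^sup>2 * (K * K)\<^sup>2)"
proof -
  have "second_moment_le P (\<lambda>w. D j (Y r w) (X j (Y r w)) - 0) ((K * K)\<^sup>2)" if "r \<in> {0..t}" for r
  proof -
    have "norm (D j (Y r w) (X j (Y r w))) \<le> K * K" if "w \<in> space P" for w
    proof -
      have y: "Y r w \<in> M" using Y_in_M[of r w] that \<open>r \<in> {0..t}\<close> by simp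
      have "norm (D j (Y r w) (X j (Y r w))) \<le> K * norm (X j (Y r w))" by (rule D_bound[OF j y])
      also have "\<dots> \<le> K * K" using X_bound[OF j y] K by (intro mult_left_mono)
      finally show ?thesis .
    qed
    moreover have "(\<lambda>w. D j (Y r w) (X j (Y r w))) \<in> borel_measurable P"
      using that by (intro fY_measurable DX_cont[OF j j]) auto
    ultimately show ?thesis using K by (intro second_moment_le_bounded AE_I2) auto
  qed
  from covariation_moment_diff[OF j t this] show ?thesis by simp
qed

end

section \<open>Short-time asymptotics of the semigroup\<close>

lemma (in prob_space) norm_expectation_le:
  assumes "second_moment_le M f B"
  shows "norm (expectation f) \<le> sqrt B"
proof -
  have i: "integrable M (\<lambda>w. norm (f w))" "integrable M (\<lambda>w. (norm (f w))\<^sup>2)"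
    using second_moment_le_integrable[OF assms] second_moment_le_integrable_sq[OF assms] by auto
  have "norm (expectation f) \<le> expectation (\<lambda>w. norm (f w))" by (rule integral_norm_bound)
  also have "\<dots> \<le> sqrt (expectation (\<lambda>w. (norm (f w))\<^sup>2))"
  proof (rule real_le_rsqrt)
    have "0 \<le> variance (\<lambda>w. norm (f w))" by (rule variance_positive)
    then show "(expectation (\<lambda>w. norm (f w)))\<^sup>2 \<le> expectation (\<lambda>w. (norm (f w))\<^sup>2)" using variance_eq[OF i] by simp
  qed
  also have "\<dots> \<le> sqrt B" using second_moment_le_integral[OF assms] by simp
  finally show ?thesis .
qed

context stratonovich_diffusion
begin

text \<open>\<open>Ito_increment\<close> started at time 0, where the integral vanishes only almost
  surely; hence the passage through almost sure equality.\<close>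

lemma Ito_from_0:
  assumes j: "j < m" and t: "0 < t"
    and \<epsilon>: "\<And>r. r \<in> {0..t} \<Longrightarrow> second_moment_le P (\<lambda>w. X j (Y r w) - X j (Y 0 w)) \<epsilon>"
  shows "second_moment_le P (\<lambda>w. I j t w - W j t w *\<^sub>R X j x) (t * \<epsilon>)"
    and "expectation (\<lambda>w. I j t w - W j t w *\<^sub>R X j x) = 0"
proof -
  have m1: "(\<lambda>w. I j t w - W j t w *\<^sub>R X j x) \<in> borel_measurable P"
    using I_measurable[OF j, of t] W_measurable[OF j, of t] t by auto
  have ae: "AE w in P. I j t w - I j 0 w - dW j 0 t w *\<^sub>R X j (Y 0 w) = I j t w - W j t w *\<^sub>R X j x"
    using I_0[OF j] AE_space by eventually_elim (simp add: dW_def W_0[OF j] Y_0)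
  note Ii = Ito_increment[OF j order_refl t \<epsilon>]
  show "second_moment_le P (\<lambda>w. I j t w - W j t w *\<^sub>R X j x) (t * \<epsilon>)"
    using second_moment_le_AE_cong[OF Ii(1) m1 ae] by simp
  have "expectation (\<lambda>w. I j t w - I j 0 w - dW j 0 t w *\<^sub>R X j (Y 0 w)) = expectation (\<lambda>w. I j t w - W j t w *\<^sub>R X j x)"
    by (rule integral_cong_AE[OF second_moment_le_measurable[OF Ii(1)] m1 ae])
  then show "expectation (\<lambda>w. I j t w - W j t w *\<^sub>R X j x) = 0" using Ii(2) by simp
qed

lemma W_moments:
  assumes j: "j < m" and t: "0 < t"
  shows "integrable P (\<lambda>w. (W j t w)^k)" "expectation (W j t) = 0" "expectation (\<lambda>w. (W j t w)\<^sup>2) = t"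
    "expectation (\<lambda>w. (W j t w)^4) = 3 * t\<^sup>2"
proof -
  have e: "\<And>w. w \<in> space P \<Longrightarrow> dW j 0 t w = W j t w" by (simp add: dW_def W_0[OF j])
  note d = dW_moments[OF j order_refl t]
  show "integrable P (\<lambda>w. (W j t w)^k)" using d(1)[of k] by (simp add: e cong: Bochner_Integration.integrable_cong)
  show "expectation (W j t) = 0" "expectation (\<lambda>w. (W j t w)\<^sup>2) = t" "expectation (\<lambda>w. (W j t w)^4) = 3 * t\<^sup>2"
    using d(2-4) by (simp_all add: e cong: Bochner_Integration.integral_cong)
qed

lemma W_mult:
  assumes j: "j < m" "l < m" and t: "0 < t"
  shows "integrable P (\<lambda>w. W j t w * W l t w)" "expectation (\<lambda>w. W j t w * W l t w) = (if j = l then t else 0)"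
proof -
  define c where "c = (if j = l then t else 0)"
  have f: "fresh (F 0) (\<lambda>w. dW j 0 t w * dW l 0 t w - c)"
    using fresh_dW_mult(1)[OF j order_refl t] by (simp only: c_def diff_zero)
  have e: "\<And>w. w \<in> space P \<Longrightarrow> dW j 0 t w * dW l 0 t w - c = W j t w * W l t w - c"
    by (simp add: dW_def W_0[OF j(1)] W_0[OF j(2)])
  have i: "integrable P (\<lambda>w. W j t w * W l t w - c)"
    using fresh_integrable[OF f] by (simp add: e cong: Bochner_Integration.integrable_cong)
  have z: "expectation (\<lambda>w. W j t w * W l t w - c) = 0"
    using f by (simp add: fresh_def e cong: Bochner_Integration.integral_cong)
  have "integrable P (\<lambda>w. (W j t w * W l t w - c) + c)" by (intro Bochner_Integration.integrable_add i) simp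
  then show i': "integrable P (\<lambda>w. W j t w * W l t w)" by simp
  show "expectation (\<lambda>w. W j t w * W l t w) = (if j = l then t else 0)"
    using z Bochner_Integration.integral_diff[OF i', of "\<lambda>_. c"] by (simp add: prob_space c_def)
qed

section \<open>Moments of the increment and Taylor expansion of its expectation\<close>

text \<open>The Gaussian part of the increment, with the coefficients frozen at the starting point.
  It is of order sqrt t and explicit enough for fourth moments.\<close>

definition lead :: "real \<Rightarrow> 'w \<Rightarrow> 'a" where
  "lead t w = (\<Sum>j<m. W j t w *\<^sub>R X j x)"

text \<open>The part of smaller order: its second moment is O(t \<epsilon> + t^2), where \<epsilon>
  bounds the mean-square oscillation of the coefficients up to time t.\<close>

definition rest :: "real \<Rightarrow> 'w \<Rightarrow> 'a" where
  "rest t w = (\<Sum>j<m. (I j t w - W j t w *\<^sub>R X j x) + (1/2) *\<^sub>R C j t w)"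

lemma Y_decomposition: "0 \<le> t \<Longrightarrow> AE w in P. Y t w = x + (lead t w + rest t w)"
  using Y_eq[of t] by (auto elim!: eventually_mono simp: lead_def rest_def sum.distrib sum_subtractf)

lemma lead_moment:
  assumes t: "0 < t"
  shows "second_moment_le P (lead t) (m * (m * (t * K\<^sup>2)))"
proof -
  have "second_moment_le P (\<lambda>w. W j t w *\<^sub>R X j x) (t * K\<^sup>2)" if j: "j < m" for j
  proof (rule second_moment_leI)
    show "(\<lambda>w. W j t w *\<^sub>R X j x) \<in> borel_measurable P" using W_measurable[OF j, of t] t by auto
    show "integrable P (\<lambda>w. (norm (W j t w *\<^sub>R X j x))\<^sup>2)"
      using W_moments(1)[OF j t, of 2] by (simp add: power_mult_distrib)
    have "expectation (\<lambda>w. (norm (W j t w *\<^sub>R X j x))\<^sup>2) = t * (norm (X j x))\<^sup>2"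
      using W_moments[OF j t] by (simp add: power_mult_distrib)
    also have "\<dots> \<le> t * K\<^sup>2" using X_bound[OF j xM] t by (intro mult_left_mono power_mono) auto
    finally show "expectation (\<lambda>w. (norm (W j t w *\<^sub>R X j x))\<^sup>2) \<le> t * K\<^sup>2" .
  qed
  then have "second_moment_le P (lead t) (real (card {..<m}) * (\<Sum>j<m. t * K\<^sup>2))"
    unfolding lead_def[abs_def] by (intro second_moment_le_sum) auto
  then show ?thesis by simp
qed

text \<open>Cauchy-Schwarz is used twice. This produces three of the factors \<open>m\<close>, the
  last sum a fourth, and each Brownian fourth moment contributes 3t^2.\<close>

lemma lead_fourth:
  assumes t: "0 < t"
  shows "integrable P (\<lambda>w. (norm (lead t w))^4)" "expectation (\<lambda>w. (norm (lead t w))^4) \<le> 3 * real m^4 * K^4 * t\<^sup>2"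
proof -
  have le: "(norm (lead t w))^4 \<le> real m^3 * K^4 * (\<Sum>j<m. (W j t w)^4)" for w
  proof -
    have "(norm (lead t w))\<^sup>2 \<le> real m * (\<Sum>j<m. (norm (W j t w *\<^sub>R X j x))\<^sup>2)"
      unfolding lead_def using norm_sum_sq_le[of "\<lambda>j. W j t w *\<^sub>R X j x" "{..<m}"] by (simp only: card_lessThan)
    also have "\<dots> \<le> real m * (\<Sum>j<m. (W j t w)\<^sup>2 * K\<^sup>2)"
      using X_bound[OF _ xM]
      by (intro mult_left_mono sum_mono) (auto simp: power_mult_distrib intro!: mult_left_mono power_mono)
    also have "\<dots> = real m * K\<^sup>2 * (\<Sum>j<m. (W j t w)\<^sup>2)" by (simp add: sum_distrib_left mult_ac)
    finally have "((norm (lead t w))\<^sup>2)\<^sup>2 \<le> (real m * K\<^sup>2 * (\<Sum>j<m. (W j t w)\<^sup>2))\<^sup>2"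
      by (intro power_mono) auto
    also have "\<dots> = (real m * K\<^sup>2)\<^sup>2 * (norm (\<Sum>j<m. (W j t w)\<^sup>2))\<^sup>2" by (simp add: power_mult_distrib)
    also have "\<dots> \<le> (real m * K\<^sup>2)\<^sup>2 * (real m * (\<Sum>j<m. (norm ((W j t w)\<^sup>2))\<^sup>2))"
      using norm_sum_sq_le[of "\<lambda>j. (W j t w)\<^sup>2" "{..<m}"] by (intro mult_left_mono) (simp_all only: card_lessThan zero_le_power2)
    also have "\<dots> = real m^3 * K^4 * (\<Sum>j<m. (W j t w)^4)"
      by (simp add: power_mult_distrib power3_eq_cube power2_eq_square power4_eq_xxxx mult_ac)
    finally show ?thesis by (simp add: power4_eq_xxxx power2_eq_square mult_ac)
  qed
  have i: "integrable P (\<lambda>w. real m^3 * K^4 * (\<Sum>j<m. (W j t w)^4))"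
    by (intro integrable_mult_right Bochner_Integration.integrable_sum W_moments(1)[OF _ t]) auto
  note [measurable] = second_moment_le_measurable[OF lead_moment[OF t]]
  show i2: "integrable P (\<lambda>w. (norm (lead t w))^4)"
    by (rule Bochner_Integration.integrable_bound[OF i]) (auto intro!: AE_I2 order_trans[OF le abs_ge_self])
  have "expectation (\<lambda>w. (norm (lead t w))^4) \<le> expectation (\<lambda>w. real m^3 * K^4 * (\<Sum>j<m. (W j t w)^4))"
    by (intro integral_mono i i2 le)
  also have "\<dots> = real m^3 * K^4 * (\<Sum>j<m. expectation (\<lambda>w. (W j t w)^4))"
    using W_moments(1)[OF _ t] by (subst integral_mult_right_zero, subst Bochner_Integration.integral_sum) auto
  also have "\<dots> = 3 * real m^4 * K^4 * t\<^sup>2" using W_moments(4)[OF _ t] by (simp add: power3_eq_cube power4_eq_xxxx)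
  finally show "expectation (\<lambda>w. (norm (lead t w))^4) \<le> 3 * real m^4 * K^4 * t\<^sup>2" .
qed

context
  fixes t \<epsilon> :: real
  assumes t: "0 < t"
    and \<epsilon>: "\<And>j r. j < m \<Longrightarrow> r \<in> {0..t} \<Longrightarrow> second_moment_le P (\<lambda>w. X j (Y r w) - X j (Y 0 w)) \<epsilon>"
begin

lemma rest_moment: "second_moment_le P (rest t) (m * (m * (2 * (t * \<epsilon> + t\<^sup>2 * K^4 / 4))))"
proof -
  have "second_moment_le P (\<lambda>w. (I j t w - W j t w *\<^sub>R X j x) + (1/2) *\<^sub>R C j t w) (2 * (t * \<epsilon> + t\<^sup>2 * K^4 / 4))"
    if j: "j < m" for j
    using second_moment_le_add[OF Ito_from_0(1)[OF j t \<epsilon>[OF j]] second_moment_le_scaleR[OF covariation_moment[OF j t], of "1/2"]]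
    by (simp add: power_divide power2_eq_square power4_eq_xxxx mult_ac)
  then have "second_moment_le P (rest t) (real (card {..<m}) * (\<Sum>j<m. 2 * (t * \<epsilon> + t\<^sup>2 * K^4 / 4)))"
    unfolding rest_def[abs_def] by (intro second_moment_le_sum) auto
  then show ?thesis by simp
qed

text \<open>The Brownian terms and the Ito errors have mean zero, so the first-order term of the
  expansion sees nothing but half of the covariations: the Stratonovich drift.\<close>

lemma expectation_linear_increment:
  fixes L :: "'a \<Rightarrow> real"
  assumes L: "bounded_linear L"
  shows "expectation (\<lambda>w. L (lead t w + rest t w)) = (\<Sum>j<m. L (expectation (C j t)) / 2)"
proof -
  interpret bounded_linear L by (rule L)
  have iI: "integrable P (\<lambda>w. I j t w - W j t w *\<^sub>R X j x)" if "j < m" for j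
    by (rule second_moment_le_integrable[OF Ito_from_0(1)[OF that t \<epsilon>[OF that]]])
  have iC: "integrable P (C j t)" if "j < m" for j
    by (rule second_moment_le_integrable[OF covariation_moment[OF that t]])
  have iW: "integrable P (W j t)" if "j < m" for j using W_moments(1)[OF that t, of 1] by simp
  have "expectation (\<lambda>w. L (lead t w + rest t w))
      = expectation (\<lambda>w. \<Sum>j<m. W j t w * L (X j x) + (L (I j t w - W j t w *\<^sub>R X j x) + L (C j t w) / 2))"
    by (simp add: lead_def rest_def add sum scaleR sum.distrib)
  also have "\<dots> = (\<Sum>j<m. expectation (\<lambda>w. W j t w * L (X j x) + (L (I j t w - W j t w *\<^sub>R X j x) + L (C j t w) / 2)))"
    by (intro Bochner_Integration.integral_sum Bochner_Integration.integrable_add integrable_mult_left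
        integrable_divide integrable_bounded_linear[OF L] iI iC iW) auto
  also have "\<dots> = (\<Sum>j<m. L (expectation (C j t)) / 2)"
  proof (rule sum.cong[OF refl])
    fix j assume "j \<in> {..<m}"
    then have j: "j < m" by simp
    have 1: "integrable P (\<lambda>w. L (I j t w - W j t w *\<^sub>R X j x))" "expectation (\<lambda>w. L (I j t w - W j t w *\<^sub>R X j x)) = 0"
      using integrable_bounded_linear[OF L iI[OF j]] integral_bounded_linear[OF L iI[OF j]]
        Ito_from_0(2)[OF j t \<epsilon>[OF j]] by (simp_all add: zero)
    have 2: "integrable P (\<lambda>w. L (C j t w))" "expectation (\<lambda>w. L (C j t w)) = L (expectation (C j t))"
      using integrable_bounded_linear[OF L iC[OF j]] integral_bounded_linear[OF L iC[OF j]] by auto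
    show "expectation (\<lambda>w. W j t w * L (X j x) + (L (I j t w - W j t w *\<^sub>R X j x) + L (C j t w) / 2))
        = L (expectation (C j t)) / 2"
      using 1 2 iW[OF j] W_moments(2)[OF j t] by simp
  qed
  finally show ?thesis .
qed

text \<open>A crude bound of order \<open>t\<close> that is uniform in the starting point. It serves
  as the dominating bound for the difference quotients.\<close>

lemma expectation_increment_bound:
  fixes f :: "'a \<Rightarrow> real"
  assumes f: "continuous_on M f" and L: "bounded_linear L" and K1: "K1 \<ge> 0" "\<And>u. \<bar>L u\<bar> \<le> K1 * norm u"
    and T: "\<And>y. y \<in> M \<Longrightarrow> \<bar>f y - f x - L (y - x)\<bar> \<le> K1 * (norm (y - x))\<^sup>2"
  shows "\<bar>expectation (\<lambda>w. f (Y t w)) - f x\<bar> \<le>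
    K1 * (2 * (m * (m * (t * K\<^sup>2)) + m * (m * (2 * (t * \<epsilon> + t\<^sup>2 * K^4 / 4))))) + m * (K1 * (t * (K * K)) / 2)"
proof -
  let ?d = "\<lambda>w. lead t w + rest t w"
  note d = second_moment_le_add[OF lead_moment[OF t] rest_moment]
  have fi: "integrable P (\<lambda>w. f (Y t w))"
  proof -
    obtain B where "\<And>y. y \<in> M \<Longrightarrow> norm (f y) \<le> B" using fY_bounded[OF f] by blast
    then show ?thesis
      using t fY_measurable[OF f, of t] Y_in_M[of t] by (intro integrable_const_bound[where B=B] AE_I2) auto
  qed
  have Li: "integrable P (\<lambda>w. L (?d w))" by (rule integrable_bounded_linear[OF L second_moment_le_integrable[OF d]])
  have "\<bar>expectation (\<lambda>w. f (Y t w) - f x - L (?d w))\<bar> \<le> expectation (\<lambda>w. \<bar>f (Y t w) - f x - L (?d w)\<bar>)"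
    by (rule integral_abs_bound)
  also have "\<dots> \<le> expectation (\<lambda>w. K1 * (norm (?d w))\<^sup>2)"
  proof (rule integral_mono_AE)
    show "AE w in P. \<bar>f (Y t w) - f x - L (?d w)\<bar> \<le> K1 * (norm (?d w))\<^sup>2"
      using Y_decomposition[OF less_imp_le[OF t]] AE_space
    proof eventually_elim
      case (elim w)
      then have "?d w = Y t w - x" "Y t w \<in> M" using Y_in_M[of t w] t by auto
      then show ?case using T by metis
    qed
  qed (use fi Li second_moment_le_integrable_sq[OF d] in auto)
  also have "\<dots> \<le> K1 * (2 * (m * (m * (t * K\<^sup>2)) + m * (m * (2 * (t * \<epsilon> + t\<^sup>2 * K^4 / 4)))))"
    using K1(1) second_moment_le_integral[OF d] by (simp add: mult_left_mono)
  also have "expectation (\<lambda>w. f (Y t w) - f x - L (?d w)) = expectation (\<lambda>w. f (Y t w)) - f x - (\<Sum>j<m. L (expectation (C j t)) / 2)"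
    using fi Li expectation_linear_increment[OF L] by (simp add: prob_space)
  finally have 1: "\<bar>expectation (\<lambda>w. f (Y t w)) - f x - (\<Sum>j<m. L (expectation (C j t)) / 2)\<bar>
      \<le> K1 * (2 * (m * (m * (t * K\<^sup>2)) + m * (m * (2 * (t * \<epsilon> + t\<^sup>2 * K^4 / 4)))))" .
  have "\<bar>\<Sum>j<m. L (expectation (C j t)) / 2\<bar> \<le> (\<Sum>j<m. K1 * (t * (K * K)) / 2)"
  proof (rule order_trans[OF sum_abs sum_mono])
    fix j assume "j \<in> {..<m}"
    then have "norm (expectation (C j t)) \<le> sqrt (t\<^sup>2 * (K * K)\<^sup>2)" by (intro norm_expectation_le covariation_moment t) auto
    also have "\<dots> = t * (K * K)" using t K by (simp add: real_sqrt_mult)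
    finally have "\<bar>L (expectation (C j t))\<bar> \<le> K1 * (t * (K * K))"
      using K1(2)[of "expectation (C j t)"] K1(1) by (meson mult_left_mono order_trans)
    then show "\<bar>L (expectation (C j t)) / 2\<bar> \<le> K1 * (t * (K * K)) / 2" by simp
  qed
  with 1 show ?thesis by simp
qed

text \<open>The error is \<open>t\<close> times three contributions: \<eta> from the Taylor
  remainder of a C^2 function, the \<open>R\<close> term from the fourth moment of
  \<open>lead\<close> and the second moment of \<open>rest\<close>, and sqrt \<epsilon>' from
  replacing the covariation by \<open>t\<close> times its initial drift.\<close>

lemma expectation_second_order:
  fixes f :: "'a \<Rightarrow> real"
  assumes f: "Ck_on (Suc (Suc k)) U f" and U: "open U" "M \<subseteq> U" and K1: "\<And>u. \<bar>FD f x u\<bar> \<le> K1 * norm u" "K1 \<ge> 0"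
    and T: "\<And>d1 d2. x + (d1 + d2) \<in> M \<Longrightarrow>
      \<bar>f (x + (d1 + d2)) - f x - FD f x (d1 + d2) - FD2 f x d1 d1 / 2\<bar> \<le> \<eta> * (norm d1)\<^sup>2 + R * ((norm d1)^4 + (norm d2)\<^sup>2)"
    and \<eta>: "\<eta> \<ge> 0" and R: "R \<ge> 0"
    and \<epsilon>': "\<And>j r. j < m \<Longrightarrow> r \<in> {0..t} \<Longrightarrow> second_moment_le P (\<lambda>w. D j (Y r w) (X j (Y r w)) - D j x (X j x)) \<epsilon>'"
  shows "\<bar>expectation (\<lambda>w. f (Y t w)) - f x - t * (\<Sum>j<m. (FD2 f x (X j x) (X j x) + FD f x (D j x (X j x))) / 2)\<bar>
    \<le> t * (\<eta> * (m * (m * K\<^sup>2)) + R * (3 * real m^4 * K^4 * t + m * (m * (2 * (\<epsilon> + t * K^4 / 4)))) + m * (K1 * sqrt \<epsilon>' / 2))"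
proof -
  let ?d = "\<lambda>w. lead t w + rest t w" and ?L = "FD f x" and ?B = "FD2 f x"
  have xU: "x \<in> U" using xM U by auto
  have L: "bounded_linear ?L"
    using Ck_on_FD[OF f xU] has_derivative_bounded_linear by blast
  interpret Bl: linear "\<lambda>u. ?B u w" for w by (rule linear_FD2_left[OF f xU])
  interpret Br: linear "?B u" for u by (rule linear_FD2_right[OF f U(1) xU])
  note d = second_moment_le_add[OF lead_moment[OF t] rest_moment]
  have fc: "continuous_on M f" using Ck_on_differentiable_imp_continuous[OF f] U continuous_on_subset by blast
  have fi: "integrable P (\<lambda>w. f (Y t w))"
  proof -
    obtain B where "\<And>y. y \<in> M \<Longrightarrow> norm (f y) \<le> B" using fY_bounded[OF fc] by blast
    then show ?thesis
      using t fY_measurable[OF fc, of t] Y_in_M[of t] by (intro integrable_const_bound[where B=B] AE_I2) auto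
  qed
  have Li: "integrable P (\<lambda>w. ?L (?d w))" by (rule integrable_bounded_linear[OF L second_moment_le_integrable[OF d]])
  have Bsum: "?B (lead t w) (lead t w) = (\<Sum>j<m. \<Sum>l<m. (W j t w * W l t w) * ?B (X j x) (X l x))" for w
    unfolding lead_def by (subst sum.swap) (simp add: Bl.sum Br.sum Bl.scale Br.scale sum_distrib_left mult_ac)
  have Bi: "integrable P (\<lambda>w. ?B (lead t w) (lead t w))"
    unfolding Bsum by (intro Bochner_Integration.integrable_sum integrable_mult_left W_mult(1) t) auto
  \<comment> \<open>Distinct Brownian motions are uncorrelated, so only the diagonal of the
    quadratic form remains.\<close>
  have BE: "expectation (\<lambda>w. ?B (lead t w) (lead t w)) = t * (\<Sum>j<m. ?B (X j x) (X j x))"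
  proof -
    have "expectation (\<lambda>w. ?B (lead t w) (lead t w)) = (\<Sum>j<m. \<Sum>l<m. expectation (\<lambda>w. W j t w * W l t w) * ?B (X j x) (X l x))"
      unfolding Bsum using W_mult(1)[OF _ _ t]
      by (subst Bochner_Integration.integral_sum, force intro!: Bochner_Integration.integrable_sum)
        (intro sum.cong refl, subst Bochner_Integration.integral_sum, auto)
    also have "\<dots> = (\<Sum>j<m. \<Sum>l<m. (if j = l then t * ?B (X j x) (X l x) else 0))"
      using W_mult(2)[OF _ _ t] by (intro sum.cong refl) auto
    also have "\<dots> = t * (\<Sum>j<m. ?B (X j x) (X j x))" by (simp add: sum_distrib_left)
    finally show ?thesis .
  qed
  let ?g = "\<lambda>w. f (Y t w) - f x - ?L (?d w) - ?B (lead t w) (lead t w) / 2"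
  have i1: "integrable P (\<lambda>w. (norm (lead t w))\<^sup>2)" "integrable P (\<lambda>w. (norm (rest t w))\<^sup>2)"
    using second_moment_le_integrable_sq lead_moment[OF t] rest_moment by blast+
  have "\<bar>expectation ?g\<bar> \<le> expectation (\<lambda>w. \<bar>?g w\<bar>)" by (rule integral_abs_bound)
  also have "\<dots> \<le> expectation (\<lambda>w. \<eta> * (norm (lead t w))\<^sup>2 + R * ((norm (lead t w))^4 + (norm (rest t w))\<^sup>2))"
  proof (rule integral_mono_AE)
    show "AE w in P. \<bar>?g w\<bar> \<le> \<eta> * (norm (lead t w))\<^sup>2 + R * ((norm (lead t w))^4 + (norm (rest t w))\<^sup>2)"
      using Y_decomposition[OF less_imp_le[OF t]] AE_space
    proof eventually_elim
      case (elim w)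
      then show ?case using T[of "lead t w" "rest t w"] Y_in_M[of t w] t by simp
    qed
    show "integrable P (\<lambda>w. \<eta> * (norm (lead t w))\<^sup>2 + R * ((norm (lead t w))^4 + (norm (rest t w))\<^sup>2))"
      using i1 lead_fourth(1)[OF t] by simp
    show "integrable P (\<lambda>w. \<bar>?g w\<bar>)" using fi Li Bi by simp
  qed
  also have "\<dots> = \<eta> * expectation (\<lambda>w. (norm (lead t w))\<^sup>2)
      + R * (expectation (\<lambda>w. (norm (lead t w))^4) + expectation (\<lambda>w. (norm (rest t w))\<^sup>2))"
    using i1 lead_fourth(1)[OF t] by simp
  also have "\<dots> \<le> \<eta> * (m * (m * (t * K\<^sup>2))) + R * (3 * real m^4 * K^4 * t\<^sup>2 + m * (m * (2 * (t * \<epsilon> + t\<^sup>2 * K^4 / 4))))"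
    by (intro add_mono mult_left_mono second_moment_le_integral lead_moment rest_moment lead_fourth(2) t \<eta> R)
  also have "expectation ?g = expectation (\<lambda>w. f (Y t w)) - f x - (\<Sum>j<m. ?L (expectation (C j t)) / 2) - t * (\<Sum>j<m. ?B (X j x) (X j x)) / 2"
    using fi Li Bi expectation_linear_increment[OF L] BE by (simp add: prob_space)
  finally have 1: "\<bar>expectation (\<lambda>w. f (Y t w)) - f x - (\<Sum>j<m. ?L (expectation (C j t)) / 2) - t * (\<Sum>j<m. ?B (X j x) (X j x)) / 2\<bar>
     \<le> \<eta> * (m * (m * (t * K\<^sup>2))) + R * (3 * real m^4 * K^4 * t\<^sup>2 + m * (m * (2 * (t * \<epsilon> + t\<^sup>2 * K^4 / 4))))" .
  have 2: "\<bar>\<Sum>j<m. (?L (expectation (C j t)) - t * ?L (D j x (X j x))) / 2\<bar> \<le> (\<Sum>j<m. K1 * (t * sqrt \<epsilon>') / 2)"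
  proof (rule order_trans[OF sum_abs sum_mono])
    fix j assume "j \<in> {..<m}"
    then have j: "j < m" by simp
    interpret L: bounded_linear ?L by (rule L)
    note c = covariation_moment_diff[OF j t \<epsilon>'[OF j]]
    have iC: "integrable P (C j t)" by (rule second_moment_le_integrable[OF covariation_moment[OF j t]])
    have "norm (expectation (\<lambda>w. C j t w - t *\<^sub>R D j x (X j x))) \<le> sqrt (t\<^sup>2 * \<epsilon>')" by (rule norm_expectation_le[OF c])
    also have "\<dots> = t * sqrt \<epsilon>'" using t by (simp add: real_sqrt_mult)
    also have "expectation (\<lambda>w. C j t w - t *\<^sub>R D j x (X j x)) = expectation (C j t) - t *\<^sub>R D j x (X j x)"
      using iC by (simp add: prob_space)
    finally have "K1 * norm (expectation (C j t) - t *\<^sub>R D j x (X j x)) \<le> K1 * (t * sqrt \<epsilon>')"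
      using K1(2) by (intro mult_left_mono)
    with K1(1)[of "expectation (C j t) - t *\<^sub>R D j x (X j x)"]
    have "\<bar>?L (expectation (C j t) - t *\<^sub>R D j x (X j x))\<bar> \<le> K1 * (t * sqrt \<epsilon>')" by (rule order_trans)
    then show "\<bar>(?L (expectation (C j t)) - t * ?L (D j x (X j x))) / 2\<bar> \<le> K1 * (t * sqrt \<epsilon>') / 2"
      by (simp add: L.diff L.scaleR)
  qed
  have 3: "expectation (\<lambda>w. f (Y t w)) - f x - t * (\<Sum>j<m. (?B (X j x) (X j x) + ?L (D j x (X j x))) / 2)
     = (expectation (\<lambda>w. f (Y t w)) - f x - (\<Sum>j<m. ?L (expectation (C j t)) / 2) - t * (\<Sum>j<m. ?B (X j x) (X j x)) / 2)
       + (\<Sum>j<m. (?L (expectation (C j t)) - t * ?L (D j x (X j x))) / 2)"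
    by (simp add: sum_subtractf sum.distrib diff_divide_distrib add_divide_distrib distrib_left
        sum_distrib_left sum_divide_distrib)
  have "\<bar>expectation (\<lambda>w. f (Y t w)) - f x - t * (\<Sum>j<m. (?B (X j x) (X j x) + ?L (D j x (X j x))) / 2)\<bar>
    \<le> (\<eta> * (m * (m * (t * K\<^sup>2))) + R * (3 * real m^4 * K^4 * t\<^sup>2 + m * (m * (2 * (t * \<epsilon> + t\<^sup>2 * K^4 / 4)))))
      + (\<Sum>j<m. K1 * (t * sqrt \<epsilon>') / 2)"
    unfolding 3 by (rule order_trans[OF abs_triangle_ineq add_mono[OF 1 2]])
  also have "\<dots> = t * (\<eta> * (m * (m * K\<^sup>2)) + R * (3 * real m^4 * K^4 * t + m * (m * (2 * (\<epsilon> + t * K^4 / 4)))) + m * (K1 * sqrt \<epsilon>' / 2))"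
    by (simp add: algebra_simps power2_eq_square)
  finally show ?thesis .
qed

end

text \<open>In \<open>expectation_second_order\<close> the oscillations \<epsilon> and \<epsilon>'
  over [0, 1/(n+1)] tend to 0 by \<open>time_modulus\<close>; after division by the time only the
  term with the arbitrary \<eta> is left.\<close>

lemma generator_limit:
  fixes f :: "'a \<Rightarrow> real"
  assumes f: "Ck_on (Suc (Suc k)) U f" and U: "open U" "M \<subseteq> U"
  shows "(\<lambda>n. real (Suc n) * (expectation (\<lambda>w. f (Y (1 / Suc n) w)) - f x))
    \<longlonglongrightarrow> (\<Sum>j<m. (FD2 f x (X j x) (X j x) + FD f x (D j x (X j x))) / 2)" (is "?q \<longlonglongrightarrow> ?L")
proof -
  have "\<exists>\<epsilon>. \<epsilon> \<longlonglongrightarrow> 0 \<and> (\<forall>n r. r \<in> {0..1 / real (Suc n)} \<longrightarrow> second_moment_le P (\<lambda>w. g (Y r w) - g (Y 0 w)) (\<epsilon> n))"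
    if g: "continuous_on M g" for g :: "'a \<Rightarrow> 'a"
  proof (rule time_modulus[OF g, of 1])
    fix \<epsilon> :: "nat \<Rightarrow> real"
    assume \<epsilon>: "\<epsilon> \<longlonglongrightarrow> 0" "\<And>n s r. s \<in> {0..1} \<Longrightarrow> r \<in> {0..1} \<Longrightarrow> \<bar>s - r\<bar> \<le> 1 / real (Suc n) \<Longrightarrow>
       second_moment_le P (\<lambda>w. g (Y s w) - g (Y r w)) (\<epsilon> n)"
    have "second_moment_le P (\<lambda>w. g (Y r w) - g (Y 0 w)) (\<epsilon> n)" if r: "r \<in> {0..1 / real (Suc n)}" for n r
    proof -
      have "1 / real (Suc n) \<le> 1" by simp
      with r have "r \<in> {0..1}" unfolding atLeastAtMost_iff by linarith
      then show ?thesis using r by (intro \<epsilon>(2)) auto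
    qed
    with \<epsilon>(1) show ?thesis by blast
  qed simp
  note mod = this
  define mo where "mo g \<epsilon> \<longleftrightarrow> \<epsilon> \<longlonglongrightarrow> 0 \<and> (\<forall>n r. r \<in> {0..1 / real (Suc n)} \<longrightarrow>
    second_moment_le P (\<lambda>w. g (Y r w) - g (Y 0 w)) (\<epsilon> n))" for g :: "'a \<Rightarrow> 'a" and \<epsilon> :: "nat \<Rightarrow> real"
  have "\<forall>j. \<exists>\<epsilon>. j < m \<longrightarrow> mo (X j) \<epsilon>" using mod[OF X_cont] unfolding mo_def by blast
  from choice[OF this] obtain \<epsilon> where e1: "\<And>j. j < m \<Longrightarrow> mo (X j) (\<epsilon> j)" by blast
  have "\<forall>j. \<exists>\<epsilon>. j < m \<longrightarrow> mo (\<lambda>y. D j y (X j y)) \<epsilon>" using mod[OF DX_cont] unfolding mo_def by blast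
  from choice[OF this] obtain \<epsilon>' where e2: "\<And>j. j < m \<Longrightarrow> mo (\<lambda>y. D j y (X j y)) (\<epsilon>' j)" by blast
  have nn: "0 \<le> \<epsilon> n" if "mo g \<epsilon>" for g \<epsilon> n
    using that[unfolded mo_def, THEN conjunct2, rule_format, of 0 n] by (auto simp: second_moment_le_def)
  define E where "E n = (\<Sum>j<m. \<epsilon> j n)" for n
  define E' where "E' n = (\<Sum>j<m. \<epsilon>' j n)" for n
  have E: "E \<longlonglongrightarrow> 0" "E' \<longlonglongrightarrow> 0"
  proof -
    have "E \<longlonglongrightarrow> (\<Sum>j<m. 0)" unfolding E_def[abs_def] using e1 by (intro tendsto_sum) (auto simp: mo_def)
    then show "E \<longlonglongrightarrow> 0" by simp
    have "E' \<longlonglongrightarrow> (\<Sum>j<m. 0)" unfolding E'_def[abs_def] using e2 by (intro tendsto_sum) (auto simp: mo_def)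
    then show "E' \<longlonglongrightarrow> 0" by simp
  qed
  have E_mom: "second_moment_le P (\<lambda>w. X j (Y r w) - X j (Y 0 w)) (E n)"
    if "j < m" "r \<in> {0..1 / real (Suc n)}" for j r n
  proof (rule second_moment_le_mono)
    show "second_moment_le P (\<lambda>w. X j (Y r w) - X j (Y 0 w)) (\<epsilon> j n)" using e1[OF that(1)] that(2) unfolding mo_def by blast
    show "\<epsilon> j n \<le> E n" unfolding E_def by (rule member_le_sum) (use that nn[OF e1] in auto)
  qed
  have E'_mom: "second_moment_le P (\<lambda>w. D j (Y r w) (X j (Y r w)) - D j x (X j x)) (E' n)"
    if "j < m" "r \<in> {0..1 / real (Suc n)}" for j r n
  proof (rule second_moment_le_mono)
    have "second_moment_le P (\<lambda>w. D j (Y r w) (X j (Y r w)) - D j (Y 0 w) (X j (Y 0 w))) (\<epsilon>' j n)"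
      using e2[OF that(1)] that(2) unfolding mo_def by blast
    moreover have "(\<lambda>w. D j (Y r w) (X j (Y r w)) - D j x (X j x)) \<in> borel_measurable P"
      using fY_measurable[OF DX_cont[OF that(1,1)], of r] that(2) by auto
    ultimately show "second_moment_le P (\<lambda>w. D j (Y r w) (X j (Y r w)) - D j x (X j x)) (\<epsilon>' j n)"
      by (rule second_moment_le_AE_cong) (auto simp: Y_0)
    show "\<epsilon>' j n \<le> E' n" unfolding E'_def by (rule member_le_sum) (use that nn[OF e2] in auto)
  qed
  obtain K1 where K1: "K1 \<ge> 0" "\<And>y u. y \<in> M \<Longrightarrow> norm (FD f y u) \<le> K1 * norm u"
    using FD_bound[OF f compact U(2)] by blast
  show ?thesis
  proof (rule LIMSEQ_I)
    fix e :: real assume e: "0 < e"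
    \<comment> \<open>Half of \<open>e\<close> is reserved for the Taylor error, and the added 1
      keeps \<open>a\<close> positive. The constant \<open>R\<close> depends on \<eta>, so
      \<open>n0\<close> can be chosen only after it.\<close>
    define a where "a = m * (m * K\<^sup>2) + 1"
    define \<eta> where "\<eta> = e / 2 / a"
    have pos: "0 < a" by (simp add: a_def add_nonneg_pos)
    have \<eta>: "\<eta> > 0" "\<eta> * (m * (m * K\<^sup>2)) \<le> e / 2"
    proof -
      show "\<eta> > 0" using e pos by (simp add: \<eta>_def)
      then have "\<eta> * (m * (m * K\<^sup>2)) \<le> \<eta> * a" by (intro mult_left_mono) (auto simp: a_def)
      also have "\<dots> = e / 2" using pos by (simp add: \<eta>_def)
      finally show "\<eta> * (m * (m * K\<^sup>2)) \<le> e / 2" .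
    qed
    obtain R where R: "R \<ge> 0" "\<And>d1 d2. x + (d1 + d2) \<in> M \<Longrightarrow>
      \<bar>f (x + (d1 + d2)) - f x - FD f x (d1 + d2) - FD2 f x d1 d1 / 2\<bar> \<le> \<eta> * (norm d1)\<^sup>2 + R * ((norm d1)^4 + (norm d2)\<^sup>2)"
      using Taylor2_split[OF f U(1) compact U(2) xM \<eta>(1)] by blast
    let ?b = "\<lambda>n. R * (3 * real m^4 * K^4 * (1 / Suc n) + m * (m * (2 * (E n + (1 / Suc n) * K^4 / 4)))) + m * (K1 * sqrt (E' n) / 2)"
    have "?b \<longlonglongrightarrow> R * (3 * real m^4 * K^4 * 0 + m * (m * (2 * (0 + 0 * K^4 / 4)))) + m * (K1 * sqrt 0 / 2)"
      by (intro tendsto_intros E mesh_tendsto_0) auto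
    then have "?b \<longlonglongrightarrow> 0" by simp
    from order_tendstoD(2)[OF this, of "e / 2"] e obtain n0 where n0: "\<And>n. n \<ge> n0 \<Longrightarrow> ?b n < e / 2"
      unfolding eventually_sequentially by auto
    show "\<exists>n0. \<forall>n\<ge>n0. norm (?q n - ?L) < e"
    proof (intro exI allI impI)
      fix n assume n: "n \<ge> n0"
      let ?t = "1 / real (Suc n)"
      have t: "?t > 0" by simp
      have "\<bar>expectation (\<lambda>w. f (Y ?t w)) - f x - ?t * ?L\<bar> \<le> ?t * (\<eta> * (m * (m * K\<^sup>2)) + ?b n)"
        using expectation_second_order[OF t E_mom f U _ K1(1) R(2) less_imp_le[OF \<eta>(1)] R(1) E'_mom] K1(2)[OF xM]
        by (simp add: add.assoc)
      then have "real (Suc n) * \<bar>expectation (\<lambda>w. f (Y ?t w)) - f x - ?t * ?L\<bar> \<le> real (Suc n) * (?t * (\<eta> * (m * (m * K\<^sup>2)) + ?b n))"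
        by (intro mult_left_mono) auto
      moreover have "real (Suc n) * \<bar>expectation (\<lambda>w. f (Y ?t w)) - f x - ?t * ?L\<bar> = \<bar>?q n - ?L\<bar>"
      proof -
        have "?q n - ?L = real (Suc n) * (expectation (\<lambda>w. f (Y ?t w)) - f x - ?t * ?L)"
          by (simp add: right_diff_distrib del: of_nat_Suc)
        then show ?thesis by (simp only: abs_mult abs_of_nat)
      qed
      moreover have "real (Suc n) * (?t * (\<eta> * (m * (m * K\<^sup>2)) + ?b n)) = \<eta> * (m * (m * K\<^sup>2)) + ?b n"
        by (simp del: of_nat_Suc)
      ultimately have "\<bar>?q n - ?L\<bar> \<le> \<eta> * (m * (m * K\<^sup>2)) + ?b n" by linarith
      then show "norm (?q n - ?L) < e" using \<eta>(2) n0[OF n] unfolding real_norm_def by linarith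
    qed
  qed
qed

end

section \<open>The generator annihilates the invariant measure\<close>

lemma Ck_on_2: "Ck_on 2 = Ck_on (Suc (Suc 0))"
  by (simp add: numeral_2_eq_2)

lemma continuous_on_FD_field:
  fixes f :: "'a::euclidean_space \<Rightarrow> 'b::real_normed_vector" and X :: "'a \<Rightarrow> 'a"
  assumes f: "Ck_on (Suc k) U f" and X: "continuous_on U X"
  shows "continuous_on U (\<lambda>y. FD f y (X y))"
proof -
  have "continuous_on U (\<lambda>y. \<Sum>b\<in>Basis. inner (X y) b *\<^sub>R FD f y b)"
    by (intro continuous_intros X FD_continuous[OF f])
  then show ?thesis by (rule continuous_on_eq) (rule FD_basis[OF f, symmetric])
qed

lemma continuous_on_FD2_fields:
  fixes f :: "'a::euclidean_space \<Rightarrow> 'b::real_normed_vector" and X Z :: "'a \<Rightarrow> 'a"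
  assumes f: "Ck_on (Suc (Suc k)) U f" and U: "open U" and X: "continuous_on U X" and Z: "continuous_on U Z"
  shows "continuous_on U (\<lambda>y. FD2 f y (X y) (Z y))"
proof -
  have "continuous_on U (\<lambda>y. FD2 f y (X y) b)" for b
    unfolding FD2_def by (rule continuous_on_FD_field[OF Ck_on_imp_FD[OF f] X])
  then have "continuous_on U (\<lambda>y. \<Sum>b\<in>Basis. inner (Z y) b *\<^sub>R FD2 f y (X y) b)"
    by (intro continuous_intros Z)
  then show ?thesis by (rule continuous_on_eq) (rule FD2_basis_right[OF f U, symmetric])
qed

text \<open>One constant for all fields and all points of \<open>M\<close>: the bound on the
  difference quotients must not depend on the starting point.\<close>

definition field_bound :: "nat \<Rightarrow> 'a::euclidean_space set \<Rightarrow> (nat \<Rightarrow> 'a \<Rightarrow> 'a) \<Rightarrow> real \<Rightarrow> bool" where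
  "field_bound m M X K \<longleftrightarrow> K \<ge> 0 \<and> (\<forall>y\<in>M. norm y \<le> K) \<and>
     (\<forall>j<m. \<forall>y\<in>M. (\<forall>u. norm (FD (X j) y u) \<le> K * norm u) \<and> norm (X j y) \<le> K \<and>
       (\<forall>y'\<in>M. norm (X j y' - X j y - FD (X j) y (y' - y)) \<le> K * (norm (y' - y))\<^sup>2))"

lemma field_bound_exists:
  fixes X :: "nat \<Rightarrow> 'a::euclidean_space \<Rightarrow> 'a"
  assumes M: "compact M" "M \<subseteq> U" and U: "open U" and X: "\<And>j. j < m \<Longrightarrow> Ck_on 2 U (X j)"
  obtains K where "field_bound m M X K"
proof -
  define good where "good j K \<longleftrightarrow> K \<ge> 0 \<and> (\<forall>y\<in>M. \<forall>u. norm (FD (X j) y u) \<le> K * norm u) \<and>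
      (\<forall>y\<in>M. norm (X j y) \<le> K) \<and>
      (\<forall>y\<in>M. \<forall>y'\<in>M. norm (X j y' - X j y - FD (X j) y (y' - y)) \<le> K * (norm (y' - y))\<^sup>2)" for j K
  have "\<exists>K. good j K" if j: "j < m" for j
  proof -
    note X2 = X[OF j, unfolded Ck_on_2]
    obtain K1 where K1: "K1 \<ge> 0" "\<And>x w. x \<in> M \<Longrightarrow> norm (FD (X j) x w) \<le> K1 * norm w"
      using FD_bound[OF X2 M] by blast
    obtain K2 where K2: "K2 \<ge> 0" "\<And>x y. x \<in> M \<Longrightarrow> y \<in> M \<Longrightarrow>
        norm (X j y - X j x - FD (X j) x (y - x)) \<le> K2 * (norm (y - x))\<^sup>2"
      using Taylor1_compact[OF X2 U M] by blast
    have "continuous_on M (X j)"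
      using Ck_on_differentiable_imp_continuous[OF X2] M continuous_on_subset by blast
    then have "bounded (X j ` M)" using M compact_continuous_image compact_imp_bounded by blast
    then obtain K3 where K3: "K3 > 0" "\<And>y. y \<in> M \<Longrightarrow> norm (X j y) \<le> K3" unfolding bounded_pos by auto
    let ?K = "K1 + K2 + K3"
    have "norm (FD (X j) y u) \<le> ?K * norm u" if "y \<in> M" for y u
      by (rule order_trans[OF K1(2)[OF that] mult_right_mono]) (use K2(1) K3(1) in auto)
    moreover have "norm (X j y) \<le> ?K" if "y \<in> M" for y using K3(2)[OF that] K1(1) K2(1) by linarith
    moreover have "norm (X j y' - X j y - FD (X j) y (y' - y)) \<le> ?K * (norm (y' - y))\<^sup>2" if "y \<in> M" "y' \<in> M" for y y'
      by (rule order_trans[OF K2(2)[OF that] mult_right_mono]) (use K1(1) K3(1) in auto)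
    ultimately show ?thesis using K1(1) K2(1) K3(1) unfolding good_def by (intro exI[of _ ?K]) auto
  qed
  then have "\<forall>j. \<exists>K. j < m \<longrightarrow> good j K" by blast
  from choice[OF this] obtain Kj where Kj: "\<And>j. j < m \<Longrightarrow> good j (Kj j)" by blast
  obtain K0 where K0: "K0 > 0" "\<And>y. y \<in> M \<Longrightarrow> norm y \<le> K0"
    using compact_imp_bounded[OF M(1)] unfolding bounded_pos by auto
  define K where "K = K0 + (\<Sum>j<m. Kj j)"
  have nn: "0 \<le> Kj j" if "j < m" for j using Kj[OF that] by (simp add: good_def)
  have sum0: "0 \<le> (\<Sum>j<m. Kj j)" by (intro sum_nonneg nn) auto
  have le: "Kj j \<le> K" if "j < m" for j
  proof -
    have "Kj j \<le> (\<Sum>j<m. Kj j)" by (rule member_le_sum) (use that nn in auto)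
    then show ?thesis using K0(1) by (simp add: K_def)
  qed
  show ?thesis
  proof (rule that[of K], unfold field_bound_def, intro conjI ballI allI impI)
    show "K \<ge> 0" using K0(1) sum0 by (simp add: K_def)
    show "norm y \<le> K" if "y \<in> M" for y using K0(2)[OF that] sum0 by (simp add: K_def)
    fix j assume j: "j < m"
    show "norm (FD (X j) y u) \<le> K * norm u" if "y \<in> M" for y u
    proof (rule order_trans)
      show "norm (FD (X j) y u) \<le> Kj j * norm u" using Kj[OF j] that by (simp add: good_def)
    qed (intro mult_right_mono le j norm_ge_zero)
    show "norm (X j y) \<le> K" if "y \<in> M" for y
      using Kj[OF j] that le[OF j] by (force simp: good_def)
    show "norm (X j y' - X j y - FD (X j) y (y' - y)) \<le> K * (norm (y' - y))\<^sup>2" if "y \<in> M" "y' \<in> M" for y y'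
    proof (rule order_trans)
      show "norm (X j y' - X j y - FD (X j) y (y' - y)) \<le> Kj j * (norm (y' - y))\<^sup>2"
        using Kj[OF j] that by (simp add: good_def)
    qed (intro mult_right_mono le j zero_le_power2)
  qed
qed

text \<open>An Ito part and a covariation are fixed for each field. The finitely many almost sure
  identities are combined before they are substituted into the equation for
  \<open>Y\<close>.\<close>

lemma stratonovich_solution_diffusion:
  fixes X :: "nat \<Rightarrow> 'a::euclidean_space \<Rightarrow> 'a"
  assumes W: "brownian_motions P F m W" and M: "compact M" "M \<subseteq> U" and U: "open U"
    and X: "\<And>j. j < m \<Longrightarrow> Ck_on 2 U (X j)"
    and K: "field_bound m M X K"
    and x: "x \<in> M" and Y: "stratonovich_solution P F m W M X x Y"
  obtains I C where "stratonovich_diffusion P F m W M X (\<lambda>j y u. FD (X j) y u) K x Y I C"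
proof -
  obtain J where J: "\<And>j. j < m \<Longrightarrow> stratonovich_integral P (\<lambda>t w. X j (Y t w)) (W j) (J j)"
    "\<And>t. t \<ge> 0 \<Longrightarrow> AE w in P. Y t w = x + (\<Sum>j<m. J j t w)"
    using Y unfolding stratonovich_solution_def by blast
  have "\<forall>j. \<exists>IC. j < m \<longrightarrow> ito_integral P (\<lambda>t w. X j (Y t w)) (W j) (fst IC) \<and>
      covariation P (\<lambda>t w. X j (Y t w)) (W j) (snd IC) \<and>
      (\<forall>t\<ge>0. AE w in P. J j t w = fst IC t w + (1/2) *\<^sub>R snd IC t w)"
    using J(1) unfolding stratonovich_integral_def by auto
  from choice[OF this] obtain IC where IC: "\<And>j. j < m \<Longrightarrow> ito_integral P (\<lambda>t w. X j (Y t w)) (W j) (fst (IC j)) \<and>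
      covariation P (\<lambda>t w. X j (Y t w)) (W j) (snd (IC j)) \<and>
      (\<forall>t\<ge>0. AE w in P. J j t w = fst (IC j) t w + (1/2) *\<^sub>R snd (IC j) t w)" by blast
  have Xc: "continuous_on U (X j)" if "j < m" for j
    using Ck_on_differentiable_imp_continuous X[OF that] unfolding Ck_on_2 by blast
  have "stratonovich_diffusion P F m W M X (\<lambda>j y u. FD (X j) y u) K x Y (\<lambda>j. fst (IC j)) (\<lambda>j. snd (IC j))"
  proof (intro stratonovich_diffusion.intro brownian.intro stratonovich_diffusion_axioms.intro)
    show "brownian_motions P F m W" by (rule W)
    show "compact M" "x \<in> M" by (rule M x)+
    show "0 \<le> K" using K by (simp add: field_bound_def)
    show "norm y \<le> K" if "y \<in> M" for y using K that by (simp add: field_bound_def)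
    fix j assume j: "j < m"
    show "continuous_on M (X j)" using Xc[OF j] M(2) continuous_on_subset by blast
    show "linear (\<lambda>u. FD (X j) y u)" if "y \<in> M" for y
      using linear_FD[OF X[OF j, unfolded Ck_on_2]] that M(2) by blast
    show "norm (FD (X j) y u) \<le> K * norm u" if "y \<in> M" for y u using K j that by (simp add: field_bound_def)
    show "norm (X j y) \<le> K" if "y \<in> M" for y using K j that by (simp add: field_bound_def)
    show "norm (X j y' - X j y - FD (X j) y (y' - y)) \<le> K * (norm (y' - y))\<^sup>2" if "y \<in> M" "y' \<in> M" for y y'
      using K j that by (simp add: field_bound_def)
    show "continuous_on M (\<lambda>y. FD (X j) y (X l y))" if "l < m" for l
      using continuous_on_FD_field[OF X[OF j, unfolded Ck_on_2] Xc[OF that]] M(2) continuous_on_subset by blast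
    show "ito_integral P (\<lambda>t w. X j (Y t w)) (W j) (fst (IC j))"
      "covariation P (\<lambda>t w. X j (Y t w)) (W j) (snd (IC j))" using IC[OF j] by auto
  next
    show "Y t \<in> F t \<rightarrow>\<^sub>M restrict_space borel M" if "0 \<le> t" for t
      using Y that unfolding stratonovich_solution_def by blast
    show "Y 0 w = x" "continuous_on {0..} (\<lambda>t. Y t w)" if "w \<in> space P" for w
      using Y that unfolding stratonovich_solution_def by auto
    show "AE w in P. Y t w = x + (\<Sum>j<m. fst (IC j) t w + (1/2) *\<^sub>R snd (IC j) t w)" if t: "0 \<le> t" for t
    proof -
      have "AE w in P. \<forall>j\<in>{..<m}. J j t w = fst (IC j) t w + (1/2) *\<^sub>R snd (IC j) t w"
      proof (rule AE_finite_allI)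
        show "AE w in P. J j t w = fst (IC j) t w + (1/2) *\<^sub>R snd (IC j) t w" if "j \<in> {..<m}" for j
          using IC[of j] t that by blast
      qed simp
      with J(2)[OF t] show ?thesis by eventually_elim simp
    qed
  qed
  then show ?thesis by (rule that)
qed

text \<open>The quotients \<open>q n\<close> have \<mu>-integral 0 by invariance at time 1/(n+1),
  converge pointwise on \<open>M\<close> to the generator applied to \<open>f\<close>, and are
  bounded uniformly, so dominated convergence gives the claim.\<close>

lemma invariant_probability_generator:
  fixes X :: "nat \<Rightarrow> 'a::euclidean_space \<Rightarrow> 'a" and f :: "'a \<Rightarrow> real"
  assumes W: "brownian_motions P F m W" and M: "compact M" "M \<subseteq> U" and U: "open U"
    and X: "\<And>j. j < m \<Longrightarrow> Ck_on 2 U (X j)"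
    and Y: "stratonovich_process P F m W M X Y" and \<mu>: "invariant_probability P M Y \<mu>"
    and f: "Ck_on 2 U f"
  shows "(\<integral>x. (\<Sum>j<m. (FD2 f x (X j x) (X j x) + FD f x (FD (X j) x (X j x))) / 2) \<partial>\<mu>) = 0"
proof -
  let ?S = "restrict_space borel M"
  obtain K where K: "field_bound m M X K"
    by (rule field_bound_exists[OF M U X])
  interpret \<mu>: prob_space \<mu> using \<mu> by (simp add: invariant_probability_def)
  interpret P: prob_space P using W by (simp add: brownian_motions_def)
  have sets\<mu>: "sets \<mu> = sets ?S" using \<mu> by (simp add: invariant_probability_def)
  have space\<mu>: "space \<mu> = M" using sets_eq_imp_space_eq[OF sets\<mu>] by (simp add: space_restrict_space)
  have sol: "stratonovich_solution P F m W M X x (Y x)" if "x \<in> M" for x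
    using Y that by (simp add: stratonovich_process_def)
  note f2 = f[unfolded Ck_on_2]
  have fM: "continuous_on M f"
    using Ck_on_differentiable_imp_continuous[OF f2] M continuous_on_subset by blast
  have fm: "f \<in> borel_measurable ?S" by (rule borel_measurable_continuous_on_restrict[OF fM])
  have "bounded (f ` M)" using fM M compact_continuous_image compact_imp_bounded by blast
  then obtain B where B: "B > 0" "\<And>y. y \<in> M \<Longrightarrow> \<bar>f y\<bar> \<le> B" unfolding bounded_pos by auto
  obtain K1 where K1: "K1 \<ge> 0" "\<And>y u. y \<in> M \<Longrightarrow> norm (FD f y u) \<le> K1 * norm u"
    using FD_bound[OF f2 M] by blast
  obtain K2 where K2: "K2 \<ge> 0" "\<And>x y. x \<in> M \<Longrightarrow> y \<in> M \<Longrightarrow> norm (f y - f x - FD f x (y - x)) \<le> K2 * (norm (y - x))\<^sup>2"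
    using Taylor1_compact[OF f2 U M] by blast
  let ?K1 = "K1 + K2"
  define gen where "gen x = (\<Sum>j<m. (FD2 f x (X j x) (X j x) + FD f x (FD (X j) x (X j x))) / 2)" for x
  define q where "q n x = real (Suc n) * ((\<integral>w. f (Y x (1 / Suc n) w) \<partial>P) - f x)" for n x
  have T: "transition_kernel P M Y t \<in> \<mu> \<rightarrow>\<^sub>M subprob_algebra ?S" if "t \<ge> 0" for t
  proof -
    have "transition_kernel P M Y t \<in> ?S \<rightarrow>\<^sub>M prob_algebra ?S"
      using Y that by (simp add: stratonovich_process_def)
    then have "transition_kernel P M Y t \<in> ?S \<rightarrow>\<^sub>M subprob_algebra ?S" by (rule measurable_prob_algebraD)
    then show ?thesis using measurable_cong_sets[OF sets\<mu> refl] by blast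
  qed
  have Tint: "(\<integral>y. f y \<partial>transition_kernel P M Y t x) = (\<integral>w. f (Y x t w) \<partial>P)" if "t \<ge> 0" "x \<in> M" for t x
  proof -
    have "Y x t \<in> F t \<rightarrow>\<^sub>M ?S" using sol[OF that(2)] that(1) by (simp add: stratonovich_solution_def)
    then have "Y x t \<in> P \<rightarrow>\<^sub>M ?S"
      using W by (intro measurable_from_subalg[of P "F t"]) (auto simp: brownian_motions_def)
    then show ?thesis unfolding transition_kernel_def by (rule integral_distr[OF _ fm])
  qed
  have inv: "(\<integral>x. (\<integral>w. f (Y x t w) \<partial>P) \<partial>\<mu>) = (\<integral>x. f x \<partial>\<mu>)" if t: "t \<ge> 0" for t
  proof -
    have "(\<integral>x. f x \<partial>\<mu>) = (\<integral>x. f x \<partial>(\<mu> \<bind> transition_kernel P M Y t))"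
      using \<mu> t by (simp add: invariant_probability_def)
    also have "\<dots> = (\<integral>x. (\<integral>y. f y \<partial>transition_kernel P M Y t x) \<partial>\<mu>)"
    proof (rule integral_bind[OF fm _ T[OF t], of B 1])
      show "\<bar>f x\<bar> \<le> B" if "x \<in> space ?S" for x using B(2) that by (simp add: space_restrict_space)
      show "finite_measure \<mu>" by unfold_locales
      show "AE x in \<mu>. emeasure (transition_kernel P M Y t x) (space (transition_kernel P M Y t x)) \<le> ennreal 1"
        using measurable_space[OF T[OF t]] by (intro AE_I2) (auto simp: space_subprob_algebra intro: subprob_space.emeasure_space_le_1)
    qed
    also have "\<dots> = (\<integral>x. (\<integral>w. f (Y x t w) \<partial>P) \<partial>\<mu>)"
      by (rule Bochner_Integration.integral_cong) (use Tint[OF t] space\<mu> in auto)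
    finally show ?thesis by simp
  qed
  \<comment> \<open>Measurability in the starting point comes from the transition kernel; the
    solutions are described for one starting point at a time.\<close>
  have Em: "(\<lambda>x. \<integral>w. f (Y x t w) \<partial>P) \<in> borel_measurable \<mu>" if t: "t \<ge> 0" for t
  proof -
    have "(\<lambda>x. \<integral>y. f y \<partial>transition_kernel P M Y t x) \<in> borel_measurable \<mu>"
      by (rule measurable_compose[OF T[OF t] integral_measurable_subprob_algebra[OF fm]])
    then show ?thesis by (rule measurable_cong[THEN iffD1, rotated]) (use Tint[OF t] space\<mu> in auto)
  qed
  have cont\<mu>: "g \<in> borel_measurable \<mu>" if "continuous_on U g" for g :: "'a \<Rightarrow> real"
    using borel_measurable_continuous_on_restrict[OF continuous_on_subset[OF that M(2)]] measurable_cong_sets[OF sets\<mu> refl]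
    by blast
  have f\<mu>: "f \<in> borel_measurable \<mu>" by (rule cont\<mu>[OF Ck_on_differentiable_imp_continuous[OF f2]])
  have q0: "(\<integral>x. q n x \<partial>\<mu>) = 0" for n
  proof -
    have "integrable \<mu> f" using B(2) f\<mu> space\<mu> by (intro \<mu>.integrable_const_bound[of _ B]) auto
    moreover have "integrable \<mu> (\<lambda>x. \<integral>w. f (Y x (1 / Suc n) w) \<partial>P)"
    proof (rule \<mu>.integrable_const_bound[of _ B])
      show "AE x in \<mu>. norm (\<integral>w. f (Y x (1 / Suc n) w) \<partial>P) \<le> B"
      proof (rule AE_I2)
        fix x assume "x \<in> space \<mu>"
        then have x: "x \<in> M" by (simp add: space\<mu>)
        obtain I C where "stratonovich_diffusion P F m W M X (\<lambda>j y u. FD (X j) y u) K x (Y x) I C"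
          by (rule stratonovich_solution_diffusion[OF W M U X K x sol[OF x]])
        then interpret stratonovich_diffusion P F m W M X "\<lambda>j y u. FD (X j) y u" K x "Y x" I C .
        have "norm (\<integral>w. f (Y x (1 / Suc n) w) \<partial>P) \<le> (\<integral>w. norm (f (Y x (1 / Suc n) w)) \<partial>P)"
          by (rule integral_norm_bound)
        also have "\<dots> \<le> (\<integral>w. B \<partial>P)"
        proof (rule integral_mono_AE')
          show "AE w in P. norm (f (Y x (1 / Suc n) w)) \<le> B" using B(2) Y_in_M by (intro AE_I2) auto
        qed (use B(1) in auto)
        finally show "norm (\<integral>w. f (Y x (1 / Suc n) w) \<partial>P) \<le> B" by (simp add: P.prob_space)
      qed
    qed (rule Em, simp)
    ultimately show ?thesis unfolding q_def using inv[of "1 / Suc n"] by simp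
  qed
  \<comment> \<open>This is the value of \<open>expectation_increment_bound\<close> divided by the
    time, with the trivial oscillation bound \<open>(K + K)\<^sup>2\<close> and t^2 \<le> t. It
    depends neither on \<open>x\<close> nor on \<open>n\<close>.\<close>
  let ?c = "?K1 * (2 * (m * (m * K\<^sup>2) + m * (m * (2 * ((K + K)\<^sup>2 + K^4 / 4))))) + m * (?K1 * (K * K) / 2)"
  have main: "(\<lambda>n. q n x) \<longlonglongrightarrow> gen x" "\<bar>q n x\<bar> \<le> ?c" if x: "x \<in> M" for x n
  proof -
    obtain I C where "stratonovich_diffusion P F m W M X (\<lambda>j y u. FD (X j) y u) K x (Y x) I C"
      by (rule stratonovich_solution_diffusion[OF W M U X K x sol[OF x]])
    then interpret stratonovich_diffusion P F m W M X "\<lambda>j y u. FD (X j) y u" K x "Y x" I C .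
    show "(\<lambda>n. q n x) \<longlonglongrightarrow> gen x" unfolding q_def gen_def by (rule generator_limit[OF f2 U M(2)])
    let ?t = "1 / real (Suc n)"
    have t: "0 < ?t" "?t \<le> 1" by auto
    have L: "bounded_linear (\<lambda>u. FD f x u)"
      using Ck_on_FD[OF f2] x M(2) has_derivative_bounded_linear by blast
    have e: "second_moment_le P (\<lambda>w. X j (Y x r w) - X j (Y x 0 w)) ((K + K)\<^sup>2)" if "j < m" "r \<in> {0..?t}" for j r
    proof (rule P.second_moment_le_bounded)
      show "(\<lambda>w. X j (Y x r w) - X j (Y x 0 w)) \<in> borel_measurable P"
        using that by (intro borel_measurable_diff fY_measurable X_cont) auto
      show "AE w in P. norm (X j (Y x r w) - X j (Y x 0 w)) \<le> K + K"
        using that by (intro AE_I2 order_trans[OF norm_triangle_ineq4] add_mono X_bound Y_in_M) auto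
    qed (use K in \<open>simp add: field_bound_def\<close>)
    have "\<bar>(\<integral>w. f (Y x ?t w) \<partial>P) - f x\<bar> \<le>
      ?K1 * (2 * (m * (m * (?t * K\<^sup>2)) + m * (m * (2 * (?t * (K + K)\<^sup>2 + ?t\<^sup>2 * K^4 / 4))))) + m * (?K1 * (?t * (K * K)) / 2)"
    proof (rule expectation_increment_bound[OF t(1) e fM L])
      show "0 \<le> ?K1" using K1(1) K2(1) by simp
      show "\<bar>FD f x u\<bar> \<le> ?K1 * norm u" for u
      proof -
        have "\<bar>FD f x u\<bar> \<le> K1 * norm u" using K1(2)[OF x, of u] by simp
        also have "\<dots> \<le> ?K1 * norm u" using K2(1) by (intro mult_right_mono) auto
        finally show ?thesis .
      qed
      show "\<bar>f y - f x - FD f x (y - x)\<bar> \<le> ?K1 * (norm (y - x))\<^sup>2" if "y \<in> M" for y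
      proof -
        have "\<bar>f y - f x - FD f x (y - x)\<bar> \<le> K2 * (norm (y - x))\<^sup>2" using K2(2)[OF x that] by simp
        also have "\<dots> \<le> ?K1 * (norm (y - x))\<^sup>2" using K1(1) by (intro mult_right_mono) auto
        finally show ?thesis .
      qed
    qed
    also have "\<dots> \<le> ?K1 * (2 * (m * (m * (?t * K\<^sup>2)) + m * (m * (2 * (?t * (K + K)\<^sup>2 + ?t * K^4 / 4))))) + m * (?K1 * (?t * (K * K)) / 2)"
    proof -
      have "?t\<^sup>2 \<le> ?t" unfolding power2_eq_square by (rule mult_left_le[OF t(2)]) (use t(1) in simp)
      then show ?thesis using K1(1) K2(1)
        by (intro add_right_mono mult_left_mono add_left_mono divide_right_mono mult_right_mono) auto
    qed
    also have "\<dots> = ?t * ?c" by (simp add: algebra_simps add_divide_distrib del: of_nat_Suc)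
    finally have "real (Suc n) * \<bar>(\<integral>w. f (Y x ?t w) \<partial>P) - f x\<bar> \<le> real (Suc n) * (?t * ?c)"
      by (intro mult_left_mono) auto
    also have "\<dots> = ?c" by (simp del: of_nat_Suc)
    finally show "\<bar>q n x\<bar> \<le> ?c" unfolding q_def by (simp only: abs_mult abs_of_nat)
  qed
  have genm: "gen \<in> borel_measurable \<mu>"
  proof (rule cont\<mu>)
    have Xc: "continuous_on U (X j)" if "j < m" for j
      using Ck_on_differentiable_imp_continuous X[OF that] unfolding Ck_on_2 by blast
    show "continuous_on U gen"
      unfolding gen_def[abs_def]
      by (intro continuous_intros continuous_on_FD2_fields[OF f2 U] continuous_on_FD_field[OF f2]
          continuous_on_FD_field[OF X[unfolded Ck_on_2]] Xc) auto
  qed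
  have "(\<lambda>n. \<integral>x. q n x \<partial>\<mu>) \<longlonglongrightarrow> (\<integral>x. gen x \<partial>\<mu>)"
  proof (rule integral_dominated_convergence[where w="\<lambda>_. ?c"])
    show "gen \<in> borel_measurable \<mu>" by (rule genm)
    show "q n \<in> borel_measurable \<mu>" for n
      unfolding q_def[abs_def] using Em[of "1 / Suc n"] f\<mu> by auto
    show "AE x in \<mu>. (\<lambda>n. q n x) \<longlonglongrightarrow> gen x" using main(1) space\<mu> by (intro AE_I2) auto
    show "AE x in \<mu>. norm (q n x) \<le> ?c" for n using main(2) space\<mu> by (intro AE_I2) auto
  qed simp
  then have "(\<integral>x. gen x \<partial>\<mu>) = 0" unfolding q0 by (simp add: LIMSEQ_const_iff)
  then show ?thesis unfolding gen_def .
qed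

section \<open>Smoothness of the Hamiltonian fields\<close>

lemma FD_eqI: "(f has_derivative f') (at x) \<Longrightarrow> FD f x w = f' w"
  using frechet_derivative_at by metis

section \<open>Closure properties of the C^k classes\<close>

lemma Ck_on_cong:
  assumes U: "open U" and eq: "\<And>x. x \<in> U \<Longrightarrow> f x = g x"
  shows "Ck_on k U f \<Longrightarrow> Ck_on k U g"
  using eq
proof (induction k arbitrary: f g)
  case 0
  then show ?case using continuous_on_cong[of U U f g] by simp
next
  case (Suc k)
  have d: "(g has_derivative frechet_derivative f (at x)) (at x)" if "x \<in> U" for x
    by (rule has_derivative_transform_within_open[OF Ck_on_FD[OF Suc.prems(1) that] U that]) (use Suc.prems(2) in auto)
  have "Ck_on k U (\<lambda>x. FD g x w)" for w
    by (rule Suc.IH[OF Ck_on_imp_FD[OF Suc.prems(1)]]) (use FD_eqI[OF d] in auto)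
  then show ?case using d by (auto simp: differentiable_def)
qed

lemma Ck_on_SucI:
  assumes U: "open U" and d: "\<And>x. x \<in> U \<Longrightarrow> (f has_derivative f' x) (at x)" and f': "\<And>w. Ck_on k U (\<lambda>x. f' x w)"
  shows "Ck_on (Suc k) U f"
proof -
  have "Ck_on k U (\<lambda>x. FD f x w)" for w
    by (rule Ck_on_cong[OF U _ f'[of w]]) (simp add: FD_eqI[OF d])
  then show ?thesis using d by (auto simp: differentiable_def)
qed

lemma Ck_on_const: "Ck_on k U (\<lambda>x. c)"
  by (induction k arbitrary: c) auto

lemma Ck_on_add:
  assumes U: "open U"
  shows "Ck_on k U f \<Longrightarrow> Ck_on k U g \<Longrightarrow> Ck_on k U (\<lambda>x. f x + g x)"
proof (induction k arbitrary: f g)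
  case 0
  then show ?case by (auto intro: continuous_on_add)
next
  case (Suc k)
  show ?case
    by (rule Ck_on_SucI[OF U has_derivative_add[OF Ck_on_FD[OF Suc.prems(1)] Ck_on_FD[OF Suc.prems(2)]]])
      (auto intro!: Suc.IH Ck_on_imp_FD Suc.prems)
qed

lemma Ck_on_sum:
  assumes "open U" "finite A" "\<And>i. i \<in> A \<Longrightarrow> Ck_on k U (f i)"
  shows "Ck_on k U (\<lambda>x. \<Sum>i\<in>A. f i x)"
  using assms(2,3) by (induction A rule: finite_induct) (auto intro: Ck_on_const Ck_on_add[OF assms(1)])

text \<open>By the product rule the derivative is a sum of two terms of the same bilinear shape in
  functions with fewer derivatives, so the induction runs over all \<open>f\<close> and
  \<open>g\<close>.\<close>

lemma Ck_on_bilinear: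
  assumes B: "bounded_bilinear B" and U: "open U"
  shows "Ck_on k U f \<Longrightarrow> Ck_on k U g \<Longrightarrow> Ck_on k U (\<lambda>x. B (f x) (g x))"
proof (induction k arbitrary: f g)
  case 0
  then show ?case by (auto intro: bounded_bilinear.continuous_on[OF B])
next
  case (Suc k)
  show ?case
  proof (rule Ck_on_SucI[OF U bounded_bilinear.FDERIV[OF B Ck_on_FD[OF Suc.prems(1)] Ck_on_FD[OF Suc.prems(2)]]])
    fix w
    have "Ck_on k U f" "Ck_on k U g" using Ck_on_mono[OF Suc.prems(1)] Ck_on_mono[OF Suc.prems(2)] by auto
    then show "Ck_on k U (\<lambda>x. B (f x) (FD g x w) + B (FD f x w) (g x))"
      using Suc.prems by (intro Ck_on_add[OF U] Suc.IH Ck_on_imp_FD)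
  qed
qed

lemma Ck_on_ident: "open U \<Longrightarrow> Ck_on k U (\<lambda>x. x)"
proof (induction k)
  case (Suc k)
  show ?case
    by (rule Ck_on_SucI[OF Suc.prems, of _ "\<lambda>_ w. w"]) (auto intro: has_derivative_ident Ck_on_const)
qed simp

section \<open>The commutator as a bilinear map, and gradients in coordinates\<close>

lemma lie_add_left: "lie (A + B) X = lie A X + lie B X"
  by (simp add: mat_of_inject[symmetric] mat_of_lie plus_su.rep_eq matrix_matrix_mult_def vec_eq_iff
      distrib_left distrib_right sum.distrib)

lemma lie_scaleR_left: "lie (c *\<^sub>R A) X = c *\<^sub>R lie A X"
proof -
  have "(c *\<^sub>R M) ** L = c *\<^sub>R (M ** L)" "L ** (c *\<^sub>R M) = c *\<^sub>R (L ** M)" for M L :: "complex^'a^'a"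
    by (simp_all add: matrix_matrix_mult_def vec_eq_iff scaleR_sum_right)
  then show ?thesis
    by (simp add: mat_of_inject[symmetric] mat_of_lie scaleR_su.rep_eq scaleR_diff_right)
qed

lemma lie_add_right: "lie X (A + B) = lie X A + lie X B"
  using lie_add_left[of A B X] lie_skew[of X "A + B"] lie_skew[of X A] lie_skew[of X B] by simp

lemma lie_scaleR_right: "lie X (c *\<^sub>R A) = c *\<^sub>R lie X A"
  using lie_scaleR_left[of c A X] lie_skew[of X "c *\<^sub>R A"] lie_skew[of X A] by simp

lemma bounded_bilinear_lie: "bounded_bilinear (lie :: 'n::card2 su \<Rightarrow> _)"
  unfolding bilinear_conv_bounded_bilinear[symmetric] bilinear_def
  by (auto intro!: linearI simp: lie_add_left lie_add_right lie_scaleR_left lie_scaleR_right)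

text \<open>\<open>grad\<close> is a definite description; existence and uniqueness come from
  representing the derivative in the orthonormal basis. The coordinate formula is what transfers
  smoothness from \<open>h\<close> to its gradient.\<close>

lemma GDERIV_grad:
  fixes f :: "'a::euclidean_space \<Rightarrow> real"
  assumes "f differentiable (at x)"
  shows "GDERIV f x :> grad f x" and "grad f x = (\<Sum>b\<in>Basis. FD f x b *\<^sub>R b)"
proof -
  have d: "(f has_derivative frechet_derivative f (at x)) (at x)" using assms frechet_derivative_works by blast
  interpret L: linear "frechet_derivative f (at x)" using d by (rule has_derivative_linear)
  let ?g = "\<Sum>b\<in>Basis. FD f x b *\<^sub>R b"
  have "inner w ?g = FD f x w" for w
  proof -
    have "FD f x w = FD f x (\<Sum>b\<in>Basis. inner w b *\<^sub>R b)" by (simp add: euclidean_representation)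
    then show ?thesis by (simp add: L.sum L.scale inner_sum_right mult.commute)
  qed
  then have G: "GDERIV f x :> ?g" unfolding gderiv_def using d by (simp add: inner_commute)
  have "g = ?g" if "GDERIV f x :> g" for g
  proof -
    have "(\<lambda>w. inner w g) = (\<lambda>w. inner w ?g)"
      using that G unfolding gderiv_def by (rule has_derivative_unique)
    from fun_cong[OF this] show ?thesis by (rule vector_eq_ldot[THEN iffD1, OF allI])
  qed
  with G show eq: "grad f x = ?g" unfolding grad_def by (rule the_equality)
  show "GDERIV f x :> grad f x" unfolding eq by (rule G)
qed

lemma inner_grad:
  fixes f :: "'a::euclidean_space \<Rightarrow> real"
  assumes "f differentiable (at x)" shows "inner (grad f x) w = FD f x w"
  using FD_eqI[OF GDERIV_grad(1)[OF assms, unfolded gderiv_def], of w] by (simp add: inner_commute)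

lemma Ck_on_ham_field:
  fixes h :: "'n::card2 su \<Rightarrow> real"
  assumes h: "smooth_on UNIV h" shows "Ck_on k UNIV (ham_field h)"
proof -
  have h': "Ck_on (Suc k) UNIV h" for k using h by (simp add: smooth_on_def)
  have "Ck_on k UNIV (\<lambda>x. \<Sum>b\<in>Basis. FD h x b *\<^sub>R b)"
    by (intro Ck_on_sum Ck_on_bilinear[OF bounded_bilinear_scaleR] Ck_on_imp_FD[OF h'] Ck_on_const) auto
  then have "Ck_on k UNIV (grad h)"
    by (rule Ck_on_cong[rotated 2, OF _ open_UNIV]) (use h'[of 0] in \<open>simp add: GDERIV_grad(2)\<close>)
  then have "Ck_on k UNIV (\<lambda>x. lie x (grad h x))"
    by (intro Ck_on_bilinear[OF bounded_bilinear_lie] Ck_on_ident) auto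
  then show ?thesis by (simp add: ham_field_def[abs_def])
qed

section \<open>Compactness of the orbits\<close>

lemma continuous_on_mat_of: "continuous_on UNIV (mat_of :: 'n::card2 su \<Rightarrow> _)"
proof -
  have "linear (mat_of :: 'n su \<Rightarrow> _)" by (rule linearI) (simp_all add: plus_su.rep_eq scaleR_su.rep_eq)
  then show ?thesis by (rule linear_continuous_on[OF linear_conv_bounded_linear[THEN iffD1]])
qed

lemma continuous_on_matrix_mult:
  fixes f g :: "'a::topological_space \<Rightarrow> complex^'n^'n"
  shows "continuous_on S f \<Longrightarrow> continuous_on S g \<Longrightarrow> continuous_on S (\<lambda>x. f x ** g x)"
  unfolding matrix_matrix_mult_def by (intro continuous_intros) auto

lemma continuous_on_casimirs: "continuous_on UNIV (\<lambda>\<Omega> :: 'n::card2 su. casimirs \<Omega> k)"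
proof -
  have "continuous_on UNIV (\<lambda>\<Omega> :: 'n su. mat_power (mat_of \<Omega>) k)" for k
    by (induction k) (auto intro: continuous_on_matrix_mult continuous_on_mat_of)
  then show ?thesis unfolding casimirs_def trace_def by (cases "2 \<le> k \<and> k \<le> CARD('n)") (auto intro!: continuous_intros)
qed

text \<open>Closedness is continuity of the trace invariants. Boundedness comes from the quadratic
  one alone: -tr \<Omega>^2 is the squared norm, hence constant on the orbit.\<close>

lemma compact_orbit: "compact (orbit z :: 'n::card2 su set)"
  unfolding compact_eq_bounded_closed
proof
  have "orbit z = (\<Inter>k. {\<Omega> :: 'n su. casimirs \<Omega> k = z k})" by (auto simp: orbit_def)
  moreover have "closed {\<Omega> :: 'n su. casimirs \<Omega> k = z k}" for k
    by (intro closed_Collect_eq continuous_on_casimirs continuous_on_const)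
  ultimately show "closed (orbit z :: 'n su set)" by auto
  have "(norm \<Omega>)\<^sup>2 = Re (- z 2)" if "\<Omega> \<in> orbit z" for \<Omega> :: "'n su"
  proof -
    have "casimirs \<Omega> 2 = z 2" using that by (simp add: orbit_def)
    then have "trace (mat_of \<Omega> ** mat_of \<Omega>) = z 2"
      using two_le_card[where 'a='n] by (simp add: casimirs_def numeral_2_eq_2)
    then show ?thesis by (simp add: power2_norm_eq_inner inner_su_def)
  qed
  then have "norm \<Omega> \<le> sqrt (Re (- z 2))" if "\<Omega> \<in> orbit z" for \<Omega> :: "'n su"
    using that by (metis norm_ge_zero order_refl real_sqrt_abs abs_of_nonneg)
  then show "bounded (orbit z :: 'n su set)" unfolding bounded_iff by blast
qed

section \<open>Expansion of the generator\<close>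

text \<open>The coefficient of \<kappa>^2 in the generator of the perturbed fields: the same
  second-order operator as \<open>L_fast\<close>, formed with the perturbations \<open>v\<close> in
  place of the Hamiltonian fields.\<close>

definition S_op :: "nat \<Rightarrow> (nat \<Rightarrow> 'n::finite su \<Rightarrow> 'n su) \<Rightarrow> ('n su \<Rightarrow> real) \<Rightarrow> 'n su \<Rightarrow> real" where
  "S_op m v f \<Omega> = (\<Sum>j<m. (FD2 f \<Omega> (v j \<Omega>) (v j \<Omega>) + FD f \<Omega> (FD (v j) \<Omega> (v j \<Omega>))) / 2)"

context
  fixes U :: "'n::card2 su set" and X v :: "nat \<Rightarrow> 'n su \<Rightarrow> 'n su" and m :: nat and f :: "'n su \<Rightarrow> real"
  assumes U: "open U" and X: "\<And>j. j < m \<Longrightarrow> Ck_on 2 U (X j)" and v: "\<And>j. j < m \<Longrightarrow> Ck_on 2 U (v j)"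
    and f: "Ck_on 2 U f"
begin

lemmas X2 = X[unfolded Ck_on_2] and v2 = v[unfolded Ck_on_2] and f2 = f[unfolded Ck_on_2]

lemma f_grad: "\<Omega> \<in> U \<Longrightarrow> inner (grad f \<Omega>) w = FD f \<Omega> w"
  using f2 by (intro inner_grad) auto

text \<open>The generator is quadratic in the fields, so the expansion in \<kappa> is exact and ends
  at \<kappa>^2. Symmetry of the second derivative combines both mixed terms into the single one
  that occurs in \<open>R_op\<close>.\<close>

lemma generator_expansion:
  fixes \<kappa> :: real
  assumes \<Omega>: "\<Omega> \<in> U"
  defines "Z \<equiv> \<lambda>j \<Omega>. X j \<Omega> + \<kappa> *\<^sub>R v j \<Omega>"
  shows "(\<Sum>j<m. (FD2 f \<Omega> (Z j \<Omega>) (Z j \<Omega>) + FD f \<Omega> (FD (Z j) \<Omega> (Z j \<Omega>))) / 2)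
    = L_fast m X f \<Omega> + \<kappa> * R_op m X v f \<Omega> + \<kappa>\<^sup>2 * S_op m v f \<Omega>"
proof -
  interpret Bl: linear "\<lambda>u. FD2 f \<Omega> u w" for w by (rule linear_FD2_left[OF f2 \<Omega>])
  interpret Br: linear "\<lambda>w. FD2 f \<Omega> u w" for u using linear_FD2_right[OF f2 U \<Omega>] .
  interpret L: linear "\<lambda>w. FD f \<Omega> w" by (rule linear_FD[OF f2 \<Omega>])
  have summand: "(FD2 f \<Omega> (Z j \<Omega>) (Z j \<Omega>) + FD f \<Omega> (FD (Z j) \<Omega> (Z j \<Omega>))) / 2
    = (1/2) * (FD2 f \<Omega> (X j \<Omega>) (X j \<Omega>) + FD f \<Omega> (FD (X j) \<Omega> (X j \<Omega>)))
      + \<kappa> * (FD2 f \<Omega> (X j \<Omega>) (v j \<Omega>) + (1/2) * FD f \<Omega> (FD (X j) \<Omega> (v j \<Omega>) + FD (v j) \<Omega> (X j \<Omega>)))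
      + \<kappa>\<^sup>2 * ((FD2 f \<Omega> (v j \<Omega>) (v j \<Omega>) + FD f \<Omega> (FD (v j) \<Omega> (v j \<Omega>))) / 2)" if j: "j < m" for j
  proof -
    interpret LX: linear "\<lambda>w. FD (X j) \<Omega> w" by (rule linear_FD[OF X2[OF j] \<Omega>])
    interpret Lv: linear "\<lambda>w. FD (v j) \<Omega> w" by (rule linear_FD[OF v2[OF j] \<Omega>])
    have "FD (Z j) \<Omega> w = FD (X j) \<Omega> w + \<kappa> *\<^sub>R FD (v j) \<Omega> w" for w
      unfolding Z_def
      by (rule FD_eqI[OF has_derivative_add[OF Ck_on_FD[OF X2[OF j] \<Omega>] has_derivative_scaleR_right[OF Ck_on_FD[OF v2[OF j] \<Omega>]]]])
    then show ?thesis
      unfolding Z_def using FD2_symmetric[OF f2 U \<Omega>, of "v j \<Omega>" "X j \<Omega>"]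
      by (simp add: Bl.add Br.add Bl.scale Br.scale L.add L.scale LX.add LX.scale Lv.add Lv.scale
          algebra_simps power2_eq_square add_divide_distrib)
  qed
  show ?thesis
    unfolding L_fast_def R_op_def S_op_def f_grad[OF \<Omega>]
    by (simp add: summand sum.distrib sum_distrib_left distrib_left)
qed

lemma continuous_operators:
  "continuous_on U (L_fast m X f)" "continuous_on U (R_op m X v f)" "continuous_on U (S_op m v f)"
proof -
  have Xc: "continuous_on U (X j)" and vc: "continuous_on U (v j)" if "j < m" for j
    using Ck_on_differentiable_imp_continuous X2[OF that] v2[OF that] by blast+
  note c = continuous_on_FD2_fields[OF f2 U] continuous_on_FD_field[OF f2]
    continuous_on_FD_field[OF X2] continuous_on_FD_field[OF v2] Xc vc
  have "continuous_on U (\<lambda>\<Omega>. (1/2) * (\<Sum>j<m. FD2 f \<Omega> (X j \<Omega>) (X j \<Omega>) + FD f \<Omega> (FD (X j) \<Omega> (X j \<Omega>))))"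
    by (intro continuous_intros c) auto
  then show "continuous_on U (L_fast m X f)"
    by (rule continuous_on_eq) (simp add: L_fast_def f_grad)
  have "continuous_on U (\<lambda>\<Omega>. (\<Sum>j<m. FD2 f \<Omega> (X j \<Omega>) (v j \<Omega>)) +
     (1/2) * (\<Sum>j<m. FD f \<Omega> (FD (X j) \<Omega> (v j \<Omega>) + FD (v j) \<Omega> (X j \<Omega>))))"
    by (intro continuous_intros c) auto
  then show "continuous_on U (R_op m X v f)"
    by (rule continuous_on_eq) (simp add: R_op_def f_grad)
  show "continuous_on U (S_op m v f)"
    unfolding S_op_def[abs_def] by (intro continuous_intros c) auto
qed

end

section \<open>First-order response of the averaged flux\<close>

lemma kks_probability_sets:
  assumes "kks_probability M \<mu>"
  shows "prob_space \<mu>" "sets \<mu> = sets (restrict_space borel M)"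
  using assms unfolding kks_probability_def liouville_volume_def by auto

lemma eventually_at_right_0:
  fixes \<kappa>0 :: real
  assumes "0 < \<kappa>0" "\<And>\<kappa>. 0 < \<kappa> \<Longrightarrow> \<kappa> < \<kappa>0 \<Longrightarrow> Q \<kappa>"
  shows "\<forall>\<^sub>F \<kappa> in at_right 0. Q \<kappa>"
  unfolding eventually_at_right_field using assms by blast

text \<open>Stated for an arbitrary \<open>flux\<close> with a corrector \<phi>, so that one
  argument covers both energy and enstrophy.\<close>

lemma flux_response_nonzero:
  fixes h :: "nat \<Rightarrow> 'n::card2 su \<Rightarrow> real" and v :: "nat \<Rightarrow> 'n su \<Rightarrow> 'n su"
    and P :: "'w measure" and Y :: "real \<Rightarrow> 'n su \<Rightarrow> real \<Rightarrow> 'w \<Rightarrow> 'n su" and \<phi> flux :: "'n su \<Rightarrow> real"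
  assumes mKKS: "kks_probability (orbit z) mKKS"
    and h: "\<And>j. j < m \<Longrightarrow> smooth_on UNIV (h j)"
    and v: "\<And>j. j < m \<Longrightarrow> smooth_near (orbit z) (v j)"
    and \<kappa>0: "\<kappa>0 > 0"
    and W: "brownian_motions P F m W"
    and Y: "\<And>\<kappa>. 0 < \<kappa> \<Longrightarrow> \<kappa> < \<kappa>0 \<Longrightarrow>
          stratonovich_process P F m W (orbit z) (perturbed_field h v \<kappa>) (Y \<kappa>)"
    and m\<kappa>: "\<And>\<kappa>. 0 < \<kappa> \<Longrightarrow> \<kappa> < \<kappa>0 \<Longrightarrow> invariant_probability P (orbit z) (Y \<kappa>) (m\<kappa> \<kappa>)"
    and q: "Ck_near 2 (orbit z) q"
    and r: "\<And>\<kappa>. 0 < \<kappa> \<Longrightarrow> \<kappa> < \<kappa>0 \<Longrightarrow> r \<kappa> \<in> borel_measurable mKKS"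
           "\<And>\<kappa> \<Omega>. 0 < \<kappa> \<Longrightarrow> \<kappa> < \<kappa>0 \<Longrightarrow> \<Omega> \<in> orbit z \<Longrightarrow> \<bar>r \<kappa> \<Omega>\<bar> \<le> C * \<kappa>\<^sup>2"
    and dens: "\<And>\<kappa>. 0 < \<kappa> \<Longrightarrow> \<kappa> < \<kappa>0 \<Longrightarrow> m\<kappa> \<kappa> = density mKKS (\<lambda>\<Omega>. ennreal (1 + \<kappa> * q \<Omega> + r \<kappa> \<Omega>))"
    and \<phi>: "Ck_near 2 (orbit z) \<phi>"
    and eq: "\<And>\<Omega>. \<Omega> \<in> orbit z \<Longrightarrow> L_fast m (\<lambda>j. ham_field (h j)) \<phi> \<Omega> = flux \<Omega>"
    and nz: "(\<integral>\<Omega>. R_op m (\<lambda>j. ham_field (h j)) v \<phi> \<Omega> \<partial>mKKS) \<noteq> 0"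
  shows "\<forall>\<^sub>F \<kappa> in at_right 0. (\<integral>\<Omega>. flux \<Omega> \<partial>m\<kappa> \<kappa>) \<noteq> 0"
proof -
  let ?M = "orbit z :: 'n su set" and ?X = "\<lambda>j. ham_field (h j)"
  obtain U\<phi> where U\<phi>: "open U\<phi>" "?M \<subseteq> U\<phi>" "Ck_on 2 U\<phi> \<phi>" using \<phi> unfolding Ck_near_def by blast
  have "\<forall>j. \<exists>U. j < m \<longrightarrow> open U \<and> ?M \<subseteq> U \<and> smooth_on U (v j)" using v unfolding smooth_near_def by blast
  from choice[OF this] obtain Uv where Uv: "\<And>j. j < m \<Longrightarrow> open (Uv j) \<and> ?M \<subseteq> Uv j \<and> smooth_on (Uv j) (v j)" by blast
  \<comment> \<open>A common domain for \<phi> and the perturbations; it is open because there are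
    finitely many fields.\<close>
  define U where "U = U\<phi> \<inter> (\<Inter>j<m. Uv j)"
  have U: "open U" "?M \<subseteq> U" using U\<phi> Uv by (auto simp: U_def intro!: open_Int open_INT)
  have \<phi>U: "Ck_on 2 U \<phi>" by (rule Ck_on_subset[OF U\<phi>(3)]) (auto simp: U_def)
  have XU: "Ck_on 2 U (?X j)" if "j < m" for j
    by (rule Ck_on_subset[OF Ck_on_ham_field[OF h[OF that]]]) simp
  have vU: "Ck_on 2 U (v j)" if "j < m" for j
    by (rule Ck_on_subset[of _ "Uv j"]) (use Uv[OF that] that in \<open>auto simp: U_def smooth_on_def\<close>)
  have pU: "Ck_on 2 U (perturbed_field h v \<kappa> j)" if "j < m" for j \<kappa>
    unfolding perturbed_field_def[abs_def]
    by (rule Ck_on_add[OF U(1) XU[OF that] Ck_on_bilinear[OF bounded_bilinear_scaleR U(1) Ck_on_const vU[OF that]]])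
  let ?L = "L_fast m ?X \<phi>" and ?R = "R_op m ?X v \<phi>" and ?S = "S_op m v \<phi>"
  have cont: "continuous_on U ?L" "continuous_on U ?R" "continuous_on U ?S"
    using continuous_operators[of U m ?X v \<phi>] U(1) XU vU \<phi>U by blast+
  have cM: "continuous_on ?M ?L" "continuous_on ?M ?R" "continuous_on ?M ?S"
    using cont[THEN continuous_on_subset[OF _ U(2)]] .
  have bd: "\<exists>B>0. \<forall>\<Omega>\<in>?M. \<bar>g \<Omega>\<bar> \<le> B" if "continuous_on ?M g" for g :: "'n su \<Rightarrow> real"
  proof -
    have "bounded (g ` ?M)" using that compact_orbit compact_continuous_image compact_imp_bounded by blast
    then show ?thesis unfolding bounded_pos by auto
  qed
  have qM: "continuous_on ?M q"
    using q Ck_on_differentiable_imp_continuous continuous_on_subset unfolding Ck_near_def Ck_on_2 by blast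
  obtain BR where BR: "BR > 0" "\<And>\<Omega>. \<Omega> \<in> ?M \<Longrightarrow> \<bar>?R \<Omega>\<bar> \<le> BR" using bd[OF cM(2)] by blast
  obtain BS where BS: "BS > 0" "\<And>\<Omega>. \<Omega> \<in> ?M \<Longrightarrow> \<bar>?S \<Omega>\<bar> \<le> BS" using bd[OF cM(3)] by blast
  obtain Bq where Bq: "Bq > 0" "\<And>\<Omega>. \<Omega> \<in> ?M \<Longrightarrow> \<bar>q \<Omega>\<bar> \<le> Bq" using bd[OF qM] by blast
  interpret K: prob_space mKKS by (rule kks_probability_sets(1)[OF mKKS])
  have setsK: "sets mKKS = sets (restrict_space borel ?M)" by (rule kks_probability_sets(2)[OF mKKS])
  have spaceK: "space mKKS = ?M" using sets_eq_imp_space_eq[OF setsK] by (simp add: space_restrict_space)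
  have meas: "g \<in> borel_measurable N" if "continuous_on ?M g" "sets N = sets (restrict_space borel ?M)"
    for g :: "'n su \<Rightarrow> real" and N
    using borel_measurable_continuous_on_restrict[OF that(1)] measurable_cong_sets[OF that(2) refl] by blast
  define a where "a = \<bar>\<integral>\<Omega>. ?R \<Omega> \<partial>mKKS\<bar>"
  have a: "a > 0" using nz by (simp add: a_def)
  define c where "c = Bq + \<bar>C\<bar>"
  have c: "c > 0" using Bq by (simp add: c_def)
  \<comment> \<open>\<open>\<kappa> < 1 / c\<close> keeps the density positive,
    \<open>\<kappa> < 1\<close> allows \<kappa>^2 \<le> \<kappa> in the bound on \<open>r\<close>,
    and the last condition makes the total error \<open>\<kappa> * (BS + BR * c)\<close> smaller
    than the leading integral, whose modulus is \<open>a\<close>.\<close>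
  define \<kappa>1 where "\<kappa>1 = min (min \<kappa>0 1) (min (1 / c) (a / (BS + BR * c)))"
  have BSR: "BS + BR * c > 0" using BS(1) BR(1) c by (simp add: add_pos_pos)
  have \<kappa>1: "\<kappa>1 > 0" using \<kappa>0 c a BSR by (simp add: \<kappa>1_def)
  show ?thesis
  proof (rule eventually_at_right_0[OF \<kappa>1])
    fix \<kappa> :: real assume k: "0 < \<kappa>" "\<kappa> < \<kappa>1"
    then have k0: "\<kappa> < \<kappa>0" and k1: "\<kappa> < 1" and "\<kappa> < 1 / c" and "\<kappa> < a / (BS + BR * c)" by (auto simp: \<kappa>1_def)
    then have kc: "\<kappa> * c < 1" and ka: "\<kappa> * (BS + BR * c) < a"
      using c BSR by (simp_all only: pos_less_divide_eq)
    interpret \<mu>: prob_space "m\<kappa> \<kappa>" using m\<kappa>[OF k(1) k0] by (simp add: invariant_probability_def)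
    have sets\<mu>: "sets (m\<kappa> \<kappa>) = sets (restrict_space borel ?M)"
      using m\<kappa>[OF k(1) k0] by (simp add: invariant_probability_def)
    have space\<mu>: "space (m\<kappa> \<kappa>) = ?M" using sets_eq_imp_space_eq[OF sets\<mu>] by (simp add: space_restrict_space)
    have "integrable (m\<kappa> \<kappa>) g" if cg: "continuous_on ?M g" for g :: "'n su \<Rightarrow> real"
    proof -
      obtain B where "\<And>\<Omega>. \<Omega> \<in> ?M \<Longrightarrow> \<bar>g \<Omega>\<bar> \<le> B" using bd[OF cg] by blast
      then show ?thesis
        using space\<mu> meas[OF cg sets\<mu>] by (intro \<mu>.integrable_const_bound[where B=B] AE_I2) auto
    qed
    note int\<mu> = this[OF cM(1)] this[OF cM(2)] this[OF cM(3)]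
    have "0 = (\<integral>\<Omega>. (\<Sum>j<m. (FD2 \<phi> \<Omega> (perturbed_field h v \<kappa> j \<Omega>) (perturbed_field h v \<kappa> j \<Omega>)
        + FD \<phi> \<Omega> (FD (perturbed_field h v \<kappa> j) \<Omega> (perturbed_field h v \<kappa> j \<Omega>))) / 2) \<partial>m\<kappa> \<kappa>)"
      by (rule invariant_probability_generator[OF W compact_orbit U(2,1) pU Y[OF k(1) k0] m\<kappa>[OF k(1) k0] \<phi>U, symmetric])
    also have "\<dots> = (\<integral>\<Omega>. ?L \<Omega> + \<kappa> * ?R \<Omega> + \<kappa>\<^sup>2 * ?S \<Omega> \<partial>m\<kappa> \<kappa>)"
    proof (rule Bochner_Integration.integral_cong[OF refl])
      fix \<Omega> assume "\<Omega> \<in> space (m\<kappa> \<kappa>)"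
      then have "\<Omega> \<in> U" using space\<mu> U(2) by blast
      from generator_expansion[where m = m and X = ?X and v = v and f = \<phi> and \<kappa> = \<kappa>, OF U(1) XU vU \<phi>U this]
      show "(\<Sum>j<m. (FD2 \<phi> \<Omega> (perturbed_field h v \<kappa> j \<Omega>) (perturbed_field h v \<kappa> j \<Omega>)
        + FD \<phi> \<Omega> (FD (perturbed_field h v \<kappa> j) \<Omega> (perturbed_field h v \<kappa> j \<Omega>))) / 2)
        = ?L \<Omega> + \<kappa> * ?R \<Omega> + \<kappa>\<^sup>2 * ?S \<Omega>"
        by (simp add: perturbed_field_def[abs_def])
    qed
    also have "\<dots> = (\<integral>\<Omega>. ?L \<Omega> \<partial>m\<kappa> \<kappa>) + \<kappa> * (\<integral>\<Omega>. ?R \<Omega> \<partial>m\<kappa> \<kappa>) + \<kappa>\<^sup>2 * (\<integral>\<Omega>. ?S \<Omega> \<partial>m\<kappa> \<kappa>)"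
      using int\<mu> by simp
    also have "(\<integral>\<Omega>. ?L \<Omega> \<partial>m\<kappa> \<kappa>) = (\<integral>\<Omega>. flux \<Omega> \<partial>m\<kappa> \<kappa>)"
      by (rule Bochner_Integration.integral_cong[OF refl]) (use space\<mu> eq in auto)
    \<comment> \<open>Since \<kappa> > 0, it remains to keep the bracket away from 0: it differs
      from the KKS integral of \<open>?R\<close> by at most
      \<open>\<kappa> * (BS + BR * c)\<close>.\<close>
    finally have id: "(\<integral>\<Omega>. flux \<Omega> \<partial>m\<kappa> \<kappa>) = - \<kappa> * ((\<integral>\<Omega>. ?R \<Omega> \<partial>m\<kappa> \<kappa>) + \<kappa> * (\<integral>\<Omega>. ?S \<Omega> \<partial>m\<kappa> \<kappa>))"
      by (simp add: algebra_simps power2_eq_square)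
    have S_le: "\<bar>\<integral>\<Omega>. ?S \<Omega> \<partial>m\<kappa> \<kappa>\<bar> \<le> BS"
    proof -
      have "\<bar>\<integral>\<Omega>. ?S \<Omega> \<partial>m\<kappa> \<kappa>\<bar> \<le> (\<integral>\<Omega>. \<bar>?S \<Omega>\<bar> \<partial>m\<kappa> \<kappa>)" by (rule integral_abs_bound)
      also have "\<dots> \<le> (\<integral>\<Omega>. BS \<partial>m\<kappa> \<kappa>)" using int\<mu>(3) BS(2) space\<mu> by (intro integral_mono) auto
      finally show ?thesis by (simp add: \<mu>.prob_space)
    qed
    let ?w = "\<lambda>\<Omega>. \<kappa> * q \<Omega> + r \<kappa> \<Omega>"
    have qm: "q \<in> borel_measurable mKKS" and Rm: "?R \<in> borel_measurable mKKS"
      by (rule meas[OF qM setsK] meas[OF cM(2) setsK])+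
    note [measurable] = qm Rm r(1)[OF k(1) k0]
    have w: "\<bar>?w \<Omega>\<bar> \<le> \<kappa> * c" if "\<Omega> \<in> ?M" for \<Omega>
    proof -
      have "\<bar>\<kappa> * q \<Omega>\<bar> \<le> \<kappa> * Bq" using Bq(2)[OF that] k(1) by (simp add: abs_mult)
      moreover have "C * \<kappa>\<^sup>2 \<le> \<kappa> * \<bar>C\<bar>"
      proof -
        have "C * \<kappa>\<^sup>2 \<le> \<bar>C\<bar> * \<kappa>\<^sup>2" by (intro mult_right_mono) auto
        also have "\<dots> \<le> \<bar>C\<bar> * \<kappa>" using k(1) k1 by (intro mult_left_mono) (auto simp: power2_eq_square)
        finally show ?thesis by (simp add: mult.commute)
      qed
      ultimately show ?thesis using r(2)[OF k(1) k0 that] unfolding c_def distrib_left by linarith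
    qed
    have "(\<integral>\<Omega>. ?R \<Omega> \<partial>m\<kappa> \<kappa>) = (\<integral>\<Omega>. (1 + \<kappa> * q \<Omega> + r \<kappa> \<Omega>) *\<^sub>R ?R \<Omega> \<partial>mKKS)"
      unfolding dens[OF k(1) k0]
    proof (rule integral_density)
      \<comment> \<open>Nonnegativity has to be checked, since \<open>ennreal\<close> would cut
        negative values of the expansion off to 0 and the integral formula would fail.\<close>
      show "AE \<Omega> in mKKS. 0 \<le> 1 + \<kappa> * q \<Omega> + r \<kappa> \<Omega>"
      proof (rule AE_I2)
        fix \<Omega> assume "\<Omega> \<in> space mKKS"
        then show "0 \<le> 1 + \<kappa> * q \<Omega> + r \<kappa> \<Omega>" using w[of \<Omega>] kc spaceK by auto
      qed
    qed measurable
    also have "\<dots> = (\<integral>\<Omega>. ?R \<Omega> + ?w \<Omega> * ?R \<Omega> \<partial>mKKS)" by (simp add: algebra_simps)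
    also have "\<dots> = (\<integral>\<Omega>. ?R \<Omega> \<partial>mKKS) + (\<integral>\<Omega>. ?w \<Omega> * ?R \<Omega> \<partial>mKKS)"
    proof (rule Bochner_Integration.integral_add)
      show "integrable mKKS ?R"
        using BR(2) spaceK by (intro K.integrable_const_bound[where B=BR] AE_I2 Rm) auto
      show "integrable mKKS (\<lambda>\<Omega>. ?w \<Omega> * ?R \<Omega>)"
      proof (rule K.integrable_const_bound[where B="\<kappa> * c * BR"], rule AE_I2)
        fix \<Omega> assume "\<Omega> \<in> space mKKS"
        then show "norm (?w \<Omega> * ?R \<Omega>) \<le> \<kappa> * c * BR"
          unfolding real_norm_def abs_mult using spaceK k(1) c by (intro mult_mono w BR(2)) auto
      qed measurable
    qed
    finally have R_eq: "(\<integral>\<Omega>. ?R \<Omega> \<partial>m\<kappa> \<kappa>) = (\<integral>\<Omega>. ?R \<Omega> \<partial>mKKS) + (\<integral>\<Omega>. ?w \<Omega> * ?R \<Omega> \<partial>mKKS)" .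
    have "\<bar>\<integral>\<Omega>. ?w \<Omega> * ?R \<Omega> \<partial>mKKS\<bar> \<le> \<kappa> * c * BR"
    proof -
      have b: "\<bar>?w \<Omega> * ?R \<Omega>\<bar> \<le> \<kappa> * c * BR" if "\<Omega> \<in> space mKKS" for \<Omega>
        unfolding abs_mult using that spaceK k(1) c by (intro mult_mono w BR(2)) auto
      have "\<bar>\<integral>\<Omega>. ?w \<Omega> * ?R \<Omega> \<partial>mKKS\<bar> \<le> (\<integral>\<Omega>. \<bar>?w \<Omega> * ?R \<Omega>\<bar> \<partial>mKKS)" by (rule integral_abs_bound)
      also have "\<dots> \<le> (\<integral>\<Omega>. \<kappa> * c * BR \<partial>mKKS)"
        by (rule integral_mono_AE') (use b k(1) c BR(1) in \<open>auto intro!: AE_I2\<close>)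
      finally show ?thesis by (simp add: K.prob_space)
    qed
    moreover have "\<bar>\<kappa> * (\<integral>\<Omega>. ?S \<Omega> \<partial>m\<kappa> \<kappa>)\<bar> \<le> \<kappa> * BS"
      using S_le k(1) by (simp add: abs_mult)
    moreover have "\<kappa> * (BS + BR * c) = \<kappa> * BS + \<kappa> * c * BR" by (simp add: algebra_simps)
    ultimately have "(\<integral>\<Omega>. ?R \<Omega> \<partial>m\<kappa> \<kappa>) + \<kappa> * (\<integral>\<Omega>. ?S \<Omega> \<partial>m\<kappa> \<kappa>) \<noteq> 0"
      using ka unfolding R_eq a_def by linarith
    then show "(\<integral>\<Omega>. flux \<Omega> \<partial>m\<kappa> \<kappa>) \<noteq> 0" unfolding id using k(1) by simp
  qed
qed

theorem corollary6p1:
  fixes z :: "nat \<Rightarrow> complex" and K \<kappa>0 C :: real and m :: nat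
    and h :: "nat \<Rightarrow> 'n::{card2,linorder} su \<Rightarrow> real"
    and v :: "nat \<Rightarrow> 'n su \<Rightarrow> 'n su"
    and q :: "'n su \<Rightarrow> real" and r :: "real \<Rightarrow> 'n su \<Rightarrow> real"
    and mKKS :: "'n su measure" and m\<kappa> :: "real \<Rightarrow> 'n su measure"
    and P :: "'w measure" and F :: "real \<Rightarrow> 'w measure"
    and W :: "nat \<Rightarrow> real \<Rightarrow> 'w \<Rightarrow> real"
    and Y :: "real \<Rightarrow> 'n su \<Rightarrow> real \<Rightarrow> 'w \<Rightarrow> 'n su"
    and \<phi>E \<phi>Z :: "'n su \<Rightarrow> real"
  assumes N: "CARD('n) \<ge> 3" "odd CARD('n)"
    and K: "K > 0"
    and z: "z \<in> interior_A_regular TYPE('n)"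
    and mKKS: "kks_probability (orbit z) mKKS"
    and h: "\<And>j. j < m \<Longrightarrow> smooth_on UNIV (h j)"
    and X0_generating: "bracket_generating (orbit z) m (\<lambda>j. ham_field (h j))"
    and v_smooth: "\<And>j. j < m \<Longrightarrow> smooth_near (orbit z) (v j)"
    and v_tangent: "\<And>j \<Omega>. j < m \<Longrightarrow> \<Omega> \<in> orbit z \<Longrightarrow> v j \<Omega> \<in> tangent_space \<Omega>"
    and v_nonham: "\<And>j. j < m \<Longrightarrow> \<not> hamiltonian_on (orbit z) (v j)"
    and \<kappa>0: "\<kappa>0 > 0"
    and X_generating: "\<And>\<kappa>. 0 < \<kappa> \<Longrightarrow> \<kappa> < \<kappa>0 \<Longrightarrow>
          bracket_generating (orbit z) m (perturbed_field h v \<kappa>)"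
    and W: "brownian_motions P F m W"
    and Y: "\<And>\<kappa>. 0 < \<kappa> \<Longrightarrow> \<kappa> < \<kappa>0 \<Longrightarrow>
          stratonovich_process P F m W (orbit z) (perturbed_field h v \<kappa>) (Y \<kappa>)"
    and m\<kappa>: "\<And>\<kappa>. 0 < \<kappa> \<Longrightarrow> \<kappa> < \<kappa>0 \<Longrightarrow>
          invariant_probability P (orbit z) (Y \<kappa>) (m\<kappa> \<kappa>)"
    and m\<kappa>_unique: "\<And>\<kappa> \<mu>. 0 < \<kappa> \<Longrightarrow> \<kappa> < \<kappa>0 \<Longrightarrow>
          invariant_probability P (orbit z) (Y \<kappa>) \<mu> \<Longrightarrow> \<mu> = m\<kappa> \<kappa>"
    and q: "Ck_near 2 (orbit z) q" "\<exists>\<Omega>\<in>orbit z. q \<Omega> \<noteq> 0" "(\<integral>\<Omega>. q \<Omega> \<partial>mKKS) = 0"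
    and r: "\<And>\<kappa>. 0 < \<kappa> \<Longrightarrow> \<kappa> < \<kappa>0 \<Longrightarrow> r \<kappa> \<in> borel_measurable mKKS"
           "\<And>\<kappa> \<Omega>. 0 < \<kappa> \<Longrightarrow> \<kappa> < \<kappa>0 \<Longrightarrow> \<Omega> \<in> orbit z \<Longrightarrow> \<bar>r \<kappa> \<Omega>\<bar> \<le> C * \<kappa>\<^sup>2"
    and m\<kappa>_density: "\<And>\<kappa>. 0 < \<kappa> \<Longrightarrow> \<kappa> < \<kappa>0 \<Longrightarrow>
          m\<kappa> \<kappa> = density mKKS (\<lambda>\<Omega>. ennreal (1 + \<kappa> * q \<Omega> + r \<kappa> \<Omega>))"
    and \<phi>E: "Ck_near 2 (orbit z) \<phi>E"
           "\<And>\<Omega>. \<Omega> \<in> orbit z \<Longrightarrow> L_fast m (\<lambda>j. ham_field (h j)) \<phi>E \<Omega> = energy_flux K \<Omega>"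
           "(\<integral>\<Omega>. \<phi>E \<Omega> \<partial>mKKS) = 0"
    and \<phi>Z: "Ck_near 2 (orbit z) \<phi>Z"
           "\<And>\<Omega>. \<Omega> \<in> orbit z \<Longrightarrow> L_fast m (\<lambda>j. ham_field (h j)) \<phi>Z \<Omega> = enstrophy_flux K \<Omega>"
           "(\<integral>\<Omega>. \<phi>Z \<Omega> \<partial>mKKS) = 0"
  shows "((\<integral>\<Omega>. R_op m (\<lambda>j. ham_field (h j)) v \<phi>E \<Omega> \<partial>mKKS) \<noteq> 0 \<longrightarrow>
            (\<forall>\<^sub>F \<kappa> in at_right 0. (\<integral>\<Omega>. energy_flux K \<Omega> \<partial>m\<kappa> \<kappa>) \<noteq> 0)) \<and>
         ((\<integral>\<Omega>. R_op m (\<lambda>j. ham_field (h j)) v \<phi>Z \<Omega> \<partial>mKKS) \<noteq> 0 \<longrightarrow>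
            (\<forall>\<^sub>F \<kappa> in at_right 0. (\<integral>\<Omega>. enstrophy_flux K \<Omega> \<partial>m\<kappa> \<kappa>) \<noteq> 0))"
  using flux_response_nonzero[OF mKKS h v_smooth \<kappa>0 W Y m\<kappa> q(1) r m\<kappa>_density \<phi>E(1,2)]
    flux_response_nonzero[OF mKKS h v_smooth \<kappa>0 W Y m\<kappa> q(1) r m\<kappa>_density \<phi>Z(1,2)]
  by blast

end
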